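(* Let $k\in\{1,2,3,4\}$, and let $p=1$ if $k\in\{1,2\}$ and $p=2$ if $k\in\{3,4\}$. Consider the semi-discrete scheme $$\frac{d}{dt}\mathbf{U}_{i,j}+\frac{\hat{\mathbf{F}}^k_{x,i+\frac12,j}-\hat{\mathbf{F}}^k_{x,i-\frac12,j}}{\Delta x}+\frac{\hat{\mathbf{F}}^k_{y,i,j+\frac12}-\hat{\mathbf{F}}^k_{y,i,j-\frac12}}{\Delta y}+\phi'(\mathbf{V}_{i,j})^\top\Big(\big(\tfrac{\partial B_x}{\partial x}\big)_{i,j}+\big(\tfrac{\partial B_y}{\partial y}\big)_{i,j}\Big)+\mathbf{C}_x(\mathbf{U}_{i,j})\big(\tfrac{\partial\mathbf{U}}{\partial x}\big)_{i,j}+\mathbf{C}_y(\mathbf{U}_{i,j})\big(\tfrac{\partial\mathbf{U}}{\partial y}\big)_{i,j}=0,$$ where $$\hat{\mathbf{F}}^k_{x,i+\frac12,j}=\tilde{\mathbf{F}}^{2p}_{x,i+\frac12,j}-\tfrac12\mathbf{D}_{x,i+\frac12,j}[\![\hat{\mathbf{V}}]\!]^k_{x,i+\frac12,j},\qquad \hat{\mathbf{F}}^k_{y,i,j+\frac12}=\tilde{\mathbf{F}}^{2p}_{y,i,j+\frac12}-\tfrac12\mathbf{D}_{y,i,j+\frac12}[\![\hat{\mathbf{V}}]\!]^k_{y,i,j+\frac12},$$ the jumps $[\![\hat{\mathbf{V}}]\!]^k$ are built from $k$-th order sign-preserving reconstructions of the scaled entropy variables, and the derivatives $(\partial B_x/\partial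 x)_{i,j}$, $(\partial B_y/\partial y)_{i,j}$, $(\partial\mathbf{U}/\partial x)_{i,j}$, $(\partial\mathbf{U}/\partial y)_{i,j}$ are discretized by second-order central differences if $k\in\{1,2\}$ and by fourth-order central differences if $k\in\{3,4\}$ (all objects being as defined in the context). Then the scheme is $k$-th order accurate and entropy stable, i.e. it satisfies $$\frac{d}{dt}\mathcal{E}(\mathbf{U}_{i,j})+\frac1{\Delta x}\big(\hat{\mathcal{Q}}^k_{x,i+\frac12,j}-\hat{\mathcal{Q}}^k_{x,i-\frac12,j}\big)+\frac1{\Delta y}\big(\hat{\mathcal{Q}}^k_{y,i,j+\frac12}-\hat{\mathcal{Q}}^k_{y,i,j-\frac12}\big)\le0,$$ where $$\hat{\mathcal{Q}}^k_{x,i+\frac12,j}=\tilde{\mathcal{Q}}^{2p}_{x,i+\frac12,j}-\tfrac12\bar{\mathbf{V}}_{i+\frac12,j}^\top\mathbf{D}_{x,i+\frac12,j}[\![\hat{\mathbf{V}}]\!]^k_{x,i+\frac12,j},\qquad \hat{\mathcal{Q}}^k_{y,i,j+\frac12}=\tilde{\mathcal{Q}}^{2p}_{y,i,j+\frac12}-\tfrac12\bar{\mathbf{V}}_{i,j+\frac12}^\top\mathbf{D}_{y,i,j+\frac12}[\![\hat{\mathbf{V}}]\!]^k_{y,i,j+\frac12}.$$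
   Context: **State and entropy.** $\mathbf{U}=(\rho,\rho\mathbf{u},p_\parallel,e,\mathbf{B})^\top\in\mathbb{R}^9$, $\mathbf{u}=(u_x,u_y,u_z)$, $\mathbf{B}=(B_x,B_y,B_z)$, $\mathbf{b}=\mathbf{B}/|\mathbf{B}|$, $p_\perp=e-\frac{\rho|\mathbf{u}|^2}{2}-\frac{|\mathbf{B}|^2}{2}-\frac{p_\parallel}{2}$, $\Delta P=p_\parallel-p_\perp$, $\beta_\perp=\rho/p_\perp$, $\beta_\parallel=\rho/p_\parallel$. All states lie in $\Omega=\{\rho>0,p_\parallel>0,p_\perp>0,\ p_m\le p_\parallel\le p_M\}$, $p_m=\frac{p_\perp^2}{6p_\perp+3|\mathbf{B}|^2}$, $p_M=|\mathbf{B}|^2+p_\perp$, with $\mathbf{B}\ne0$. Entropy $\mathcal{E}=-\rho s$, $s=\ln(p_\parallel p_\perp^2/\rho^5)$, entropy fluxes $\mathcal{Q}_x=-\rho u_xs$, $\mathcal{Q}_y=-\rho u_ys$; entropy variable $\mathbf{V}=\partial\mathcal{E}/\partial\mathbf{U}=(5-s-\beta_\perp|\mathbf{u}|^2,2\beta_\perp\mathbf{u},-\beta_\parallel+\beta_\perp,-2\beta_\perp,2\beta_\perp\mathbf{B})^\top$. Also $\phi=2\beta_\perp(\mathbf{u}\cdot\mathbf{B})=-\frac{V_2V_7+V_3V_8+V_4V_9}{V_6}$, $\phi'(\mathbf{V})=[0,\mathbf{B},0,\mathbf{u}\cdot\mathbf{B},\mathbf{u}]$ (gradient with respect to $\mathbf{V}$,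 row vector), and $\mathcal{F}_d=(2\rho+\beta_\perp|\mathbf{B}|^2)u_d$, $d\in\{x,y\}$. **PDE being discretized.** $\partial_t\mathbf{U}+\partial_x\mathbf{f}_x+\partial_y\mathbf{f}_y+\mathbf{C}_x\partial_x\mathbf{U}+\mathbf{C}_y\partial_y\mathbf{U}+\phi'(\mathbf{V})^\top(\nabla\cdot\mathbf{B})=0$, with, for $d\in\{x,y\}$ and $\mathbf{e}_d$ the unit vector in direction $d$, $\mathbf{f}_d$ having components: density $\rho u_d$; momentum $\rho u_d\mathbf{u}+(p_\perp+\frac{|\mathbf{B}|^2}2)\mathbf{e}_d-B_d\mathbf{B}$; parallel pressure $p_\parallel u_d$; energy $u_d(e+p_\perp+\frac{|\mathbf{B}|^2}{2})-B_d(\mathbf{B}\cdot\mathbf{u})$; magnetic field $u_d\mathbf{B}-B_d\mathbf{u}$. The matrix $\mathbf{C}_d(\mathbf{U})\in\mathbb{R}^{9\times 9}$ has zero rows 1, 7, 8, 9; rows 2–4 are $\frac{\partial}{\partial\mathbf{U}}(\Delta P\,b_db_l)$, $l=x,y,z$; row 5 is $2p_\parallel b_d\sum_{l\in\{x,y,z\}}b_l\frac{\partial u_l}{\partial\mathbf{U}}$; row 6 is $\frac{\partial}{\partial\mathbf{U}}(\Delta P\,b_d(\mathbf{b}\cdot\mathbf{u}))$. **Mesh notation.** Uniform mesh of size $\Delta x\times\Delta y$, nodes $(i,j)$; $\bar a_{i+\frac12,j}=\frac{a_{i+1,j}+a_{i,j}}2$, $[\![a]\!]_{i+\frac12,j}=a_{i+1,j}-a_{i,j}$,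 similarly in $y$. For two states $\mathbf{U}_l,\mathbf{U}_r$: $\bar a=\frac{a_l+a_r}{2}$, $[\![a]\!]=a_r-a_l$, $a^{\ln}=[\![a]\!]/[\![\ln a]\!]$ (equal to $a$ if $a_l=a_r$). The $2$nd and $4$th order central differences in $x$ are $\frac{a_{i+1,j}-a_{i-1,j}}{2\Delta x}$ and $\frac{8(a_{i+1,j}-a_{i-1,j})-(a_{i+2,j}-a_{i-2,j})}{12\Delta x}$, similarly in $y$. **Two-point entropy conservative flux.** $\tilde{\mathbf{F}}_x(\mathbf{U}_l,\mathbf{U}_r)$ has components $\tilde F^{(1)}=\rho^{\ln}\bar u_x$, $\tilde F^{(2)}=\frac{\bar\rho}{\bar\beta_\perp}+\bar u_x\tilde F^{(1)}+\frac12\overline{|\mathbf{B}|^2}-\bar B_x\bar B_x$, $\tilde F^{(3)}=\bar u_y\tilde F^{(1)}-\bar B_x\bar B_y$, $\tilde F^{(4)}=\bar u_z\tilde F^{(1)}-\bar B_x\bar B_z$, $\tilde F^{(5)}=\tilde F^{(1)}/\beta_\parallel^{\ln}$, $\tilde F^{(7)}=0$, $\tilde F^{(8)}=\frac1{\bar\beta_\perp}(\overline{\beta_\perp u_x}\bar B_y-\overline{\beta_\perp u_y}\bar B_x)$, $\tilde F^{(9)}=\frac1{\bar\beta_\perp}(\overline{\beta_\perp u_x}\bar B_z-\overline{\beta_\perp u_z}\bar B_x)$, and $$\tilde F^{(6)}=\tfrac12\Big[\tfrac{2}{\beta_\perp^{\ln}}-\overline{|\mathbf{u}|^2}\Big]\tilde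 F^{(1)}+\bar u_x\tilde F^{(2)}+\bar u_y\tilde F^{(3)}+\bar u_z\tilde F^{(4)}+\tfrac12\tilde F^{(5)}+\bar B_x\tilde F^{(7)}+\bar B_y\tilde F^{(8)}+\bar B_z\tilde F^{(9)}-\tfrac12\bar u_x\overline{|\mathbf{B}|^2}+(\bar u_x\bar B_x+\bar u_y\bar B_y+\bar u_z\bar B_z)\bar B_x.$$ $\tilde{\mathbf{F}}_y(\mathbf{U}_l,\mathbf{U}_r)$ is obtained by exchanging the roles of $x$ and $y$ (swapping components 2 and 3, and 7 and 8). The two-point entropy fluxes are $\tilde{\mathcal{Q}}_d(\mathbf{U}_l,\mathbf{U}_r)=\bar{\mathbf{V}}\cdot\tilde{\mathbf{F}}_d+\bar\phi\bar B_d-\bar{\mathcal{F}}_d$. **High-order versions.** $\tilde{\mathbf{F}}^2_{x,i+\frac12,j}=\tilde{\mathbf{F}}_x(\mathbf{U}_{i,j},\mathbf{U}_{i+1,j})$ and $\tilde{\mathbf{F}}^4_{x,i+\frac12,j}=\frac43\tilde{\mathbf{F}}_x(\mathbf{U}_{i,j},\mathbf{U}_{i+1,j})-\frac16\big(\tilde{\mathbf{F}}_x(\mathbf{U}_{i-1,j},\mathbf{U}_{i+1,j})+\tilde{\mathbf{F}}_x(\mathbf{U}_{i,j},\mathbf{U}_{i+2,j})\big)$; $\tilde{\mathcal{Q}}^2_x$, $\tilde{\mathcal{Q}}^4_x$ are defined by the same formulas with $\tilde{\mathcal{Q}}_x$ in place of $\tilde{\mathbf{F}}_x$; analogously in $y$.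 **Diffusion.** For $d\in\{x,y\}$ let $\mathcal{A}_d=\frac{\partial\mathbf{f}_d}{\partial\mathbf{U}}+\phi'(\mathbf{V})^\top B_d'(\mathbf{U})$, where $B_d'(\mathbf{U})=\partial B_d/\partial\mathbf{U}$. $\tilde R_d$ denotes an (invertible) $9\times9$ matrix of entropy-scaled right eigenvectors of $\mathcal{A}_d$: its columns are right eigenvectors of $\mathcal{A}_d$ and $\frac{\partial\mathbf{U}}{\partial\mathbf{V}}=\tilde R_d\tilde R_d^\top$. $\Lambda_d=\big(\max_{1\le m\le9}|\lambda_d^m|\big)\mathbf{I}_{9\times9}$, with $\lambda^m_d$ the eigenvalues of $\mathcal{A}_d$. The subscript $(i+\frac12,j)$ or $(i,j+\frac12)$ means evaluation at an averaged state at that interface. $\mathbf{D}_{x,i+\frac12,j}=\tilde R_{x,i+\frac12,j}\Lambda_{x,i+\frac12,j}\tilde R_{x,i+\frac12,j}^\top$, $\mathbf{D}_{y,i,j+\frac12}=\tilde R_{y,i,j+\frac12}\Lambda_{y,i,j+\frac12}\tilde R_{y,i,j+\frac12}^\top$. **Reconstruction.** Scaled entropy variables: $\mathbf{W}^\pm_{x,i,j}=\tilde R^\top_{x,i\pm\frac12,j}\mathbf{V}_{i,j}$. $\hat{\mathbf{W}}^\pm_{x,i,j}$ denotes a $k$-th order reconstruction of $\mathbf{W}^\pm_{x,i,j}$ in the $x$-direction (for $k=1$ simply $\hat{\mathbf{W}}^\pm=\mathbf{W}^\pm$; the paper uses MinMod for $k=2$ and ENO of order $k$ for $k=3,4$)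 that is sign preserving: for each component $1\le l\le9$, $$\mathrm{sign}\big(\hat{\mathbf{W}}^-_{x,i+1,j,l}-\hat{\mathbf{W}}^+_{x,i,j,l}\big)=\mathrm{sign}\big(\mathbf{W}^-_{x,i+1,j,l}-\mathbf{W}^+_{x,i,j,l}\big).$$ Then $\hat{\mathbf{V}}^\pm_{x,i,j}=\{\tilde R^\top_{x,i\pm\frac12,j}\}^{-1}\hat{\mathbf{W}}^\pm_{x,i,j}$ and $[\![\hat{\mathbf{V}}]\!]^k_{x,i+\frac12,j}=\hat{\mathbf{V}}^-_{x,i+1,j}-\hat{\mathbf{V}}^+_{x,i,j}$; analogously in $y$. **Accuracy.** "$k$-th order accurate" means that the local truncation error of the scheme on smooth solutions is $O(\Delta x^k+\Delta y^k)$.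
   Formalization: For k>1, "k-th order reconstruction" also requires divided differences of the interface traces across a cell to be accurate to O(h^k), since O(h^k) traces alone do not give a k-th order scheme; the averaged interface state is taken locally Lipschitz in the two states. *)

theory Defs
  imports "HOL-Analysis.Analysis"
begin

section \<open>States, fluxes and entropy of the CGL system\<close>

text \<open>A state is \<open>U = (\<rho>, \<rho> u, p_par, e, B)\<close> in \<open>\<real>\<^sup>9\<close>, with components numbered from 1.
  Only the directions \<open>x\<close> and \<open>y\<close> are discretized; \<open>u\<close> and \<open>B\<close> have three components.\<close>

type_synonym state = "real^9"

datatype dir = Xdir | Ydir

fun dir_idx :: "dir \<Rightarrow> 3" where
  "dir_idx Xdir = 1"
| "dir_idx Ydir = 2"

definition rho :: "state \<Rightarrow> real" where "rho U = U $ 1"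

definition vel :: "state \<Rightarrow> real^3" where
  "vel U = vector [U $ 2 / U $ 1, U $ 3 / U $ 1, U $ 4 / U $ 1]"

definition p_par :: "state \<Rightarrow> real" where "p_par U = U $ 5"

definition energy :: "state \<Rightarrow> real" where "energy U = U $ 6"

definition mag :: "state \<Rightarrow> real^3" where
  "mag U = vector [U $ 7, U $ 8, U $ 9]"

definition p_perp :: "state \<Rightarrow> real" where
  "p_perp U = energy U - rho U * (norm (vel U))\<^sup>2 / 2 - (norm (mag U))\<^sup>2 / 2 - p_par U / 2"

definition bdir :: "state \<Rightarrow> real^3" where
  "bdir U = mag U /\<^sub>R norm (mag U)"

definition delta_p :: "state \<Rightarrow> real" where "delta_p U = p_par U - p_perp U"

definition beta_perp :: "state \<Rightarrow> real" where "beta_perp U = rho U / p_perp U"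

definition beta_par :: "state \<Rightarrow> real" where "beta_par U = rho U / p_par U"

definition pos_states :: "state set" where
  "pos_states = {U. rho U > 0 \<and> p_par U > 0 \<and> p_perp U > 0}"

definition Omega :: "state set" where
  "Omega = {U \<in> pos_states. mag U \<noteq> 0 \<and>
     (p_perp U)\<^sup>2 / (6 * p_perp U + 3 * (norm (mag U))\<^sup>2) \<le> p_par U \<and>
     p_par U \<le> (norm (mag U))\<^sup>2 + p_perp U}"

definition spec_entropy :: "state \<Rightarrow> real" where
  "spec_entropy U = ln (p_par U * (p_perp U)\<^sup>2 / rho U ^ 5)"

definition entropy :: "state \<Rightarrow> real" where
  "entropy U = - rho U * spec_entropy U"

text \<open>The entropy variable \<open>V = \<partial>E/\<partial>U\<close> in closed form; see \<open>entropy_var_gradient\<close> below.\<close>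

definition entropy_var :: "state \<Rightarrow> real^9" where
  "entropy_var U = vector
     [5 - spec_entropy U - beta_perp U * (norm (vel U))\<^sup>2,
      2 * beta_perp U * vel U $ 1, 2 * beta_perp U * vel U $ 2, 2 * beta_perp U * vel U $ 3,
      - beta_par U + beta_perp U,
      - 2 * beta_perp U,
      2 * beta_perp U * mag U $ 1, 2 * beta_perp U * mag U $ 2, 2 * beta_perp U * mag U $ 3]"

definition phi :: "state \<Rightarrow> real" where
  "phi U = 2 * beta_perp U * (vel U \<bullet> mag U)"

text \<open>\<open>phi_grad U\<close> is the gradient of \<open>\<phi>\<close> as a function of the entropy variable, evaluated at
  \<open>V(U)\<close>; see \<open>phi_grad_gradient\<close> below.\<close>

definition phi_grad :: "state \<Rightarrow> real^9" where
  "phi_grad U = vector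
     [0, mag U $ 1, mag U $ 2, mag U $ 3, 0, vel U \<bullet> mag U, vel U $ 1, vel U $ 2, vel U $ 3]"

definition calF :: "dir \<Rightarrow> state \<Rightarrow> real" where
  "calF d U = (2 * rho U + beta_perp U * (norm (mag U))\<^sup>2) * vel U $ dir_idx d"

definition flux :: "dir \<Rightarrow> state \<Rightarrow> real^9" where
  "flux d U =
    (let u = vel U; B = mag U; ud = u $ dir_idx d; Bd = B $ dir_idx d;
         pt = p_perp U + (norm B)\<^sup>2 / 2;
         m = (rho U * ud) *\<^sub>R u + pt *\<^sub>R axis (dir_idx d) 1 - Bd *\<^sub>R B;
         F = ud *\<^sub>R B - Bd *\<^sub>R u
     in vector [rho U * ud, m $ 1, m $ 2, m $ 3, p_par U * ud,
                ud * (energy U + p_perp U + (norm B)\<^sup>2 / 2) - Bd * (B \<bullet> u),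
                F $ 1, F $ 2, F $ 3])"

definition grad :: "(state \<Rightarrow> real) \<Rightarrow> state \<Rightarrow> real^9" where
  "grad g U = (\<chi> j. frechet_derivative g (at U) (axis j 1))"

definition Cmat :: "dir \<Rightarrow> state \<Rightarrow> real^9^9" where
  "Cmat d U =
    (let r = (\<lambda>l. grad (\<lambda>W. delta_p W * bdir W $ dir_idx d * bdir W $ l) U)
     in vector [0, r 1, r 2, r 3,
       (2 * p_par U * bdir U $ dir_idx d) *\<^sub>R (\<Sum>l\<in>UNIV. bdir U $ l *\<^sub>R grad (\<lambda>W. vel W $ l) U),
       grad (\<lambda>W. delta_p W * bdir W $ dir_idx d * (bdir W \<bullet> vel W)) U,
       0, 0, 0])"

section \<open>Two-point entropy conservative fluxes\<close>

definition mean :: "(state \<Rightarrow> 'a::real_vector) \<Rightarrow> state \<Rightarrow> state \<Rightarrow> 'a" where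
  "mean g Ul Ur = (g Ul + g Ur) /\<^sub>R 2"

definition ln_mean :: "(state \<Rightarrow> real) \<Rightarrow> state \<Rightarrow> state \<Rightarrow> real" where
  "ln_mean g Ul Ur =
     (if g Ul = g Ur then g Ul else (g Ur - g Ul) / (ln (g Ur) - ln (g Ul)))"

definition ec_flux_x :: "state \<Rightarrow> state \<Rightarrow> real^9" where
  "ec_flux_x Ul Ur =
    (let ux = mean (\<lambda>U. vel U $ 1) Ul Ur; uy = mean (\<lambda>U. vel U $ 2) Ul Ur;
         uz = mean (\<lambda>U. vel U $ 3) Ul Ur;
         Bx = mean (\<lambda>U. mag U $ 1) Ul Ur; By = mean (\<lambda>U. mag U $ 2) Ul Ur;
         Bz = mean (\<lambda>U. mag U $ 3) Ul Ur;
         B2 = mean (\<lambda>U. (norm (mag U))\<^sup>2) Ul Ur; u2 = mean (\<lambda>U. (norm (vel U))\<^sup>2) Ul Ur;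
         bt = mean beta_perp Ul Ur;
         bux = mean (\<lambda>U. beta_perp U * vel U $ 1) Ul Ur;
         buy = mean (\<lambda>U. beta_perp U * vel U $ 2) Ul Ur;
         buz = mean (\<lambda>U. beta_perp U * vel U $ 3) Ul Ur;
         F1 = ln_mean rho Ul Ur * ux;
         F2 = mean rho Ul Ur / bt + ux * F1 + B2 / 2 - Bx * Bx;
         F3 = uy * F1 - Bx * By;
         F4 = uz * F1 - Bx * Bz;
         F5 = F1 / ln_mean beta_par Ul Ur;
         F7 = 0;
         F8 = (bux * By - buy * Bx) / bt;
         F9 = (bux * Bz - buz * Bx) / bt;
         F6 = (2 / ln_mean beta_perp Ul Ur - u2) * F1 / 2 + ux * F2 + uy * F3 + uz * F4 + F5 / 2
              + Bx * F7 + By * F8 + Bz * F9 - ux * B2 / 2 + (ux * Bx + uy * By + uz * Bz) * Bx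
     in vector [F1, F2, F3, F4, F5, F6, F7, F8, F9])"

definition swap_xy :: "real^9 \<Rightarrow> real^9" where
  "swap_xy U = vector [U $ 1, U $ 3, U $ 2, U $ 4, U $ 5, U $ 6, U $ 8, U $ 7, U $ 9]"

fun ec_flux :: "dir \<Rightarrow> state \<Rightarrow> state \<Rightarrow> real^9" where
  "ec_flux Xdir Ul Ur = ec_flux_x Ul Ur"
| "ec_flux Ydir Ul Ur = swap_xy (ec_flux_x (swap_xy Ul) (swap_xy Ur))"

definition ec_entropy_flux :: "dir \<Rightarrow> state \<Rightarrow> state \<Rightarrow> real" where
  "ec_entropy_flux d Ul Ur =
     mean entropy_var Ul Ur \<bullet> ec_flux d Ul Ur
     + mean phi Ul Ur * mean (\<lambda>U. mag U $ dir_idx d) Ul Ur - mean (calF d) Ul Ur"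

section \<open>Order \<open>2p\<close> building blocks along a grid line\<close>

text \<open>A grid line is a sequence \<open>a :: int \<Rightarrow> _\<close>. The interface between the nodes \<open>i\<close> and \<open>i + 1\<close>
  carries the index \<open>i\<close>. The parameter \<open>p\<close> takes the values 1 and 2.\<close>

definition high_order ::
  "nat \<Rightarrow> (state \<Rightarrow> state \<Rightarrow> 'a::real_vector) \<Rightarrow> (int \<Rightarrow> state) \<Rightarrow> int \<Rightarrow> 'a" where
  "high_order p g a i =
     (if p = 1 then g (a i) (a (i + 1))
      else (4 / 3) *\<^sub>R g (a i) (a (i + 1))
           - (1 / 6) *\<^sub>R (g (a (i - 1)) (a (i + 1)) + g (a i) (a (i + 2))))"

definition central_diff :: "nat \<Rightarrow> real \<Rightarrow> (int \<Rightarrow> 'a::real_vector) \<Rightarrow> int \<Rightarrow> 'a" where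
  "central_diff p h a i =
     (if p = 1 then (a (i + 1) - a (i - 1)) /\<^sub>R (2 * h)
      else (8 *\<^sub>R (a (i + 1) - a (i - 1)) - (a (i + 2) - a (i - 2))) /\<^sub>R (12 * h))"

section \<open>Diffusion operator\<close>

definition Amat :: "dir \<Rightarrow> state \<Rightarrow> real^9^9" where
  "Amat d U = jacobian (flux d) (at U)
     + (\<chi> i j. phi_grad U $ i * grad (\<lambda>W. mag W $ dir_idx d) U $ j)"

text \<open>\<open>\<partial>U/\<partial>V\<close>: the Jacobian at \<open>V(U)\<close> of the inverse of \<open>U \<mapsto> V(U)\<close>. That map is inverted on the
  open set \<open>pos_states\<close>, since \<open>Omega\<close> contains boundary points.\<close>

definition dU_dV :: "state \<Rightarrow> real^9^9" where
  "dU_dV U = jacobian (inv_into pos_states entropy_var) (at (entropy_var U))"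

definition entropy_scaled_eigenvectors :: "dir \<Rightarrow> state \<Rightarrow> real^9^9 \<Rightarrow> bool" where
  "entropy_scaled_eigenvectors d U R \<longleftrightarrow>
     invertible R \<and>
     (\<forall>m. \<exists>l::real. Amat d U *v column m R = l *s column m R) \<and>
     dU_dV U = R ** transpose R"

text \<open>An invertible real matrix of eigenvectors exists wherever this is used, so all
  eigenvalues are real.\<close>

definition max_abs_eigenvalue :: "real^9^9 \<Rightarrow> real" where
  "max_abs_eigenvalue A = Max {\<bar>l\<bar> | l. \<exists>v. v \<noteq> 0 \<and> A *v v = l *s v}"

definition Lambda :: "dir \<Rightarrow> state \<Rightarrow> real^9^9" where
  "Lambda d U = max_abs_eigenvalue (Amat d U) *\<^sub>R mat 1"

text \<open>\<open>avg U\<^sub>l U\<^sub>r\<close> is the averaged state at an interface. It is not required to satisfy the bounds on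
  \<open>p_par\<close> in \<open>Omega\<close>, nor \<open>B \<noteq> 0\<close>, which arithmetic averages need not inherit.\<close>

definition averaged_state :: "(state \<Rightarrow> state \<Rightarrow> state) \<Rightarrow> bool" where
  "averaged_state avg \<longleftrightarrow>
     (\<forall>U\<in>Omega. avg U U = U) \<and>
     (\<forall>Ul\<in>Omega. \<forall>Ur\<in>Omega. avg Ul Ur \<in> pos_states) \<and>
     (\<forall>K. compact K \<and> K \<subseteq> Omega \<times> Omega \<longrightarrow>
        (\<exists>L. L-lipschitz_on K (\<lambda>(Ul, Ur). avg Ul Ur)))"

definition diff_mat ::
  "(state \<Rightarrow> state \<Rightarrow> state) \<Rightarrow> (dir \<Rightarrow> state \<Rightarrow> real^9^9) \<Rightarrow> dir \<Rightarrow> (int \<Rightarrow> state) \<Rightarrow> int \<Rightarrow> real^9^9"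
where
  "diff_mat avg R d a i =
    (let U = avg (a i) (a (i + 1)) in R d U ** Lambda d U ** transpose (R d U))"

section \<open>Reconstruction of the scaled entropy variables\<close>

text \<open>The superscripts \<open>-\<close> and \<open>+\<close> at node \<open>i\<close> refer to the interfaces \<open>i - 1/2\<close> and \<open>i + 1/2\<close>.\<close>

datatype side = Minus | Plus

fun iface :: "side \<Rightarrow> int \<Rightarrow> int" where
  "iface Minus i = i - 1"
| "iface Plus i = i"

definition scaled_var :: "side \<Rightarrow> (int \<Rightarrow> real^9^9) \<Rightarrow> (int \<Rightarrow> real^9) \<Rightarrow> int \<Rightarrow> real^9" where
  "scaled_var s Rs v i = transpose (Rs (iface s i)) *v v i"

text \<open>A reconstruction \<open>rec\<close> maps the interface matrices \<open>Rs\<close> and the nodal entropy variables \<open>v\<close>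
  along a grid line, which together determine all the \<open>W\<^sup>\<plusminus>\<close>, to the reconstructed values. Passing
  \<open>Rs\<close> and \<open>v\<close> rather than \<open>W\<^sup>\<plusminus>\<close> alone also allows reconstructing the values
  \<open>transpose (Rs i) *v v m\<close> over a stencil of nodes \<open>m\<close> in the frame of one interface.\<close>

type_synonym reconstruction =
  "side \<Rightarrow> (int \<Rightarrow> real^9^9) \<Rightarrow> (int \<Rightarrow> real^9) \<Rightarrow> int \<Rightarrow> real^9"

definition sign_preserving :: "reconstruction \<Rightarrow> bool" where
  "sign_preserving rec \<longleftrightarrow>
     (\<forall>Rs v i l.
        sgn ((rec Minus Rs v (i + 1) - rec Plus Rs v i) $ l) =
        sgn ((scaled_var Minus Rs v (i + 1) - scaled_var Plus Rs v i) $ l))"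

definition iface_mats ::
  "(state \<Rightarrow> state \<Rightarrow> state) \<Rightarrow> (dir \<Rightarrow> state \<Rightarrow> real^9^9) \<Rightarrow> dir \<Rightarrow> (int \<Rightarrow> state) \<Rightarrow> int \<Rightarrow> real^9^9"
where
  "iface_mats avg R d a i = R d (avg (a i) (a (i + 1)))"

definition V_hat ::
  "(state \<Rightarrow> state \<Rightarrow> state) \<Rightarrow> (dir \<Rightarrow> state \<Rightarrow> real^9^9) \<Rightarrow> reconstruction \<Rightarrow>
   dir \<Rightarrow> side \<Rightarrow> (int \<Rightarrow> state) \<Rightarrow> int \<Rightarrow> real^9"
where
  "V_hat avg R rec d s a i =
     matrix_inv (transpose (iface_mats avg R d a (iface s i)))
       *v rec s (iface_mats avg R d a) (\<lambda>m. entropy_var (a m)) i"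

definition V_jump ::
  "(state \<Rightarrow> state \<Rightarrow> state) \<Rightarrow> (dir \<Rightarrow> state \<Rightarrow> real^9^9) \<Rightarrow> reconstruction \<Rightarrow>
   dir \<Rightarrow> (int \<Rightarrow> state) \<Rightarrow> int \<Rightarrow> real^9"
where
  "V_jump avg R rec d a i = V_hat avg R rec d Minus a (i + 1) - V_hat avg R rec d Plus a i"

section \<open>The semi-discrete scheme\<close>

definition num_flux ::
  "nat \<Rightarrow> (state \<Rightarrow> state \<Rightarrow> state) \<Rightarrow> (dir \<Rightarrow> state \<Rightarrow> real^9^9) \<Rightarrow> reconstruction \<Rightarrow>
   dir \<Rightarrow> (int \<Rightarrow> state) \<Rightarrow> int \<Rightarrow> real^9"
where
  "num_flux p avg R rec d a i =
     high_order p (ec_flux d) a i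
     - (1 / 2) *\<^sub>R (diff_mat avg R d a i *v V_jump avg R rec d a i)"

definition num_entropy_flux ::
  "nat \<Rightarrow> (state \<Rightarrow> state \<Rightarrow> state) \<Rightarrow> (dir \<Rightarrow> state \<Rightarrow> real^9^9) \<Rightarrow> reconstruction \<Rightarrow>
   dir \<Rightarrow> (int \<Rightarrow> state) \<Rightarrow> int \<Rightarrow> real"
where
  "num_entropy_flux p avg R rec d a i =
     high_order p (ec_entropy_flux d) a i
     - (1 / 2) * (mean entropy_var (a i) (a (i + 1))
                  \<bullet> (diff_mat avg R d a i *v V_jump avg R rec d a i))"

text \<open>All terms of the scheme other than the time derivative, at node \<open>(i, j)\<close>.\<close>

definition spatial_terms ::
  "nat \<Rightarrow> (state \<Rightarrow> state \<Rightarrow> state) \<Rightarrow> (dir \<Rightarrow> state \<Rightarrow> real^9^9) \<Rightarrow> reconstruction \<Rightarrow>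
   real \<Rightarrow> real \<Rightarrow> (int \<Rightarrow> int \<Rightarrow> state) \<Rightarrow> int \<Rightarrow> int \<Rightarrow> real^9"
where
  "spatial_terms p avg R rec dx dy U i j =
     (num_flux p avg R rec Xdir (\<lambda>m. U m j) i - num_flux p avg R rec Xdir (\<lambda>m. U m j) (i - 1)) /\<^sub>R dx
   + (num_flux p avg R rec Ydir (U i) j - num_flux p avg R rec Ydir (U i) (j - 1)) /\<^sub>R dy
   + (central_diff p dx (\<lambda>m. mag (U m j) $ 1) i + central_diff p dy (\<lambda>m. mag (U i m) $ 2) j)
       *\<^sub>R phi_grad (U i j)
   + Cmat Xdir (U i j) *v central_diff p dx (\<lambda>m. U m j) i
   + Cmat Ydir (U i j) *v central_diff p dy (U i) j"

section \<open>Smooth solutions and accuracy\<close>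

primrec Ck_on :: "nat \<Rightarrow> ('a::euclidean_space \<Rightarrow> 'b::real_normed_vector) \<Rightarrow> 'a set \<Rightarrow> bool" where
  "Ck_on 0 f S \<longleftrightarrow> continuous_on S f"
| "Ck_on (Suc n) f S \<longleftrightarrow>
     (\<forall>x\<in>S. f differentiable (at x)) \<and>
     (\<forall>b\<in>Basis. Ck_on n (\<lambda>x. frechet_derivative f (at x) b) S)"

definition smooth_on :: "('a::euclidean_space \<Rightarrow> 'b::real_normed_vector) \<Rightarrow> 'a set \<Rightarrow> bool" where
  "smooth_on f S \<longleftrightarrow> (\<forall>n. Ck_on n f S)"

text \<open>Space-time points are triples \<open>(t, x, y)\<close>.\<close>

definition solves_pde_at :: "(real \<times> real \<times> real \<Rightarrow> state) \<Rightarrow> real \<Rightarrow> real \<Rightarrow> real \<Rightarrow> bool" where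
  "solves_pde_at U t x y \<longleftrightarrow>
     vector_derivative (\<lambda>s. U (s, x, y)) (at t)
   + vector_derivative (\<lambda>\<xi>. flux Xdir (U (t, \<xi>, y))) (at x)
   + vector_derivative (\<lambda>\<eta>. flux Ydir (U (t, x, \<eta>))) (at y)
   + Cmat Xdir (U (t, x, y)) *v vector_derivative (\<lambda>\<xi>. U (t, \<xi>, y)) (at x)
   + Cmat Ydir (U (t, x, y)) *v vector_derivative (\<lambda>\<eta>. U (t, x, \<eta>)) (at y)
   + (deriv (\<lambda>\<xi>. mag (U (t, \<xi>, y)) $ 1) x + deriv (\<lambda>\<eta>. mag (U (t, x, \<eta>)) $ 2) y)
       *\<^sub>R phi_grad (U (t, x, y)) = 0"

definition smooth_solution :: "(real \<times> real \<times> real \<Rightarrow> state) \<Rightarrow> real set \<Rightarrow> bool" where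
  "smooth_solution U T \<longleftrightarrow>
     open T \<and> smooth_on U (T \<times> UNIV \<times> UNIV) \<and>
     (\<forall>t\<in>T. \<forall>x y. U (t, x, y) \<in> Omega \<and> solves_pde_at U t x y)"

definition node :: "real \<Rightarrow> real \<Rightarrow> int \<Rightarrow> real" where
  "node x0 h i = x0 + of_int i * h"

definition truncation_error ::
  "nat \<Rightarrow> (state \<Rightarrow> state \<Rightarrow> state) \<Rightarrow> (dir \<Rightarrow> state \<Rightarrow> real^9^9) \<Rightarrow> reconstruction \<Rightarrow>
   real \<Rightarrow> real \<Rightarrow> real \<Rightarrow> real \<Rightarrow> (real \<times> real \<times> real \<Rightarrow> state) \<Rightarrow> real \<Rightarrow> int \<Rightarrow> int \<Rightarrow> real^9"
where
  "truncation_error p avg R rec x0 y0 dx dy U t i j =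
     vector_derivative (\<lambda>s. U (s, node x0 dx i, node y0 dy j)) (at t)
   + spatial_terms p avg R rec dx dy (\<lambda>m n. U (t, node x0 dx m, node y0 dy n)) i j"

text \<open>The two traces of the reconstruction at interface \<open>i\<close> are \<open>V\<^sup>+\<close> at node \<open>i\<close> and \<open>V\<^sup>-\<close> at
  node \<open>i + 1\<close>.\<close>

definition V_trace ::
  "(state \<Rightarrow> state \<Rightarrow> state) \<Rightarrow> (dir \<Rightarrow> state \<Rightarrow> real^9^9) \<Rightarrow> reconstruction \<Rightarrow>
   dir \<Rightarrow> side \<Rightarrow> (int \<Rightarrow> state) \<Rightarrow> int \<Rightarrow> real^9"
where
  "V_trace avg R rec d s a i =
     (case s of Plus \<Rightarrow> V_hat avg R rec d Plus a i | Minus \<Rightarrow> V_hat avg R rec d Minus a (i + 1))"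

text \<open>Order of accuracy of a reconstruction, at a cell with center \<open>node x0 h i\<close> and for the profile
  \<open>w\<close> of the state along a line: the traces at the two interfaces of the cell, and their divided
  difference across it, agree with those of the exact entropy variable up to \<open>O(h^k)\<close>. Divided
  differences are included because the conservative scheme differences the fluxes and divides by
  \<open>h\<close>: an error that is merely \<open>O(h^k)\<close> at each interface costs one order there.\<close>

definition accurate_traces ::
  "(state \<Rightarrow> state \<Rightarrow> state) \<Rightarrow> (dir \<Rightarrow> state \<Rightarrow> real^9^9) \<Rightarrow> reconstruction \<Rightarrow>
   real \<Rightarrow> nat \<Rightarrow> dir \<Rightarrow> real \<Rightarrow> real \<Rightarrow> (real \<Rightarrow> state) \<Rightarrow> int \<Rightarrow> bool"
where
  "accurate_traces avg R rec C k d x0 h w i \<longleftrightarrow>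
    (let tr = (\<lambda>s. V_trace avg R rec d s (\<lambda>m. w (node x0 h m)));
         vl = entropy_var (w (node x0 h i - h / 2));
         vr = entropy_var (w (node x0 h i + h / 2))
     in \<forall>s. norm (tr s i - vr) \<le> C * h ^ k \<and>
            norm (tr s (i - 1) - vl) \<le> C * h ^ k \<and>
            norm ((tr s i - tr s (i - 1)) /\<^sub>R h - (vr - vl) /\<^sub>R h) \<le> C * h ^ k)"

text \<open>\<open>k\<close>-th order reconstruction, for \<open>k = 1\<close> the trivial one; for \<open>k > 1\<close> the order is measured along
  a solution \<open>U\<close>, uniformly over the nodes lying in a set \<open>K\<close> of space-time points.\<close>

definition trivial_reconstruction :: "reconstruction \<Rightarrow> bool" where
  "trivial_reconstruction rec \<longleftrightarrow> (\<forall>s Rs v i. rec s Rs v i = scaled_var s Rs v i)"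

definition accurate_reconstruction ::
  "(state \<Rightarrow> state \<Rightarrow> state) \<Rightarrow> (dir \<Rightarrow> state \<Rightarrow> real^9^9) \<Rightarrow> reconstruction \<Rightarrow>
   nat \<Rightarrow> real \<Rightarrow> real \<Rightarrow> (real \<times> real \<times> real \<Rightarrow> state) \<Rightarrow> (real \<times> real \<times> real) set \<Rightarrow> bool"
where
  "accurate_reconstruction avg R rec k x0 y0 U K \<longleftrightarrow>
     (\<exists>C. \<exists>\<delta>>0. \<forall>dx dy t i j.
        0 < dx \<and> dx < \<delta> \<and> 0 < dy \<and> dy < \<delta> \<and> (t, node x0 dx i, node y0 dy j) \<in> K \<longrightarrow>
        accurate_traces avg R rec C k Xdir x0 dx (\<lambda>\<xi>. U (t, \<xi>, node y0 dy j)) i \<and>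
        accurate_traces avg R rec C k Ydir y0 dy (\<lambda>\<eta>. U (t, node x0 dx i, \<eta>)) j)"

section \<open>The closed forms of \<open>V\<close> and \<open>\<phi>'(V)\<close> as gradients\<close>

lemma vector_9:
  "(vector [a, b, c, d, e, f, g, h, k] :: real^9) $ 1 = a"
  "(vector [a, b, c, d, e, f, g, h, k] :: real^9) $ 2 = b"
  "(vector [a, b, c, d, e, f, g, h, k] :: real^9) $ 3 = c"
  "(vector [a, b, c, d, e, f, g, h, k] :: real^9) $ 4 = d"
  "(vector [a, b, c, d, e, f, g, h, k] :: real^9) $ 5 = e"
  "(vector [a, b, c, d, e, f, g, h, k] :: real^9) $ 6 = f"
  "(vector [a, b, c, d, e, f, g, h, k] :: real^9) $ 7 = g"
  "(vector [a, b, c, d, e, f, g, h, k] :: real^9) $ 8 = h"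
  "(vector [a, b, c, d, e, f, g, h, k] :: real^9) $ 9 = k"
  unfolding vector_def by simp_all

lemma UNIV_9: "(UNIV :: 9 set) = {1, 2, 3, 4, 5, 6, 7, 8, 9}"
proof -
  have "card {1, 2, 3, 4, 5, 6, 7, 8, 9 :: 9} = CARD(9)" by simp
  then show ?thesis by (metis card_subset_eq finite_UNIV finite subset_UNIV)
qed

lemma sum_9: "(\<Sum>i\<in>(UNIV :: 9 set). f i) =
    f 1 + f 2 + f 3 + f 4 + f 5 + f 6 + f 7 + f 8 + (f 9 :: real)"
  unfolding UNIV_9 by simp

lemma norm_vector_3: "(norm (vector [a, b, c] :: real^3))\<^sup>2 = a\<^sup>2 + b\<^sup>2 + c\<^sup>2"
  unfolding power2_norm_eq_inner by (simp add: inner_vec_def sum_3 power2_eq_square)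

lemma p_perp_alt:
  "p_perp U = U $ 6 - ((U $ 2)\<^sup>2 + (U $ 3)\<^sup>2 + (U $ 4)\<^sup>2) / (2 * U $ 1)
    - ((U $ 7)\<^sup>2 + (U $ 8)\<^sup>2 + (U $ 9)\<^sup>2) / 2 - U $ 5 / 2"
proof -
  have "U $ 1 * ((U $ 2 / U $ 1)\<^sup>2 + (U $ 3 / U $ 1)\<^sup>2 + (U $ 4 / U $ 1)\<^sup>2)
      = ((U $ 2)\<^sup>2 + (U $ 3)\<^sup>2 + (U $ 4)\<^sup>2) / U $ 1"
    by (cases "U $ 1 = 0") (simp_all add: field_simps power2_eq_square)
  then show ?thesis
    by (simp add: p_perp_def energy_def rho_def p_par_def vel_def mag_def norm_vector_3)
qed

lemma entropy_var_gradient: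
  assumes "U \<in> pos_states"
  shows "GDERIV entropy U :> entropy_var U"
proof -
  have r: "U $ 1 > 0" and pp: "U $ 5 > 0" and pt: "p_perp U > 0"
    using assms by (auto simp: pos_states_def rho_def p_par_def)
  have u2: "(norm (vel U))\<^sup>2 = ((U $ 2)\<^sup>2 + (U $ 3)\<^sup>2 + (U $ 4)\<^sup>2) / (U $ 1)\<^sup>2"
    by (simp add: vel_def norm_vector_3 power_divide add_divide_distrib)
  have vc: "vel U $ 1 = U $ 2 / U $ 1" "vel U $ 2 = U $ 3 / U $ 1" "vel U $ 3 = U $ 4 / U $ 1"
    by (simp_all add: vel_def)
  note n = bounded_linear_imp_has_derivative[OF bounded_linear_vec_nth, of _ "at U"]
  note sq = has_derivative_power[OF n, of _ 2]
  have r2: "2 * U $ 1 \<noteq> 0" using r by simp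
  define P' where "P' = (\<lambda>h :: state. h $ 6
     - (U $ 2 * h $ 2 + U $ 3 * h $ 3 + U $ 4 * h $ 4) / U $ 1
     + ((U $ 2)\<^sup>2 + (U $ 3)\<^sup>2 + (U $ 4)\<^sup>2) * h $ 1 / (2 * (U $ 1)\<^sup>2)
     - (U $ 7 * h $ 7 + U $ 8 * h $ 8 + U $ 9 * h $ 9) - h $ 5 / 2)"
  note kin = has_derivative_divide'[OF has_derivative_add[OF has_derivative_add[OF
      sq[of 2] sq[of 3]] sq[of 4]] has_derivative_mult_right[OF n[of 1], of 2] r2]
  note magn = has_derivative_divide'[OF has_derivative_add[OF has_derivative_add[OF
      sq[of 7] sq[of 8]] sq[of 9]] has_derivative_const[of 2]]
  have P: "(p_perp has_derivative P') (at U)"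
    unfolding p_perp_alt[abs_def]
    apply (rule has_derivative_eq_rhs[OF has_derivative_diff[OF has_derivative_diff[OF
        has_derivative_diff[OF n[of 6] kin] magn] has_derivative_divide'[OF n[of 5] has_derivative_const[of 2]]]])
    using r
    apply (simp_all add: fun_eq_iff P'_def)
    apply (simp add: divide_simps power2_eq_square)
    apply (simp add: algebra_simps)
    done
  have r5: "U $ 1 ^ 5 \<noteq> 0" and pos: "U $ 5 * (p_perp U)\<^sup>2 / U $ 1 ^ 5 > 0"
    using r pp pt by simp_all
  note G = has_derivative_divide'[OF has_derivative_mult[OF n[of 5] has_derivative_power[OF P, of 2]]
      has_derivative_power[OF n[of 1], of 5] r5]
  have "(entropy has_derivative
     (\<lambda>h. - h $ 1 * spec_entropy U
        - U $ 1 * (h $ 5 / U $ 5 + 2 * P' h / p_perp U - 5 * h $ 1 / U $ 1))) (at U)"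
    unfolding entropy_def[abs_def] spec_entropy_def[abs_def] rho_def p_par_def
    apply (rule has_derivative_eq_rhs[OF has_derivative_mult[OF has_derivative_minus[OF n[of 1]]
        has_derivative_ln[OF pos G]]])
    using r pp pt
    apply (simp add: fun_eq_iff)
    apply (simp add: divide_simps)
    apply (simp add: algebra_simps eval_nat_numeral)
    done
  moreover have "- h $ 1 * spec_entropy U
        - U $ 1 * (h $ 5 / U $ 5 + 2 * P' h / p_perp U - 5 * h $ 1 / U $ 1) = h \<bullet> entropy_var U"
    for h :: state
    using r pp pt
    apply (simp add: inner_vec_def sum_9 entropy_var_def vector_9 u2 beta_perp_def beta_par_def
        rho_def p_par_def mag_def vc P'_def)
    apply (simp add: divide_simps power2_eq_square)
    apply (simp add: algebra_simps)
    done
  ultimately show ?thesis by (simp add: gderiv_def)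
qed

definition phi_of_V :: "real^9 \<Rightarrow> real" where
  "phi_of_V V = - (V $ 2 * V $ 7 + V $ 3 * V $ 8 + V $ 4 * V $ 9) / V $ 6"

lemma phi_eq_phi_of_V:
  assumes "U \<in> pos_states"
  shows "phi U = phi_of_V (entropy_var U)"
proof -
  have b: "beta_perp U > 0" using assms by (simp add: pos_states_def beta_perp_def)
  then show ?thesis
    by (simp add: phi_def phi_of_V_def entropy_var_def vector_9 inner_vec_def sum_3 field_simps)
qed

lemma phi_of_V_gradient:
  assumes V6: "V $ 6 \<noteq> 0"
  shows "GDERIV phi_of_V V :> vector
    [0, - V $ 7 / V $ 6, - V $ 8 / V $ 6, - V $ 9 / V $ 6, 0,
     (V $ 2 * V $ 7 + V $ 3 * V $ 8 + V $ 4 * V $ 9) / (V $ 6)\<^sup>2,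
     - V $ 2 / V $ 6, - V $ 3 / V $ 6, - V $ 4 / V $ 6]"
proof -
  note n = bounded_linear_imp_has_derivative[OF bounded_linear_vec_nth, of _ "at V"]
  note m = has_derivative_mult[OF n n]
  note q = has_derivative_divide'[OF has_derivative_minus[OF has_derivative_add[OF
      has_derivative_add[OF m[of 2 7] m[of 3 8]] m[of 4 9]]] n[of 6] V6]
  show ?thesis
    unfolding gderiv_def phi_of_V_def[abs_def]
    apply (rule has_derivative_eq_rhs[OF q])
    using V6
    apply (simp add: fun_eq_iff inner_vec_def sum_9 vector_9)
    apply (simp add: divide_simps power2_eq_square)
    apply (simp add: algebra_simps)
    done
qed

lemma phi_grad_gradient:
  assumes "U \<in> pos_states"
  shows "GDERIV phi_of_V (entropy_var U) :> phi_grad U"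
proof -
  have b: "beta_perp U > 0" using assms by (simp add: pos_states_def beta_perp_def)
  let ?b = "2 * beta_perp U"
  have c: "?b * x / ?b = x" "?b * x * (?b * y) / ?b\<^sup>2 = x * y" for x y
    using b by (simp_all add: power2_eq_square)
  have s: "(?b * x * (?b * y) + ?b * z * (?b * w) + ?b * p * (?b * q)) / ?b\<^sup>2
      = x * y + z * w + p * q" for x y z w p q
    by (simp only: add_divide_distrib c(2))
  have V6: "entropy_var U $ 6 \<noteq> 0" using b by (simp add: entropy_var_def vector_9)
  show ?thesis
    using phi_of_V_gradient[OF V6] c s
    by (simp add: entropy_var_def vector_9 phi_grad_def inner_vec_def sum_3 minus_divide_divide)
qed

end

theory Submission
  imports Defs "HOL-Real_Asymp.Real_Asymp"
begin

text \<open>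
  The two halves of the theorem rest on two different properties of the two-point fluxes.

  Entropy stability needs only algebra at a single time. The flux \<open>ec_flux d\<close> is symmetric and satisfies
  \<open>[V] \<bullet> F + [\<phi>] B = [calF]\<close>, where \<open>[_]\<close> is the jump and \<open>B\<close> the mean of \<open>B\<^sub>d\<close>
  (\<open>ec_condition\<close>). Hence testing a flux difference with \<open>V\<close> at a node, and adding \<open>\<phi>\<close> times the
  central difference of \<open>B\<^sub>d\<close>, gives exactly a difference of entropy fluxes; this is linear in the
  two-point values, so it passes from order two to order four. The source term supplies the
  \<open>\<phi>\<close>-term because \<open>V \<bullet> \<phi>'(V) = \<phi>\<close>, and the nonconservative products are invisible to the entropy
  because \<open>V\<close> annihilates \<open>C\<^sub>d\<close> from the left (\<open>entropy_var_Cmat\<close>). What remains are the diffusion terms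
  \<open>[V] \<bullet> D J\<close> with \<open>D = \<lambda> R R\<^sup>T\<close>: in the scaled variables this is \<open>\<lambda>\<close> times the inner product of
  the jump of \<open>W\<close> with the reconstructed jump, and by sign preservation every summand is nonnegative.

  For the accuracy, fix a node and let \<open>G(s)\<close> be the flux between the state at the node and the state at
  signed distance \<open>s\<close> along the grid line. By symmetry of the two-point flux, the difference of numerical
  fluxes across the cell is twice a central difference of \<open>G\<close> at \<open>0\<close>; so it suffices that \<open>G\<close> has a Taylor
  expansion with bounds uniform in the node, and that \<open>2 G'(0)\<close> is the derivative of the physical flux.
  Uniform expansions are handled by a small calculus (\<open>expands\<close>) closed under arithmetic, logarithms and
  logarithmic means; the relation between \<open>G'(0)\<close> and the flux derivative (\<open>half_slope\<close>) is closed under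
  the same operations, so both are checked on the means of which the flux is built.

  For the diffusion terms, \<open>R\<close> may be discontinuous in the state, but it enters only through
  \<open>D = \<lambda> R R\<^sup>T = \<lambda> \<partial>U/\<partial>V\<close>. The matrix \<open>\<partial>U/\<partial>V\<close> is rational in the state, by an explicit inverse of the
  entropy-variable map, and the spectral radius \<open>\<lambda>\<close> of \<open>A\<^sub>d\<close> is Lipschitz because the symmetrized matrix
  \<open>A\<^sub>d R R\<^sup>T\<close> turns it into a maximum of Rayleigh quotients (\<open>scaled_diffusion_lipschitz\<close>). So \<open>D\<close> varies by
  \<open>O(h)\<close> between neighbouring interfaces, and a jump that is \<open>O(h^k)\<close> with \<open>O(h^k)\<close> divided differences
  perturbs the truncation error by \<open>O(h^k)\<close> only.
\<close>

section \<open>Expansions uniform in a parameter\<close>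

definition near :: "'z set \<Rightarrow> ('z \<Rightarrow> real \<Rightarrow> bool) \<Rightarrow> bool" where
  "near Z P \<longleftrightarrow> (\<exists>\<delta>>0. \<forall>z\<in>Z. \<forall>s. \<bar>s\<bar> < \<delta> \<longrightarrow> P z s)"

lemma nearI: "0 < \<delta> \<Longrightarrow> (\<And>z s. z \<in> Z \<Longrightarrow> \<bar>s\<bar> < \<delta> \<Longrightarrow> P z s) \<Longrightarrow> near Z P"
  unfolding near_def by blast

lemma near_always: "(\<And>z s. z \<in> Z \<Longrightarrow> P z s) \<Longrightarrow> near Z P"
  unfolding near_def by (auto intro: exI[of _ 1])

lemma near_mono: "near Z P \<Longrightarrow> (\<And>z s. z \<in> Z \<Longrightarrow> P z s \<Longrightarrow> Q z s) \<Longrightarrow> near Z Q"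
  unfolding near_def by meson

lemma near_conj:
  assumes "near Z P" "near Z Q"
  shows "near Z (\<lambda>z s. P z s \<and> Q z s)"
proof -
  obtain d where d: "d > 0" "\<And>z s. z \<in> Z \<Longrightarrow> \<bar>s\<bar> < d \<Longrightarrow> P z s"
    using assms(1) unfolding near_def by blast
  obtain e where e: "e > 0" "\<And>z s. z \<in> Z \<Longrightarrow> \<bar>s\<bar> < e \<Longrightarrow> Q z s"
    using assms(2) unfolding near_def by blast
  show ?thesis by (rule nearI[of "min d e"]) (use d e in auto)
qed

lemma near_mono2:
  "near Z P \<Longrightarrow> near Z Q \<Longrightarrow> (\<And>z s. z \<in> Z \<Longrightarrow> P z s \<Longrightarrow> Q z s \<Longrightarrow> T z s) \<Longrightarrow> near Z T"
  using near_mono[OF near_conj] by blast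

lemma near_small: "0 < \<delta> \<Longrightarrow> near Z (\<lambda>z s. \<bar>s\<bar> < \<delta>)"
  by (rule nearI)

lemma near_zero: "near Z P \<Longrightarrow> z \<in> Z \<Longrightarrow> P z 0"
  unfolding near_def by force

text \<open>Taylor expansion of \<open>s \<mapsto> g z s\<close> at \<open>0\<close> to order \<open>n\<close> with remainder \<open>O(s^n)\<close>, bounded uniformly in
  \<open>z \<in> Z\<close>, written in nested form \<open>c\<^sub>0 + s (c\<^sub>1 + s (\<dots> + s r))\<close>. The recursion on \<open>n\<close> makes every closure
  property a short induction and avoids truncated products of polynomials.\<close>
fun expands :: "nat \<Rightarrow> 'z set \<Rightarrow> ('z \<Rightarrow> real \<Rightarrow> real) \<Rightarrow> bool" where
  "expands 0 Z g \<longleftrightarrow> (\<exists>M. near Z (\<lambda>z s. \<bar>g z s\<bar> \<le> M))"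
| "expands (Suc n) Z g \<longleftrightarrow> (\<exists>c h M. (\<forall>z\<in>Z. \<bar>c z\<bar> \<le> M) \<and> expands n Z h \<and>
     near Z (\<lambda>z s. g z s = c z + s * h z s))"

lemma expands_SucI:
  "(\<And>z. z \<in> Z \<Longrightarrow> \<bar>c z\<bar> \<le> M) \<Longrightarrow> expands n Z h \<Longrightarrow>
     near Z (\<lambda>z s. g z s = c z + s * h z s) \<Longrightarrow> expands (Suc n) Z g"
  by auto

lemma expands_SucE:
  assumes "expands (Suc n) Z g"
  obtains c h M where "\<And>z. z \<in> Z \<Longrightarrow> \<bar>c z\<bar> \<le> M" "0 \<le> M" "expands n Z h"
    "near Z (\<lambda>z s. g z s = c z + s * h z s)" "\<And>z. z \<in> Z \<Longrightarrow> c z = g z 0"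
proof -
  obtain c h M where *: "\<forall>z\<in>Z. \<bar>c z\<bar> \<le> M" "expands n Z h"
    "near Z (\<lambda>z s. g z s = c z + s * h z s)"
    using assms by auto
  show thesis
  proof (rule that[of c "\<bar>M\<bar>" h])
    show "\<And>z. z \<in> Z \<Longrightarrow> \<bar>c z\<bar> \<le> \<bar>M\<bar>" using *(1) by force
    show "\<And>z. z \<in> Z \<Longrightarrow> c z = g z 0" using near_zero[OF *(3)] by simp
  qed (use * in simp_all)
qed

lemma expands_Suc_split:
  assumes "expands (Suc n) Z g"
  obtains c h where "expands n Z h" "near Z (\<lambda>z s. g z s = c z + s * h z s)"
    "\<And>z. z \<in> Z \<Longrightarrow> c z = g z 0"
  using assms by (rule expands_SucE) (rule that)

lemma expands_cong:
  assumes "expands n Z g" "near Z (\<lambda>z s. f z s = g z s)"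
  shows "expands n Z f"
proof (cases n)
  case 0
  obtain M where "near Z (\<lambda>z s. \<bar>g z s\<bar> \<le> M)" using assms(1) 0 by auto
  then have "near Z (\<lambda>z s. \<bar>f z s\<bar> \<le> M)" using assms(2) by (rule near_mono2) simp
  then show ?thesis using 0 by auto
next
  case (Suc m)
  obtain c h M where *: "\<And>z. z \<in> Z \<Longrightarrow> \<bar>c z\<bar> \<le> M" "expands m Z h"
    "near Z (\<lambda>z s. g z s = c z + s * h z s)"
    using assms(1)[unfolded Suc] by (rule expands_SucE) blast
  show ?thesis unfolding Suc
    by (rule expands_SucI[OF *(1) *(2)]) (auto intro: near_mono2[OF *(3) assms(2)])
qed

lemma expands_pred: "expands (Suc n) Z g \<Longrightarrow> expands n Z g"
proof (induction n arbitrary: g)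
  case 0
  obtain c h M where *: "\<And>z. z \<in> Z \<Longrightarrow> \<bar>c z\<bar> \<le> M" "expands 0 Z h"
    "near Z (\<lambda>z s. g z s = c z + s * h z s)"
    using 0 by (rule expands_SucE) blast
  obtain N where N: "near Z (\<lambda>z s. \<bar>h z s\<bar> \<le> N)" using *(2) by auto
  have "near Z (\<lambda>z s. \<bar>g z s\<bar> \<le> M + N)"
  proof (rule near_mono2[OF near_conj[OF *(3) N] near_small[of 1]])
    fix z s assume z: "z \<in> Z" "g z s = c z + s * h z s \<and> \<bar>h z s\<bar> \<le> N" "\<bar>s\<bar> < 1"
    have "\<bar>s * h z s\<bar> \<le> 1 * N"
      unfolding abs_mult by (rule mult_mono) (use z in auto)
    then show "\<bar>g z s\<bar> \<le> M + N" using z *(1)[of z] by auto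
  qed simp
  then show ?case by auto
next
  case (Suc n)
  obtain c h M where *: "\<And>z. z \<in> Z \<Longrightarrow> \<bar>c z\<bar> \<le> M" "expands (Suc n) Z h"
    "near Z (\<lambda>z s. g z s = c z + s * h z s)"
    using Suc.prems by (rule expands_SucE) blast
  show ?case by (rule expands_SucI[OF *(1) Suc.IH[OF *(2)] *(3)])
qed

lemma expands_le: "expands n Z g \<Longrightarrow> m \<le> n \<Longrightarrow> expands m Z g"
  by (induction n) (auto simp: le_Suc_eq dest: expands_pred simp del: expands.simps)

lemma expands_param:
  assumes "\<And>z. z \<in> Z \<Longrightarrow> \<bar>c z\<bar> \<le> M"
  shows "expands n Z (\<lambda>z s. c z)"
  using assms
proof (induction n arbitrary: c M)
  case 0 then show ?case by (auto intro: near_always)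
next
  case (Suc n)
  show ?case
    by (rule expands_SucI[of _ c M _ "\<lambda>z s. 0"])
       (use Suc.prems Suc.IH[of "\<lambda>_. 0" 0] in \<open>auto intro: near_always\<close>)
qed

lemma expands_add:
  assumes "expands n Z f" "expands n Z g"
  shows "expands n Z (\<lambda>z s. f z s + g z s)"
  using assms
proof (induction n arbitrary: f g)
  case 0
  then obtain M N where "near Z (\<lambda>z s. \<bar>f z s\<bar> \<le> M)" "near Z (\<lambda>z s. \<bar>g z s\<bar> \<le> N)" by auto
  then have "near Z (\<lambda>z s. \<bar>f z s + g z s\<bar> \<le> M + N)" by (rule near_mono2) auto
  then show ?case by auto
next
  case (Suc n)
  obtain c h M where 1: "\<And>z. z \<in> Z \<Longrightarrow> \<bar>c z\<bar> \<le> M" "expands n Z h"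
    "near Z (\<lambda>z s. f z s = c z + s * h z s)"
    using Suc.prems(1) by (rule expands_SucE) blast
  obtain d k N where 2: "\<And>z. z \<in> Z \<Longrightarrow> \<bar>d z\<bar> \<le> N" "expands n Z k"
    "near Z (\<lambda>z s. g z s = d z + s * k z s)"
    using Suc.prems(2) by (rule expands_SucE) blast
  show ?case
  proof (rule expands_SucI)
    show "\<And>z. z \<in> Z \<Longrightarrow> \<bar>c z + d z\<bar> \<le> M + N" using 1(1) 2(1) by (smt (verit))
    show "expands n Z (\<lambda>z s. h z s + k z s)" by (rule Suc.IH[OF 1(2) 2(2)])
    show "near Z (\<lambda>z s. f z s + g z s = c z + d z + s * (h z s + k z s))"
      by (rule near_mono2[OF 1(3) 2(3)]) (simp add: algebra_simps)
  qed
qed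

text \<open>From \<open>(c + s h) g = c g + s h g\<close> and \<open>g = d + s k\<close> the quotient is \<open>c k + h g\<close>, whose factors expand to the
  lower order; this is why \<open>expands_pred\<close> is needed first.\<close>
lemma expands_mult:
  assumes "expands n Z f" "expands n Z g"
  shows "expands n Z (\<lambda>z s. f z s * g z s)"
  using assms
proof (induction n arbitrary: f g)
  case 0
  then obtain M N where "near Z (\<lambda>z s. \<bar>f z s\<bar> \<le> M)" "near Z (\<lambda>z s. \<bar>g z s\<bar> \<le> N)" by auto
  then have "near Z (\<lambda>z s. \<bar>f z s * g z s\<bar> \<le> \<bar>M\<bar> * \<bar>N\<bar>)"
    by (rule near_mono2) (unfold abs_mult, rule mult_mono, auto)
  then show ?case by auto
next
  case (Suc n)
  obtain c h M where 1: "\<And>z. z \<in> Z \<Longrightarrow> \<bar>c z\<bar> \<le> M" "expands n Z h"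
    "near Z (\<lambda>z s. f z s = c z + s * h z s)" "0 \<le> M"
    using Suc.prems(1) by (rule expands_SucE) blast
  obtain d k N where 2: "\<And>z. z \<in> Z \<Longrightarrow> \<bar>d z\<bar> \<le> N" "expands n Z k"
    "near Z (\<lambda>z s. g z s = d z + s * k z s)"
    using Suc.prems(2) by (rule expands_SucE) blast
  show ?case
  proof (rule expands_SucI)
    show "\<And>z. z \<in> Z \<Longrightarrow> \<bar>c z * d z\<bar> \<le> M * N"
      using 1(1,4) 2(1) by (auto simp: abs_mult intro!: mult_mono)
    show "expands n Z (\<lambda>z s. c z * k z s + h z s * g z s)"
      by (intro expands_add Suc.IH expands_param[OF 1(1)] 1(2) 2(2) expands_pred[OF Suc.prems(2)])
    show "near Z (\<lambda>z s. f z s * g z s = c z * d z + s * (c z * k z s + h z s * g z s))"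
      by (rule near_mono2[OF 1(3) 2(3)]) (simp add: algebra_simps)
  qed
qed

lemma near_lower_bound:
  assumes "expands (Suc n) Z g" "\<And>z. z \<in> Z \<Longrightarrow> m \<le> \<bar>g z 0\<bar>" "m > 0"
  shows "near Z (\<lambda>z s. m / 2 \<le> \<bar>g z s\<bar>)"
proof -
  have "expands (Suc 0) Z g" using expands_le[OF assms(1), of "Suc 0"] by simp
  then obtain c h M where 1: "expands 0 Z h"
    "near Z (\<lambda>z s. g z s = c z + s * h z s)" "\<And>z. z \<in> Z \<Longrightarrow> c z = g z 0"
    by (rule expands_SucE) blast
  obtain N where N: "near Z (\<lambda>z s. \<bar>h z s\<bar> \<le> N)" using 1(1) by auto
  have d: "m / (2 * (\<bar>N\<bar> + 1)) > 0" using assms(3) by simp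
  show ?thesis
  proof (rule near_mono2[OF near_conj[OF 1(2) N] near_small[OF d]])
    fix z s assume z: "z \<in> Z" "g z s = c z + s * h z s \<and> \<bar>h z s\<bar> \<le> N"
      "\<bar>s\<bar> < m / (2 * (\<bar>N\<bar> + 1))"
    have "\<bar>s * h z s\<bar> \<le> (m / (2 * (\<bar>N\<bar> + 1))) * (\<bar>N\<bar> + 1)"
      unfolding abs_mult by (rule mult_mono) (use z assms(3) in auto)
    also have "\<dots> = m / 2" by (simp add: field_simps)
    finally have "\<bar>s * h z s\<bar> \<le> m / 2" .
    moreover have "m \<le> \<bar>c z\<bar>" using assms(2)[OF z(1)] 1(3)[OF z(1)] by simp
    moreover have "\<bar>c z\<bar> \<le> \<bar>g z s\<bar> + \<bar>s * h z s\<bar>" using z(2) by linarith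
    ultimately show "m / 2 \<le> \<bar>g z s\<bar>" by linarith
  qed
qed

text \<open>With \<open>g = c + s h\<close> one has \<open>1/g = 1/c - s h / (c g)\<close>, and \<open>1/g\<close> on the right is covered by the
  induction hypothesis.\<close>
lemma expands_inverse_near:
  assumes "expands n Z g" "near Z (\<lambda>z s. m \<le> \<bar>g z s\<bar>)" "m > 0"
  shows "expands n Z (\<lambda>z s. inverse (g z s))"
  using assms(1)
proof (induction n)
  case 0
  have "near Z (\<lambda>z s. \<bar>inverse (g z s)\<bar> \<le> inverse m)"
    using assms(2) by (rule near_mono) (use assms(3) in \<open>simp add: le_imp_inverse_le\<close>)
  then show ?case by auto
next
  case (Suc n)
  obtain c h M where 1: "expands n Z h"
    "near Z (\<lambda>z s. g z s = c z + s * h z s)" "\<And>z. z \<in> Z \<Longrightarrow> c z = g z 0"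
    using Suc.prems by (rule expands_SucE) blast
  have c: "m \<le> \<bar>c z\<bar>" if "z \<in> Z" for z using near_zero[OF assms(2) that] 1(3)[OF that] by simp
  have ic: "\<bar>inverse (c z)\<bar> \<le> inverse m" if "z \<in> Z" for z
    using c[OF that] assms(3) by (simp add: le_imp_inverse_le)
  show ?case
  proof (rule expands_SucI[OF ic])
    have "expands n Z (\<lambda>z s. h z s * inverse (c z) * inverse (g z s))"
      by (intro expands_mult 1 Suc.IH expands_pred[OF Suc.prems] expands_param[OF ic])
    from expands_mult[OF expands_param[of Z "\<lambda>_. -1" 1] this]
    show "expands n Z (\<lambda>z s. - 1 * (h z s * inverse (c z) * inverse (g z s)))" by simp
    show "near Z (\<lambda>z s. inverse (g z s) = inverse (c z) + s * (- 1 * (h z s * inverse (c z) * inverse (g z s))))"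
    proof (rule near_mono2[OF 1(2) assms(2)])
      fix z s assume z: "z \<in> Z" "g z s = c z + s * h z s" "m \<le> \<bar>g z s\<bar>"
      have "c z \<noteq> 0" "g z s \<noteq> 0" using c[OF z(1)] z(3) assms(3) by auto
      moreover have "s * h z s = g z s - c z" using z(2) by simp
      ultimately show "inverse (g z s) = inverse (c z) + s * (- 1 * (h z s * inverse (c z) * inverse (g z s)))"
        by (simp add: field_simps)
    qed
  qed
qed

text \<open>The inner function must vanish at \<open>0\<close>, hence its form \<open>s * h z s\<close>. Writing \<open>f x = c + x k x\<close>, the quotient is
  \<open>h\<close> times the composition of \<open>k\<close> with the same inner function.\<close>
lemma expands_compose:
  assumes "expands n Z h" "expands n {()} (\<lambda>_. f)"
  shows "expands n Z (\<lambda>z s. f (s * h z s))"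
  using assms
proof (induction n arbitrary: f)
  case 0
  obtain N where N: "near Z (\<lambda>z s. \<bar>h z s\<bar> \<le> N)" using 0 by auto
  obtain M d where M: "d > 0" "\<And>s. \<bar>s\<bar> < d \<Longrightarrow> \<bar>f s\<bar> \<le> M" using 0 by (auto simp: near_def)
  have "near Z (\<lambda>z s. \<bar>f (s * h z s)\<bar> \<le> M)"
  proof (rule near_mono2[OF N near_small[of "d / (\<bar>N\<bar> + 1)"]])
    show "d / (\<bar>N\<bar> + 1) > 0" using M by simp
    fix z s assume z: "z \<in> Z" "\<bar>h z s\<bar> \<le> N" "\<bar>s\<bar> < d / (\<bar>N\<bar> + 1)"
    have "\<bar>s * h z s\<bar> \<le> \<bar>s\<bar> * (\<bar>N\<bar> + 1)"
      unfolding abs_mult by (rule mult_mono) (use z in auto)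
    also have "\<dots> < d" using z(3) by (simp add: field_simps)
    finally show "\<bar>f (s * h z s)\<bar> \<le> M" using M by simp
  qed
  then show ?case by auto
next
  case (Suc n)
  have hn: "expands n Z h" by (rule expands_pred[OF Suc.prems(1)])
  have "expands 0 Z h" using expands_le[OF hn, of 0] by simp
  then obtain N where N: "near Z (\<lambda>z s. \<bar>h z s\<bar> \<le> N)" by auto
  obtain c k M where 2: "\<bar>c ()\<bar> \<le> M" "expands n {()} k"
    "near {()} (\<lambda>z s. f s = c z + s * k z s)"
    using Suc.prems(2) by (rule expands_SucE) blast
  then obtain d where d: "d > 0" "\<And>s. \<bar>s\<bar> < d \<Longrightarrow> f s = c () + s * k () s" by (auto simp: near_def)
  have k: "expands n {()} (\<lambda>_. k ())" using 2(2) by (rule expands_cong) (auto intro: near_always)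
  show ?case
  proof (rule expands_SucI)
    show "\<And>z. z \<in> Z \<Longrightarrow> \<bar>c ()\<bar> \<le> M" using 2 by simp
    show "expands n Z (\<lambda>z s. h z s * k () (s * h z s))"
      by (intro expands_mult hn Suc.IH k)
    show "near Z (\<lambda>z s. f (s * h z s) = c () + s * (h z s * k () (s * h z s)))"
    proof (rule near_mono2[OF N near_small[of "d / (\<bar>N\<bar> + 1)"]])
      show "d / (\<bar>N\<bar> + 1) > 0" using d by simp
      fix z s assume z: "z \<in> Z" "\<bar>h z s\<bar> \<le> N" "\<bar>s\<bar> < d / (\<bar>N\<bar> + 1)"
      have "\<bar>s * h z s\<bar> \<le> \<bar>s\<bar> * (\<bar>N\<bar> + 1)"
        unfolding abs_mult by (rule mult_mono) (use z in auto)
      also have "\<dots> < d" using z(3) by (simp add: field_simps)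
      finally show "f (s * h z s) = c () + s * (h z s * k () (s * h z s))"
        using d(2)[of "s * h z s"] by (simp add: algebra_simps)
    qed
  qed
qed

lemma expands_power_series:
  fixes a :: "nat \<Rightarrow> real"
  assumes "r > 0" "\<And>x. \<bar>x\<bar> < r \<Longrightarrow> (\<lambda>n. a n * x ^ n) sums f x"
  shows "expands n {()} (\<lambda>_. f)"
  using assms(2)
proof (induction n arbitrary: a f)
  case 0
  have su: "summable (\<lambda>n. \<bar>a n\<bar> * (r / 2) ^ n)"
  proof -
    have "summable (\<lambda>n. a n * (3 * r / 4) ^ n)" using 0[of "3 * r / 4"] assms(1) by (auto simp: sums_iff)
    from powser_insidea[OF this, of "r / 2"] assms(1) show ?thesis
      by (simp add: abs_mult power_abs)
  qed
  have "near {()} (\<lambda>z s. \<bar>f s\<bar> \<le> (\<Sum>n. \<bar>a n\<bar> * (r / 2) ^ n))"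
  proof (rule nearI[of "r / 2"])
    fix s :: real assume s: "\<bar>s\<bar> < r / 2"
    have le: "norm (a n * s ^ n) \<le> \<bar>a n\<bar> * (r / 2) ^ n" for n
      using s by (auto simp: abs_mult power_abs intro!: mult_left_mono power_mono)
    have "f s = (\<Sum>n. a n * s ^ n)" using 0[of s] s assms(1) by (simp add: sums_iff)
    then show "\<bar>f s\<bar> \<le> (\<Sum>n. \<bar>a n\<bar> * (r / 2) ^ n)"
      using norm_suminf_le[OF le su] by simp
  qed (use assms(1) in simp)
  then show ?case by auto
next
  case (Suc n)
  define k where "k x = (if x = 0 then a 1 else (f x - a 0) / x)" for x
  have k: "(\<lambda>n. a (Suc n) * x ^ n) sums k x" if "\<bar>x\<bar> < r" for x
  proof (cases "x = 0")
    case True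
    have "(\<lambda>n. a (Suc n) * 0 ^ n) sums (a (Suc 0) :: real)"
      using powser_sums_zero[of "\<lambda>n. a (Suc n)"] by simp
    then show ?thesis using True by (simp add: k_def)
  next
    case False
    have "(\<lambda>n. a (Suc n) * x ^ Suc n) sums (f x - a 0)"
      using Suc.prems[OF that] by (subst sums_Suc_iff) simp
    from sums_divide[OF this, of x] False show ?thesis by (simp add: k_def field_simps)
  qed
  have f0: "f 0 = a 0" using Suc.prems[of 0] assms(1) powser_sums_zero[of a] sums_unique2 by force
  show ?case
    by (rule expands_SucI[of _ "\<lambda>_. a 0" "\<bar>a 0\<bar>", OF _ Suc.IH[OF k]])
       (use f0 in \<open>auto intro!: near_always simp: k_def\<close>)
qed

text \<open>The bridge from Taylor's theorem with a Lagrange remainder to the nested form.\<close>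
lemma expands_polynomial_remainder:
  assumes "\<And>m z. m < n \<Longrightarrow> z \<in> Z \<Longrightarrow> \<bar>c m z\<bar> \<le> M" "0 \<le> M" "\<delta> > 0"
    and "\<And>z s. z \<in> Z \<Longrightarrow> \<bar>s\<bar> < \<delta> \<Longrightarrow>
      \<exists>r. \<bar>r\<bar> \<le> M \<and> g z s = (\<Sum>m<n. c m z * s ^ m) + r * s ^ n"
  shows "expands n Z g"
  using assms(1,4)
proof (induction n arbitrary: c g)
  case 0
  have "near Z (\<lambda>z s. \<bar>g z s\<bar> \<le> M)"
    by (rule nearI[OF assms(3)]) (use 0 in fastforce)
  then show ?case by auto
next
  case (Suc n)
  define h where "h z s = (if s = 0 then (if n = 0 then 0 else c 1 z) else (g z s - c 0 z) / s)" for z s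
  have sum: "(\<Sum>m<Suc n. c m z * s ^ m) + r * s ^ Suc n
      = c 0 z + s * ((\<Sum>m<n. c (Suc m) z * s ^ m) + r * s ^ n)" for z s r
    unfolding sum.lessThan_Suc_shift by (simp add: algebra_simps sum_distrib_left)
  have 0: "g z 0 = c 0 z" if "z \<in> Z" for z using Suc.prems(2)[OF that, of 0] sum assms(3) by auto
  have h: "expands n Z h"
  proof (rule Suc.IH)
    show "\<bar>c (Suc m) z\<bar> \<le> M" if "m < n" "z \<in> Z" for m z using Suc.prems(1) that by simp
    fix z s assume z: "z \<in> Z" "\<bar>s\<bar> < \<delta>"
    show "\<exists>r. \<bar>r\<bar> \<le> M \<and> h z s = (\<Sum>m<n. c (Suc m) z * s ^ m) + r * s ^ n"
    proof (cases "s = 0")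
      case True
      show ?thesis using True assms(2)
        by (intro exI[of _ 0], cases n)
           (simp_all add: h_def sum.lessThan_Suc_shift del: sum.lessThan_Suc)
    next
      case False
      obtain r where "\<bar>r\<bar> \<le> M" "g z s = (\<Sum>m<Suc n. c m z * s ^ m) + r * s ^ Suc n"
        using Suc.prems(2)[OF z] by blast
      then show ?thesis using False unfolding sum by (auto simp: h_def)
    qed
  qed
  show ?case
    by (rule expands_SucI[of _ "c 0" M, OF _ h]) (use Suc.prems 0 in \<open>auto intro!: near_always simp: h_def\<close>)
qed

definition expandable :: "'z set \<Rightarrow> ('z \<Rightarrow> real \<Rightarrow> real) \<Rightarrow> bool" where
  "expandable Z g \<longleftrightarrow> (\<forall>n. expands n Z g)"

definition bounded_below :: "'z set \<Rightarrow> ('z \<Rightarrow> real \<Rightarrow> real) \<Rightarrow> bool" where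
  "bounded_below Z g \<longleftrightarrow> (\<exists>m>0. \<forall>z\<in>Z. m \<le> g z 0)"

lemma expandable_cong:
  "expandable Z g \<Longrightarrow> near Z (\<lambda>z s. f z s = g z s) \<Longrightarrow> expandable Z f"
  unfolding expandable_def using expands_cong by blast

lemma expandable_param: "(\<And>z. z \<in> Z \<Longrightarrow> \<bar>c z\<bar> \<le> M) \<Longrightarrow> expandable Z (\<lambda>z s. c z)"
  unfolding expandable_def using expands_param by blast

lemma expandable_const: "expandable Z (\<lambda>z s. c)"
  by (rule expandable_param) auto

lemma expandable_add: "expandable Z f \<Longrightarrow> expandable Z g \<Longrightarrow> expandable Z (\<lambda>z s. f z s + g z s)"
  unfolding expandable_def using expands_add by blast

lemma expandable_mult: "expandable Z f \<Longrightarrow> expandable Z g \<Longrightarrow> expandable Z (\<lambda>z s. f z s * g z s)"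
  unfolding expandable_def using expands_mult by blast

lemma expandable_diff: "expandable Z f \<Longrightarrow> expandable Z g \<Longrightarrow> expandable Z (\<lambda>z s. f z s - g z s)"
  using expandable_add[OF _ expandable_mult[OF expandable_const[of Z "-1"]], of f g] by simp

lemma expandable_at_0:
  assumes "expandable Z g"
  obtains M where "\<And>z. z \<in> Z \<Longrightarrow> \<bar>g z 0\<bar> \<le> M"
proof -
  have "expands 0 Z g" using assms by (simp add: expandable_def del: expands.simps)
  then obtain M where M: "near Z (\<lambda>z s. \<bar>g z s\<bar> \<le> M)" by auto
  show thesis by (rule that) (rule near_zero[OF M])
qed

lemma expandable_freeze: "expandable Z g \<Longrightarrow> expandable Z (\<lambda>z s. g z 0)"
  by (metis expandable_at_0 expandable_param)

lemma expandable_inverse: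
  assumes "expandable Z g" "m > 0" "\<And>z. z \<in> Z \<Longrightarrow> m \<le> \<bar>g z 0\<bar>"
  shows "expandable Z (\<lambda>z s. inverse (g z s))"
  unfolding expandable_def
proof
  fix n
  show "expands n Z (\<lambda>z s. inverse (g z s))"
    by (rule expands_inverse_near[OF _ near_lower_bound[where n = 0]])
       (use assms in \<open>auto simp: expandable_def simp del: expands.simps\<close>)
qed

lemma expandable_divide:
  assumes "expandable Z f" "expandable Z g" "bounded_below Z g"
  shows "expandable Z (\<lambda>z s. f z s / g z s)"
proof -
  obtain m where m: "m > 0" "\<And>z. z \<in> Z \<Longrightarrow> m \<le> g z 0"
    using assms(3) unfolding bounded_below_def by blast
  have "m \<le> \<bar>g z 0\<bar>" if "z \<in> Z" for z using m(2)[OF that] by simp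
  then show ?thesis unfolding divide_inverse
    by (rule expandable_mult[OF assms(1) expandable_inverse[OF assms(2) m(1)]])
qed

text \<open>The linear coefficient of any expansion is the derivative at \<open>0\<close>; in particular it does not depend on
  the chosen expansion.\<close>
lemma expands_has_derivative:
  assumes k: "near Z (\<lambda>z s. g z s = c z + s * k z s)" "expands (Suc 0) Z k" and z: "z \<in> Z"
  shows "(g z has_real_derivative k z 0) (at 0)"
proof -
  obtain c' k' M where 1: "expands 0 Z k'"
    "near Z (\<lambda>z s. k z s = c' z + s * k' z s)" "\<And>z. z \<in> Z \<Longrightarrow> c' z = k z 0"
    using k(2) by (rule expands_SucE) blast
  obtain N where N: "near Z (\<lambda>z s. \<bar>k' z s\<bar> \<le> N)" using 1(1) by auto
  obtain d where d: "d > 0" "\<And>s. \<bar>s\<bar> < d \<Longrightarrow> g z s = c z + s * k z s \<and> k z s = c' z + s * k' z s \<and> \<bar>k' z s\<bar> \<le> N"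
    using near_conj[OF k(1) near_conj[OF 1(2) N]] z unfolding near_def by blast
  have "k z \<midarrow>0\<rightarrow> k z 0"
  proof (rule LIM_I)
    fix r :: real assume r: "r > 0"
    show "\<exists>s>0. \<forall>x. x \<noteq> 0 \<and> norm (x - 0) < s \<longrightarrow> norm (k z x - k z 0) < r"
    proof (intro exI[of _ "min d (r / (\<bar>N\<bar> + 1))"] conjI allI impI)
      fix x :: real assume x: "x \<noteq> 0 \<and> norm (x - 0) < min d (r / (\<bar>N\<bar> + 1))"
      have "\<bar>x * k' z x\<bar> \<le> \<bar>x\<bar> * (\<bar>N\<bar> + 1)"
        unfolding abs_mult by (rule mult_mono) (use x d(2)[of x] in auto)
      also have "\<dots> < r" using x by (simp add: field_simps)
      finally show "norm (k z x - k z 0) < r" using x d(2)[of x] 1(3)[OF z] by simp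
    qed (use d r in auto)
  qed
  moreover have "eventually (\<lambda>h. (g z (0 + h) - g z 0) / h = k z h) (at 0)"
    unfolding eventually_at
    by (intro exI[of _ d]) (use d(1) d(2) d(2)[of 0] in \<open>auto simp: dist_real_def\<close>)
  ultimately show ?thesis
    unfolding DERIV_def by (simp cong: tendsto_cong)
qed

text \<open>For different orders the coefficient functions could differ, so a single quotient valid for all orders is
  the difference quotient itself, completed by the derivative at \<open>0\<close>.\<close>
lemma expandable_factor:
  assumes "expandable Z g"
  obtains h where "expandable Z h" "near Z (\<lambda>z s. g z s = g z 0 + s * h z s)"
proof -
  define h where "h z s = (if s = 0 then deriv (g z) 0 else (g z s - g z 0) / s)" for z s
  have "expandable Z h"
    unfolding expandable_def
  proof
    fix n
    have "expands (Suc (Suc n)) Z g" using assms by (simp add: expandable_def del: expands.simps)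
    then obtain c k M where 1: "expands (Suc n) Z k"
      "near Z (\<lambda>z s. g z s = c z + s * k z s)" "\<And>z. z \<in> Z \<Longrightarrow> c z = g z 0"
      by (rule expands_SucE) blast
    have k1: "expands (Suc 0) Z k" using expands_le[OF 1(1), of "Suc 0"] by simp
    have "deriv (g z) 0 = k z 0" if "z \<in> Z" for z
      using expands_has_derivative[OF 1(2) k1 that] by (simp add: DERIV_imp_deriv)
    then show "expands n Z h"
      by (intro expands_cong[OF expands_pred[OF 1(1)] near_mono[OF 1(2)]])
         (use 1(3) in \<open>auto simp: h_def\<close>)
  qed
  moreover have "near Z (\<lambda>z s. g z s = g z 0 + s * h z s)" by (rule near_always) (simp add: h_def)
  ultimately show thesis by (rule that)
qed

lemma expandable_compose:
  assumes "expandable Z h" "expandable {()} (\<lambda>_. f)"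
  shows "expandable Z (\<lambda>z s. f (s * h z s))"
  using assms expands_compose unfolding expandable_def by blast

section \<open>Logarithmic means\<close>

text \<open>The analytic function \<open>ln (1 + x) / x\<close>. The logarithmic mean of \<open>a\<close> and \<open>a (1 + e)\<close> is \<open>a / ln_quot e\<close>,
  which removes the singularity at equal arguments.\<close>
definition ln_quot :: "real \<Rightarrow> real" where
  "ln_quot x = (if x = 0 then 1 else ln (1 + x) / x)"

lemma expandable_ln_quot: "expandable {()} (\<lambda>_. ln_quot)"
  unfolding expandable_def
proof
  fix n
  show "expands n {()} (\<lambda>_. ln_quot)"
  proof (rule expands_power_series[of 1 "\<lambda>n. (-1) ^ n / real (n + 1)"])
    fix x :: real assume x: "\<bar>x\<bar> < 1"
    show "(\<lambda>n. (-1) ^ n / real (n + 1) * x ^ n) sums ln_quot x"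
    proof (cases "x = 0")
      case True
      then show ?thesis using powser_sums_zero[of "\<lambda>n. (-1) ^ n / real (n + 1)"]
        by (simp add: ln_quot_def)
    next
      case False
      have "summable (\<lambda>n. (-1) ^ n * (1 / real (n + 1)) * x ^ Suc n)"
      proof (rule summable_comparison_test')
        show "summable (\<lambda>n. \<bar>x\<bar> ^ Suc n)" using x by (simp add: summable_geometric)
        show "norm ((-1) ^ n * (1 / real (n + 1)) * x ^ Suc n) \<le> \<bar>x\<bar> ^ Suc n" if "n \<ge> 0" for n
        proof -
          have "norm ((-1) ^ n * (1 / real (n + 1)) * x ^ Suc n) = 1 / real (n + 1) * \<bar>x\<bar> ^ Suc n"
            by (simp add: abs_mult power_abs)
          also have "\<dots> \<le> 1 * \<bar>x\<bar> ^ Suc n" by (rule mult_right_mono) auto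
          finally show ?thesis by simp
        qed
      qed
      then have "(\<lambda>n. (-1) ^ n * (1 / real (n + 1)) * x ^ Suc n) sums ln (1 + x)"
        using ln_series[of "1 + x"] x by (simp add: sums_iff)
      from sums_divide[OF this, of x] False show ?thesis
        by (simp add: ln_quot_def)
    qed
  qed simp
qed

lemma ln_quot: "\<bar>x\<bar> < 1 \<Longrightarrow> ln (1 + x) = x * ln_quot x"
  by (simp add: ln_quot_def)

lemma expandable_near_bound:
  assumes "expandable Z g" "e > 0"
  shows "near Z (\<lambda>z s. \<bar>s * g z s\<bar> < e)"
proof -
  have "expands 0 Z g" using assms(1) by (simp add: expandable_def del: expands.simps)
  then obtain N where N: "near Z (\<lambda>z s. \<bar>g z s\<bar> \<le> N)" by auto
  show ?thesis
  proof (rule near_mono2[OF N near_small[of "e / (\<bar>N\<bar> + 1)"]])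
    show "e / (\<bar>N\<bar> + 1) > 0" using assms by simp
    fix z s assume z: "z \<in> Z" "\<bar>g z s\<bar> \<le> N" "\<bar>s\<bar> < e / (\<bar>N\<bar> + 1)"
    have "\<bar>s * g z s\<bar> \<le> \<bar>s\<bar> * (\<bar>N\<bar> + 1)"
      unfolding abs_mult by (rule mult_mono) (use z in auto)
    also have "\<dots> < e" using z(3) by (simp add: field_simps)
    finally show "\<bar>s * g z s\<bar> < e" .
  qed
qed

lemma expandable_shift: "expandable Z (\<lambda>z s. s)"
  unfolding expandable_def
proof
  fix n
  show "expands n Z (\<lambda>z s. s)"
  proof (cases n)
    case 0
    then show ?thesis by (auto intro!: exI[of _ 1] nearI[of 1])
  next
    case (Suc m)
    show ?thesis unfolding Suc
      by (rule expands_SucI[of _ "\<lambda>_. 0" 0 _ "\<lambda>_ _. 1"])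
         (auto intro: near_always expands_param[of _ "\<lambda>_. 1" 1])
  qed
qed

lemma expandable_relative_increment:
  assumes g: "expandable Z g" and b: "bounded_below Z g"
  obtains k where "expandable Z k"
    "near Z (\<lambda>z s. 0 < g z 0 \<and> \<bar>s * k z s\<bar> < 1 / 2 \<and> g z s = g z 0 * (1 + s * k z s))"
proof -
  obtain m where m: "m > 0" "\<And>z. z \<in> Z \<Longrightarrow> m \<le> g z 0" using b by (auto simp: bounded_below_def)
  obtain h where h: "expandable Z h" "near Z (\<lambda>z s. g z s = g z 0 + s * h z s)"
    using expandable_factor[OF g] by blast
  have k: "expandable Z (\<lambda>z s. h z s / g z 0)"
    by (rule expandable_divide[OF h(1) expandable_freeze[OF g]]) (use m in \<open>auto simp: bounded_below_def\<close>)
  have "near Z (\<lambda>z s. 0 < g z 0 \<and> \<bar>s * (h z s / g z 0)\<bar> < 1 / 2 \<and> g z s = g z 0 * (1 + s * (h z s / g z 0)))"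
    by (rule near_mono2[OF h(2) expandable_near_bound[OF k, of "1/2"]])
       (use m in \<open>force simp: field_simps\<close>)+
  with k show thesis by (rule that)
qed

lemma expandable_ln:
  assumes g: "expandable Z g" and b: "bounded_below Z g"
  shows "expandable Z (\<lambda>z s. ln (g z s))"
proof -
  obtain m where m: "m > 0" "\<And>z. z \<in> Z \<Longrightarrow> m \<le> g z 0" using b by (auto simp: bounded_below_def)
  obtain M where M: "\<And>z. z \<in> Z \<Longrightarrow> \<bar>g z 0\<bar> \<le> M" using expandable_at_0[OF g] by blast
  obtain k where k: "expandable Z k"
    "near Z (\<lambda>z s. 0 < g z 0 \<and> \<bar>s * k z s\<bar> < 1 / 2 \<and> g z s = g z 0 * (1 + s * k z s))"
    using expandable_relative_increment[OF g b] by blast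
  have ln0: "\<bar>ln (g z 0)\<bar> \<le> \<bar>ln m\<bar> + \<bar>ln M\<bar>" if "z \<in> Z" for z
  proof -
    have "0 < g z 0" "m \<le> g z 0" "g z 0 \<le> M" using m(2)[OF that] M[OF that] m(1) by auto
    then have "ln m \<le> ln (g z 0)" "ln (g z 0) \<le> ln M" using m(1) by auto
    then show ?thesis by auto
  qed
  have "expandable Z (\<lambda>z s. ln (g z 0) + s * (k z s * ln_quot (s * k z s)))"
    by (intro expandable_add expandable_mult expandable_param[OF ln0] k expandable_shift
        expandable_compose[OF k(1) expandable_ln_quot])
  then show ?thesis
    by (rule expandable_cong) (rule near_mono[OF k(2)], auto simp: ln_mult_pos ln_quot)
qed

definition log_mean :: "real \<Rightarrow> real \<Rightarrow> real" where
  "log_mean a b = (if a = b then a else (b - a) / (ln b - ln a))"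

lemma log_mean_ln_quot:
  assumes "0 < a" "\<bar>e\<bar> < 1"
  shows "log_mean a (a * (1 + e)) = a / ln_quot e"
proof (cases "e = 0")
  case False
  have "ln (a * (1 + e)) = ln a + ln (1 + e)" using assms by (intro ln_mult_pos) auto
  then show ?thesis using False assms by (simp add: log_mean_def ln_quot_def algebra_simps)
qed (simp add: log_mean_def ln_quot_def)

lemma expandable_log_mean:
  assumes g: "expandable Z g" and b: "bounded_below Z g"
  shows "expandable Z (\<lambda>z s. log_mean (g z 0) (g z s))"
proof -
  obtain k where k: "expandable Z k"
    "near Z (\<lambda>z s. 0 < g z 0 \<and> \<bar>s * k z s\<bar> < 1 / 2 \<and> g z s = g z 0 * (1 + s * k z s))"
    using expandable_relative_increment[OF g b] by blast
  have "expandable Z (\<lambda>z s. g z 0 / ln_quot (s * k z s))"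
    by (intro expandable_divide expandable_freeze[OF g] expandable_compose[OF k(1) expandable_ln_quot])
       (auto simp: bounded_below_def ln_quot_def intro: exI[of _ 1])
  then show ?thesis
    by (rule expandable_cong) (rule near_mono[OF k(2)], auto simp: log_mean_ln_quot)
qed

lemma ln_quot_has_derivative: "(ln_quot has_real_derivative - 1 / 2) (at 0)"
proof -
  have "((\<lambda>x::real. (ln (1 + x) / x - 1) / x) \<longlongrightarrow> - 1 / 2) (at 0)"
    by real_asymp
  then show ?thesis
    unfolding DERIV_def
    by (rule Lim_transform_eventually) (auto simp: eventually_at ln_quot_def intro: exI[of _ 1])
qed

section \<open>Symmetric two-point functions\<close>

text \<open>Here \<open>G s\<close> stands for \<open>F (w 0) (w s)\<close> with a symmetric two-point function \<open>F\<close>, and \<open>f s\<close> for the consistent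
  value \<open>F (w s) (w s)\<close>: moving only one of two symmetric arguments produces half of the derivative. Stating
  this along a curve replaces partial derivatives of \<open>F\<close>, and the statement is stable under arithmetic.\<close>
definition half_slope :: "(real \<Rightarrow> real) \<Rightarrow> (real \<Rightarrow> real) \<Rightarrow> bool" where
  "half_slope G f \<longleftrightarrow> G 0 = f 0 \<and>
     (\<exists>D. (G has_real_derivative D) (at 0) \<and> (f has_real_derivative 2 * D) (at 0))"

lemma half_slopeI:
  "(G has_real_derivative D) (at 0) \<Longrightarrow> (f has_real_derivative E) (at 0) \<Longrightarrow> E = 2 * D \<Longrightarrow>
     G 0 = f 0 \<Longrightarrow> half_slope G f"
  unfolding half_slope_def by blast

lemma half_slope_const: "half_slope (\<lambda>s. c) (\<lambda>s. c)"
  by (rule half_slopeI[OF DERIV_const DERIV_const]) auto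

lemma half_slope_add:
  assumes "half_slope G f" "half_slope H g"
  shows "half_slope (\<lambda>s. G s + H s) (\<lambda>s. f s + g s)"
proof -
  obtain D E where "(G has_real_derivative D) (at 0)" "(f has_real_derivative 2 * D) (at 0)"
    "(H has_real_derivative E) (at 0)" "(g has_real_derivative 2 * E) (at 0)" "G 0 = f 0" "H 0 = g 0"
    using assms unfolding half_slope_def by blast
  then show ?thesis by (intro half_slopeI[OF DERIV_add DERIV_add]) auto
qed

lemma half_slope_mult:
  assumes "half_slope G f" "half_slope H g"
  shows "half_slope (\<lambda>s. G s * H s) (\<lambda>s. f s * g s)"
proof -
  obtain D E where "(G has_real_derivative D) (at 0)" "(f has_real_derivative 2 * D) (at 0)"
    "(H has_real_derivative E) (at 0)" "(g has_real_derivative 2 * E) (at 0)" "G 0 = f 0" "H 0 = g 0"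
    using assms unfolding half_slope_def by blast
  then show ?thesis by (intro half_slopeI[OF DERIV_mult DERIV_mult]) auto
qed

lemma half_slope_inverse:
  assumes "half_slope G f" "f 0 \<noteq> 0"
  shows "half_slope (\<lambda>s. inverse (G s)) (\<lambda>s. inverse (f s))"
proof -
  obtain D where "(G has_real_derivative D) (at 0)" "(f has_real_derivative 2 * D) (at 0)" "G 0 = f 0"
    using assms unfolding half_slope_def by blast
  then show ?thesis using assms(2) by (intro half_slopeI[OF DERIV_inverse_fun DERIV_inverse_fun]) auto
qed

lemma half_slope_mean:
  assumes "(f has_real_derivative D) (at 0)"
  shows "half_slope (\<lambda>s. (f 0 + f s) / 2) f"
  by (rule half_slopeI[OF DERIV_cdivide[OF DERIV_add[OF DERIV_const assms]] assms]) auto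

text \<open>The factor one half comes from \<open>ln_quot'(0) = - 1/2\<close>.\<close>
lemma half_slope_log_mean:
  assumes "(f has_real_derivative D) (at 0)" "f 0 > 0"
  shows "half_slope (\<lambda>s. log_mean (f 0) (f s)) f"
proof -
  define e where "e s = (f s - f 0) / f 0" for s
  have de: "(e has_real_derivative D / f 0) (at 0)"
    using DERIV_cdivide[OF DERIV_diff[OF assms(1) DERIV_const[of "f 0"]], of "f 0"]
    by (simp add: e_def[abs_def])
  have "(ln_quot has_real_derivative - 1 / 2) (at (e 0))" using ln_quot_has_derivative by (simp add: e_def)
  from DERIV_chain2[OF this de]
  have q: "((\<lambda>s. ln_quot (e s)) has_real_derivative - 1 / 2 * (D / f 0)) (at 0)" .
  have "((\<lambda>s. f 0 / ln_quot (e s)) has_real_derivative D / 2) (at 0)"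
    using DERIV_divide[OF DERIV_const[of "f 0"] q] assms(2) by (simp add: e_def ln_quot_def)
  moreover have "eventually (\<lambda>s. f 0 / ln_quot (e s) = log_mean (f 0) (f s)) (nhds 0)"
  proof -
    have "isCont e 0" using de by (rule DERIV_isCont)
    then have "(e \<longlongrightarrow> 0) (nhds 0)" using isCont_def by (simp add: continuous_within tendsto_nhds_iff e_def)
    then have "eventually (\<lambda>s. \<bar>e s\<bar> < 1) (nhds 0)"
      using tendstoD[of e 0 _ 1] by (simp add: dist_real_def)
    then show ?thesis
    proof (rule eventually_mono)
      fix s assume "\<bar>e s\<bar> < 1"
      then show "f 0 / ln_quot (e s) = log_mean (f 0) (f s)"
        using log_mean_ln_quot[OF assms(2), of "e s"] assms(2) by (simp add: e_def field_simps)
    qed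
  qed
  ultimately have "((\<lambda>s. log_mean (f 0) (f s)) has_real_derivative D / 2) (at 0)"
    by (subst (asm) DERIV_cong_ev[OF refl _ refl])
  then show ?thesis unfolding half_slope_def using assms(1)
    by (auto simp: log_mean_def)
qed

section \<open>Central differences\<close>

definition central_slope :: "nat \<Rightarrow> real \<Rightarrow> (real \<Rightarrow> real) \<Rightarrow> real" where
  "central_slope p h g = (if p = 1 then (g h - g (- h)) / (2 * h)
     else (8 * (g h - g (- h)) - (g (2 * h) - g (- (2 * h)))) / (12 * h))"

lemma abs_mult_power_le:
  fixes e :: real
  shows "e = c * h ^ k \<Longrightarrow> \<bar>c\<bar> \<le> M \<Longrightarrow> 0 < h \<Longrightarrow> \<bar>e\<bar> \<le> M * h ^ k"
  by (simp add: abs_mult mult_right_mono)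

lemma fourth_order_stencil:
  fixes h c0 c1 c2 c3 c4 :: real
  assumes "h \<noteq> 0"
  defines "q s k \<equiv> c0 + s * (c1 + s * (c2 + s * (c3 + s * (c4 + s * k))))"
  shows "(8 * (q h k1 - q (- h) k2) - (q (2 * h) k3 - q (- (2 * h)) k4)) / (12 * h) - c1
    = (8 * (k1 + k2) - 32 * (k3 + k4)) / 12 * h ^ 4"
proof -
  have "8 * (q h k1 - q (- h) k2) - (q (2 * h) k3 - q (- (2 * h)) k4)
      = 12 * h * c1 + (8 * (k1 + k2) - 32 * (k3 + k4)) * h ^ 5"
    unfolding q_def by (simp add: algebra_simps eval_nat_numeral)
  also have "\<dots> = (12 * h) * (c1 + (8 * (k1 + k2) - 32 * (k3 + k4)) / 12 * h ^ 4)"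
  proof -
    have "h ^ 5 = h * h ^ 4" by (simp add: eval_nat_numeral)
    then show ?thesis by (simp add: field_simps)
  qed
  finally show ?thesis using assms(1) by simp
qed

text \<open>Odd-order coefficients survive in \<open>g h - g (- h)\<close>; the weights 8 and 1 of the wide stencil cancel the cubic
  one. What is left is the remainder of order three (for \<open>p = 1\<close>) or five (for \<open>p = 2\<close>), divided by \<open>h\<close>.\<close>
lemma central_slope_error:
  assumes "expandable Z G" "p \<in> {1, 2}"
    and D: "\<And>z. z \<in> Z \<Longrightarrow> (G z has_real_derivative D z) (at 0)"
  shows "\<exists>M. \<exists>\<delta>>0. \<forall>z\<in>Z. \<forall>h. 0 < h \<and> h < \<delta> \<longrightarrow> \<bar>central_slope p h (G z) - D z\<bar> \<le> M * h ^ (2 * p)"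
proof -
  have "expands (Suc (Suc (Suc (Suc (Suc 0))))) Z G" using assms(1) by (simp add: expandable_def del: expands.simps)
  then obtain c0 g1 where 0: "expands (Suc (Suc (Suc (Suc 0)))) Z g1" "near Z (\<lambda>z s. G z s = c0 z + s * g1 z s)" "\<And>z. z \<in> Z \<Longrightarrow> c0 z = G z 0"
    by (rule expands_Suc_split) blast
  obtain c1 g2 where 1: "expands (Suc (Suc (Suc 0))) Z g2" "near Z (\<lambda>z s. g1 z s = c1 z + s * g2 z s)"
    "\<And>z. z \<in> Z \<Longrightarrow> c1 z = g1 z 0"
    using 0(1) by (rule expands_Suc_split) blast
  obtain c2 g3 where 2: "expands (Suc (Suc 0)) Z g3" "near Z (\<lambda>z s. g2 z s = c2 z + s * g3 z s)" "\<And>z. z \<in> Z \<Longrightarrow> c2 z = g2 z 0"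
    using 1(1) by (rule expands_Suc_split) blast
  obtain c3 g4 where 3: "expands (Suc 0) Z g4" "near Z (\<lambda>z s. g3 z s = c3 z + s * g4 z s)" "\<And>z. z \<in> Z \<Longrightarrow> c3 z = g3 z 0"
    using 2(1) by (rule expands_Suc_split) blast
  obtain c4 g5 where 4: "expands 0 Z g5" "near Z (\<lambda>z s. g4 z s = c4 z + s * g5 z s)" "\<And>z. z \<in> Z \<Longrightarrow> c4 z = g4 z 0"
    using 3(1) by (rule expands_Suc_split) blast
  obtain N where N: "near Z (\<lambda>z s. \<bar>g5 z s\<bar> \<le> N)" using 4(1) by auto
  have "expands 0 Z g3" using expands_le[OF 2(1), of 0] by simp
  then obtain K where K: "near Z (\<lambda>z s. \<bar>g3 z s\<bar> \<le> K)" by auto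
  have g1: "expands (Suc 0) Z g1" using expands_le[OF 0(1), of "Suc 0"] by simp
  have c1: "D z = c1 z" if "z \<in> Z" for z
    using DERIV_unique[OF D[OF that] expands_has_derivative[OF 0(2) g1 that]] 1(3)[OF that] by simp
  obtain d where d: "d > 0" "\<And>z s. z \<in> Z \<Longrightarrow> \<bar>s\<bar> < d \<Longrightarrow>
    G z s = c0 z + s * (c1 z + s * (c2 z + s * g3 z s)) \<and>
    G z s = c0 z + s * (c1 z + s * (c2 z + s * (c3 z + s * (c4 z + s * g5 z s)))) \<and> \<bar>g5 z s\<bar> \<le> N \<and> \<bar>g3 z s\<bar> \<le> K"
  proof -
    have "near Z (\<lambda>z s. G z s = c0 z + s * (c1 z + s * (c2 z + s * g3 z s)) \<and>
      G z s = c0 z + s * (c1 z + s * (c2 z + s * (c3 z + s * (c4 z + s * g5 z s)))) \<and> \<bar>g5 z s\<bar> \<le> N \<and> \<bar>g3 z s\<bar> \<le> K)"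
      by (rule near_mono[OF near_conj[OF 0(2) near_conj[OF 1(2) near_conj[OF 2(2)
          near_conj[OF 3(2) near_conj[OF 4(2) near_conj[OF N K]]]]]]]) auto
    then show thesis using that unfolding near_def by blast
  qed
  show ?thesis
  proof (rule exI[of _ "\<bar>K\<bar> + 7 * \<bar>N\<bar>"], rule exI[of _ "d / 2"], intro conjI ballI allI impI)
    fix z h assume z: "z \<in> Z" and h: "0 < h \<and> h < d / 2"
    have ab: "\<bar>h\<bar> < d" "\<bar>- h\<bar> < d" "\<bar>2 * h\<bar> < d" "\<bar>- (2 * h)\<bar> < d" using h by auto
    note e = d(2)[OF z ab(1)] d(2)[OF z ab(2)] d(2)[OF z ab(3)] d(2)[OF z ab(4)]
    show "\<bar>central_slope p h (G z) - D z\<bar> \<le> (\<bar>K\<bar> + 7 * \<bar>N\<bar>) * h ^ (2 * p)"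
    proof (cases "p = 1")
      case True
      have e3: "G z h = c0 z + h * (c1 z + h * (c2 z + h * g3 z h))"
        "G z (- h) = c0 z + (- h) * (c1 z + (- h) * (c2 z + (- h) * g3 z (- h)))"
        using e by blast+
      have "central_slope p h (G z) - D z = (g3 z h + g3 z (- h)) / 2 * h ^ 2"
        unfolding central_slope_def c1[OF z] e3 using h True by (simp add: field_simps power2_eq_square)
      moreover have "\<bar>(g3 z h + g3 z (- h)) / 2\<bar> \<le> \<bar>K\<bar> + 7 * \<bar>N\<bar>" using e by auto
      ultimately have "\<bar>central_slope p h (G z) - D z\<bar> \<le> (\<bar>K\<bar> + 7 * \<bar>N\<bar>) * h ^ 2"
        by (rule abs_mult_power_le) (use h in simp)
      then show ?thesis using True by simp
    next
      case False
      then have p: "p = 2" using assms(2) by simp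
      have e5: "G z s = c0 z + s * (c1 z + s * (c2 z + s * (c3 z + s * (c4 z + s * g5 z s))))"
        if "s \<in> {h, - h, 2 * h, - (2 * h)}" for s
        using e that by blast
      have "central_slope p h (G z) - D z
          = (8 * (g5 z h + g5 z (- h)) - 32 * (g5 z (2 * h) + g5 z (- (2 * h)))) / 12 * h ^ 4"
      proof -
        have "central_slope p h (G z)
            = (8 * (G z h - G z (- h)) - (G z (2 * h) - G z (- (2 * h)))) / (12 * h)"
          using p by (simp add: central_slope_def)
        also have "\<dots> - D z
            = (8 * (g5 z h + g5 z (- h)) - 32 * (g5 z (2 * h) + g5 z (- (2 * h)))) / 12 * h ^ 4"
          unfolding c1[OF z] e5[of h, simplified] e5[of "- h", OF insertI2[OF insertI1]]
            e5[of "2 * h", OF insertI2[OF insertI2[OF insertI1]]]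
            e5[of "- (2 * h)", OF insertI2[OF insertI2[OF insertI2[OF insertI1]]]]
          by (rule fourth_order_stencil) (use h in simp)
        finally show ?thesis .
      qed
      moreover have "\<bar>(8 * (g5 z h + g5 z (- h)) - 32 * (g5 z (2 * h) + g5 z (- (2 * h)))) / 12\<bar> \<le> \<bar>K\<bar> + 7 * \<bar>N\<bar>"
        using e by auto
      ultimately have "\<bar>central_slope p h (G z) - D z\<bar> \<le> (\<bar>K\<bar> + 7 * \<bar>N\<bar>) * h ^ 4"
        by (rule abs_mult_power_le) (use h in simp)
      then show ?thesis using p by simp
    qed
  qed (use d in auto)
qed

section \<open>Entropy conservation of the two-point fluxes\<close>

lemma log_mean_mult_ln:
  assumes "0 < a" "0 < b"
  shows "log_mean a b \<noteq> 0" "ln b - ln a = (b - a) / log_mean a b"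
  using assms by (auto simp: log_mean_def)

lemma log_mean_commute: "log_mean a b = log_mean b a"
  unfolding log_mean_def by (metis minus_diff_eq minus_divide_divide)

lemma ln_mean_log_mean: "ln_mean g Ul Ur = log_mean (g Ul) (g Ur)"
  by (simp add: ln_mean_def log_mean_def)

lemma mean_real: "mean g Ul Ur = (g Ul + g Ur) / (2::real)"
  by (simp add: mean_def)

lemma norm_sq_3: "(norm (v :: real^3))\<^sup>2 = (v $ 1)\<^sup>2 + (v $ 2)\<^sup>2 + (v $ 3)\<^sup>2"
  unfolding power2_norm_eq_inner by (simp add: inner_vec_def sum_3 power2_eq_square)

text \<open>The entropy-conservation condition as an identity between real numbers; unprimed and primed letters are the
  left and right values. The letters \<open>B2\<close> and \<open>usq\<close> denote the means of \<open>|B|\<^sup>2\<close> and \<open>|u|\<^sup>2\<close>, so the second component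
  of the field is called \<open>Q2\<close>. The energy flux \<open>F6\<close> is designed so that, in \<open>[V] \<bullet> F\<close>, its velocity and field parts turn
  \<open>[2 \<beta> u]\<close> into \<open>2 mean(\<beta>) [u]\<close>, and similarly for \<open>B\<close>. The density flux is then paired with \<open>[s]\<close> alone, which the
  logarithmic means convert into jumps of \<open>\<beta>\<close> and \<open>\<rho>\<close>, and the rest is polynomial.\<close>
lemma ec_identity:
  fixes r r' b b' bp bp' s s' Lr Lb Lp F1 F2 F3 F4 F5 F6 F7 F8 F9 :: real
  assumes nz: "Lr \<noteq> 0" "b + b' \<noteq> 0"
    and s: "s' - s = - (bp' - bp) / Lp - 2 * (b' - b) / Lb - 2 * (r' - r) / Lr"
    and F1: "F1 = Lr * ((u1 + u1') / 2)"
    and F2: "F2 = (r + r') / 2 / ((b + b') / 2) + (u1 + u1') / 2 * F1 + B2 / 2 - ((B1 + B1') / 2) * ((B1 + B1') / 2)"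
    and F3: "F3 = (u2 + u2') / 2 * F1 - (B1 + B1') / 2 * ((Q2 + Q2') / 2)"
    and F4: "F4 = (u3 + u3') / 2 * F1 - (B1 + B1') / 2 * ((B3 + B3') / 2)"
    and F5: "F5 = F1 / Lp"
    and F7: "F7 = 0"
    and F8: "F8 = ((b * u1 + b' * u1') / 2 * ((Q2 + Q2') / 2) - (b * u2 + b' * u2') / 2 * ((B1 + B1') / 2)) / ((b + b') / 2)"
    and F9: "F9 = ((b * u1 + b' * u1') / 2 * ((B3 + B3') / 2) - (b * u3 + b' * u3') / 2 * ((B1 + B1') / 2)) / ((b + b') / 2)"
    and F6: "F6 = (2 / Lb - usq) * F1 / 2 + (u1 + u1') / 2 * F2 + (u2 + u2') / 2 * F3 + (u3 + u3') / 2 * F4 + F5 / 2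
              + (B1 + B1') / 2 * F7 + (Q2 + Q2') / 2 * F8 + (B3 + B3') / 2 * F9 - (u1 + u1') / 2 * B2 / 2
              + ((u1 + u1') / 2 * ((B1 + B1') / 2) + (u2 + u2') / 2 * ((Q2 + Q2') / 2) + (u3 + u3') / 2 * ((B3 + B3') / 2)) * ((B1 + B1') / 2)"
    and B2: "B2 = ((B1\<^sup>2 + Q2\<^sup>2 + B3\<^sup>2) + (B1'\<^sup>2 + Q2'\<^sup>2 + B3'\<^sup>2)) / 2"
    and usq: "usq = ((u1\<^sup>2 + u2\<^sup>2 + u3\<^sup>2) + (u1'\<^sup>2 + u2'\<^sup>2 + u3'\<^sup>2)) / 2"
  shows "((5 - s' - b' * (u1'\<^sup>2 + u2'\<^sup>2 + u3'\<^sup>2)) - (5 - s - b * (u1\<^sup>2 + u2\<^sup>2 + u3\<^sup>2))) * F1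
      + (2 * b' * u1' - 2 * b * u1) * F2 + (2 * b' * u2' - 2 * b * u2) * F3 + (2 * b' * u3' - 2 * b * u3) * F4
      + ((- bp' + b') - (- bp + b)) * F5 + (- 2 * b' - - 2 * b) * F6
      + (2 * b' * B1' - 2 * b * B1) * F7 + (2 * b' * Q2' - 2 * b * Q2) * F8 + (2 * b' * B3' - 2 * b * B3) * F9
      + (2 * b' * (u1' * B1' + u2' * Q2' + u3' * B3') - 2 * b * (u1 * B1 + u2 * Q2 + u3 * B3)) * ((B1 + B1') / 2)
      = (2 * r' + b' * (B1'\<^sup>2 + Q2'\<^sup>2 + B3'\<^sup>2)) * u1' - (2 * r + b * (B1\<^sup>2 + Q2\<^sup>2 + B3\<^sup>2)) * u1"
    (is "?L = ?R")
proof -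
  have F2': "(b + b') * F2 = (r + r') + (b + b') * ((u1 + u1') / 2 * F1 + B2 / 2 - ((B1 + B1') / 2) * ((B1 + B1') / 2))"
    unfolding F2 using nz(2) by (simp add: field_simps)
  have F8': "(b + b') * F8 = (b * u1 + b' * u1') * ((Q2 + Q2') / 2) - (b * u2 + b' * u2') * ((B1 + B1') / 2)"
    unfolding F8 using nz(2) by (simp add: mult.commute)
  have F9': "(b + b') * F9 = (b * u1 + b' * u1') * ((B3 + B3') / 2) - (b * u3 + b' * u3') * ((B1 + B1') / 2)"
    unfolding F9 using nz(2) by (simp add: mult.commute)
  have s1: "(s' - s) * F1 = - (bp' - bp) * F5 - 2 * (b' - b) * (F1 / Lb) - (r' - r) * (u1 + u1')"
  proof -
    have k: "2 * (r' - r) / Lr * F1 = (r' - r) * (u1 + u1')" unfolding F1 using nz(1) by simp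
    have "(s' - s) * F1 = - (bp' - bp) / Lp * F1 - 2 * (b' - b) / Lb * F1 - 2 * (r' - r) / Lr * F1"
      unfolding s by (simp only: left_diff_distrib)
    also have "\<dots> = - (bp' - bp) * F5 - 2 * (b' - b) * (F1 / Lb) - (r' - r) * (u1 + u1')"
      unfolding k F5 by (simp only: times_divide_eq_left times_divide_eq_right)
    finally show ?thesis .
  qed
  have F6': "F6 = F1 / Lb - usq * F1 / 2 + (u1 + u1') / 2 * F2 + (u2 + u2') / 2 * F3 + (u3 + u3') / 2 * F4 + F5 / 2
              + (Q2 + Q2') / 2 * F8 + (B3 + B3') / 2 * F9 - (u1 + u1') / 2 * B2 / 2
              + ((u1 + u1') / 2 * ((B1 + B1') / 2) + (u2 + u2') / 2 * ((Q2 + Q2') / 2) + (u3 + u3') / 2 * ((B3 + B3') / 2)) * ((B1 + B1') / 2)"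
    unfolding F6 F7 by (simp add: field_simps)
  have "?L = - (s' - s) * F1 - (b' * (u1'\<^sup>2 + u2'\<^sup>2 + u3'\<^sup>2) - b * (u1\<^sup>2 + u2\<^sup>2 + u3\<^sup>2)) * F1
      + (u1' - u1) * ((b + b') * F2) + (b + b') * ((u2' - u2) * F3 + (u3' - u3) * F4)
      + (- (bp' - bp)) * F5
      - 2 * (b' - b) * (F1 / Lb - usq * F1 / 2 - (u1 + u1') / 2 * B2 / 2
              + ((u1 + u1') / 2 * ((B1 + B1') / 2) + (u2 + u2') / 2 * ((Q2 + Q2') / 2) + (u3 + u3') / 2 * ((B3 + B3') / 2)) * ((B1 + B1') / 2))
      + (Q2' - Q2) * ((b + b') * F8) + (B3' - B3) * ((b + b') * F9)
      + (2 * b' * (u1' * B1' + u2' * Q2' + u3' * B3') - 2 * b * (u1 * B1 + u2 * Q2 + u3 * B3)) * ((B1 + B1') / 2)"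
    unfolding F6' F7 by (simp add: algebra_simps add_divide_distrib diff_divide_distrib)
  also have "\<dots> = ?R"
    unfolding F2' F8' F9' F3 F4 minus_mult_left[symmetric] s1 B2 usq
    by (simp add: algebra_simps add_divide_distrib diff_divide_distrib power2_eq_square)
  finally show ?thesis .
qed

lemma spec_entropy_alt:
  assumes "U \<in> pos_states"
  shows "spec_entropy U = - ln (beta_par U) - 2 * ln (beta_perp U) - 2 * ln (rho U)"
proof -
  have p: "rho U > 0" "p_par U > 0" "p_perp U > 0" using assms by (auto simp: pos_states_def)
  then show ?thesis
    by (simp add: spec_entropy_def beta_par_def beta_perp_def ln_div ln_mult_pos ln_realpow)
qed

lemma ec_condition_x:
  assumes "Ul \<in> pos_states" "Ur \<in> pos_states"
  shows "(entropy_var Ur - entropy_var Ul) \<bullet> ec_flux_x Ul Ur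
      + (phi Ur - phi Ul) * mean (\<lambda>U. mag U $ 1) Ul Ur = calF Xdir Ur - calF Xdir Ul"
proof -
  define F where "F = ec_flux_x Ul Ur"
  note Fd = F_def[unfolded ec_flux_x_def Let_def]
  have pos: "rho U > 0" "beta_perp U > 0" "beta_par U > 0" if "U \<in> pos_states" for U
    using that by (auto simp: pos_states_def beta_perp_def beta_par_def)
  note lns = spec_entropy_alt
  note L = log_mean_mult_ln[OF pos(1)[OF assms(1)] pos(1)[OF assms(2)]]
    log_mean_mult_ln[OF pos(2)[OF assms(1)] pos(2)[OF assms(2)]]
    log_mean_mult_ln[OF pos(3)[OF assms(1)] pos(3)[OF assms(2)]]
  have s: "spec_entropy Ur - spec_entropy Ul
      = - (beta_par Ur - beta_par Ul) / ln_mean beta_par Ul Ur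
        - 2 * (beta_perp Ur - beta_perp Ul) / ln_mean beta_perp Ul Ur
        - 2 * (rho Ur - rho Ul) / ln_mean rho Ul Ur"
    unfolding lns[OF assms(1)] lns[OF assms(2)] ln_mean_log_mean
    by (simp only: times_divide_eq_right[symmetric] minus_divide_left[symmetric] L(2,4,6)[symmetric])
      (simp add: algebra_simps)
  have nz: "ln_mean rho Ul Ur \<noteq> 0" "beta_perp Ul + beta_perp Ur \<noteq> 0"
    using L(1) pos(2)[OF assms(1)] pos(2)[OF assms(2)] by (auto simp: ln_mean_log_mean)
  note * = ec_identity[OF nz s, of "F$1" "vel Ul $ 1" "vel Ur $ 1" "F$2"
      "mean (\<lambda>U. (norm (mag U))\<^sup>2) Ul Ur" "mag Ul $ 1" "mag Ur $ 1" "F$3" "vel Ul $ 2" "vel Ur $ 2"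
      "mag Ul $ 2" "mag Ur $ 2" "F$4" "vel Ul $ 3" "vel Ur $ 3" "mag Ul $ 3" "mag Ur $ 3" "F$5" "F$7" "F$8" "F$9" "F$6"
      "mean (\<lambda>U. (norm (vel U))\<^sup>2) Ul Ur"]
  show ?thesis unfolding F_def[symmetric]
    apply (subst inner_vec_def)
    apply (simp only: sum_9 vector_minus_component entropy_var_def vector_9 phi_def calF_def inner_real_def dir_idx.simps norm_sq_3)
    apply (simp only: inner_vec_def sum_3 inner_real_def mean_real)
    apply (rule *)
    apply (simp_all only: Fd vector_9 mean_real norm_sq_3)
    done
qed

text \<open>The \<open>y\<close>-direction is the \<open>x\<close>-direction for the reflected state: all scalar quantities are invariant
  under \<open>swap_xy\<close> and all vectors are permuted by it.\<close>
lemma swap_xy_nth: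
  "swap_xy U $ 1 = U $ 1" "swap_xy U $ 2 = U $ 3" "swap_xy U $ 3 = U $ 2" "swap_xy U $ 4 = U $ 4"
  "swap_xy U $ 5 = U $ 5" "swap_xy U $ 6 = U $ 6" "swap_xy U $ 7 = U $ 8" "swap_xy U $ 8 = U $ 7"
  "swap_xy U $ 9 = U $ 9"
  by (simp_all only: swap_xy_def vector_9)

lemma vec_eq_9: "(v :: real^9) = w \<longleftrightarrow> (v$1 = w$1 \<and> v$2 = w$2 \<and> v$3 = w$3 \<and> v$4 = w$4 \<and> v$5 = w$5
    \<and> v$6 = w$6 \<and> v$7 = w$7 \<and> v$8 = w$8 \<and> v$9 = w$9)"
  unfolding vec_eq_iff ball_UNIV[symmetric] UNIV_9 by (simp only: ball_simps simp_thms)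

lemma swap_xy_state:
  "rho (swap_xy U) = rho U" "p_par (swap_xy U) = p_par U" "energy (swap_xy U) = energy U"
  "vel (swap_xy U) $ 1 = vel U $ 2" "vel (swap_xy U) $ 2 = vel U $ 1" "vel (swap_xy U) $ 3 = vel U $ 3"
  "mag (swap_xy U) $ 1 = mag U $ 2" "mag (swap_xy U) $ 2 = mag U $ 1" "mag (swap_xy U) $ 3 = mag U $ 3"
  "norm (vel (swap_xy U)) = norm (vel U)" "norm (mag (swap_xy U)) = norm (mag U)"
  "vel (swap_xy U) \<bullet> mag (swap_xy U) = vel U \<bullet> mag U"
  "p_perp (swap_xy U) = p_perp U"
proof -
  show v: "vel (swap_xy U) $ 1 = vel U $ 2" "vel (swap_xy U) $ 2 = vel U $ 1" "vel (swap_xy U) $ 3 = vel U $ 3"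
    and m: "mag (swap_xy U) $ 1 = mag U $ 2" "mag (swap_xy U) $ 2 = mag U $ 1" "mag (swap_xy U) $ 3 = mag U $ 3"
    and e: "rho (swap_xy U) = rho U" "p_par (swap_xy U) = p_par U" "energy (swap_xy U) = energy U"
    by (simp_all add: vel_def mag_def rho_def p_par_def energy_def swap_xy_nth)
  have "(norm (vel (swap_xy U)))\<^sup>2 = (norm (vel U))\<^sup>2" "(norm (mag (swap_xy U)))\<^sup>2 = (norm (mag U))\<^sup>2"
    by (simp_all add: norm_sq_3 v m)
  then show nv: "norm (vel (swap_xy U)) = norm (vel U)" and nm: "norm (mag (swap_xy U)) = norm (mag U)"
    by simp_all
  show "vel (swap_xy U) \<bullet> mag (swap_xy U) = vel U \<bullet> mag U" by (simp add: inner_vec_def sum_3 v m)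
  show "p_perp (swap_xy U) = p_perp U" by (simp add: p_perp_def e nv nm)
qed

lemma swap_xy_inner: "swap_xy a \<bullet> b = a \<bullet> swap_xy b"
  by (simp add: inner_vec_def sum_9 swap_xy_nth)

lemma swap_xy_functions:
  "swap_xy U \<in> pos_states \<longleftrightarrow> U \<in> pos_states"
  "entropy_var (swap_xy U) = swap_xy (entropy_var U)"
  "phi (swap_xy U) = phi U"
  "calF Xdir (swap_xy U) = calF Ydir U"
  "flux Ydir U = swap_xy (flux Xdir (swap_xy U))"
proof -
  show "swap_xy U \<in> pos_states \<longleftrightarrow> U \<in> pos_states" by (simp add: pos_states_def swap_xy_state)
  have s: "spec_entropy (swap_xy U) = spec_entropy U" "beta_perp (swap_xy U) = beta_perp U"
    "beta_par (swap_xy U) = beta_par U"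
    by (simp_all add: spec_entropy_def beta_perp_def beta_par_def swap_xy_state)
  show "entropy_var (swap_xy U) = swap_xy (entropy_var U)"
    by (simp only: vec_eq_9 entropy_var_def vector_9 swap_xy_nth swap_xy_state s)
  show "phi (swap_xy U) = phi U" by (simp only: phi_def swap_xy_state s)
  show "calF Xdir (swap_xy U) = calF Ydir U" by (simp only: calF_def swap_xy_state s dir_idx.simps)
  have "mag (swap_xy U) \<bullet> vel (swap_xy U) = mag U \<bullet> vel U" by (metis inner_commute swap_xy_state(12))
  then show "flux Ydir U = swap_xy (flux Xdir (swap_xy U))"
    by (simp only: vec_eq_9 flux_def Let_def vector_9 swap_xy_nth swap_xy_state dir_idx.simps
        vector_minus_component vector_add_component vector_scaleR_component)
       (simp add: axis_def swap_xy_state)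
qed

lemma mean_commute: "mean g Ul Ur = mean g Ur Ul"
  by (simp add: mean_def add.commute)

lemma ec_flux_commute: "ec_flux d Ul Ur = ec_flux d Ur Ul"
proof -
  have x: "ec_flux_x Ul Ur = ec_flux_x Ur Ul" for Ul Ur
    unfolding ec_flux_x_def ln_mean_log_mean
    by (simp only: mean_commute[of _ Ul Ur] log_mean_commute[of "rho Ul"]
        log_mean_commute[of "beta_perp Ul"] log_mean_commute[of "beta_par Ul"])
  show ?thesis by (cases d) (simp_all only: ec_flux.simps x)
qed

lemma ec_condition:
  assumes "Ul \<in> pos_states" "Ur \<in> pos_states"
  shows "(entropy_var Ur - entropy_var Ul) \<bullet> ec_flux d Ul Ur
      + (phi Ur - phi Ul) * mean (\<lambda>U. mag U $ dir_idx d) Ul Ur = calF d Ur - calF d Ul"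
proof (cases d)
  case Xdir
  then show ?thesis using ec_condition_x[OF assms] by simp
next
  case Ydir
  have "(entropy_var (swap_xy Ur) - entropy_var (swap_xy Ul)) \<bullet> ec_flux_x (swap_xy Ul) (swap_xy Ur)
      + (phi (swap_xy Ur) - phi (swap_xy Ul)) * mean (\<lambda>U. mag U $ 1) (swap_xy Ul) (swap_xy Ur)
      = calF Xdir (swap_xy Ur) - calF Xdir (swap_xy Ul)"
    by (rule ec_condition_x) (use assms in \<open>simp_all add: swap_xy_functions\<close>)
  then show ?thesis using Ydir
    by (simp add: swap_xy_functions swap_xy_inner inner_diff_left mean_real swap_xy_state)
qed

text \<open>One-sided form of the entropy-conservation condition. Since both sides of the interface see the same flux,
  subtracting it for the two neighbours of a node cancels \<open>calF d Ul\<close> and leaves an entropy flux difference.\<close>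
lemma ec_entropy_balance:
  assumes "Ul \<in> pos_states" "Ur \<in> pos_states"
  shows "entropy_var Ul \<bullet> ec_flux d Ul Ur + phi Ul * mean (\<lambda>U. mag U $ dir_idx d) Ul Ur
      = ec_entropy_flux d Ul Ur + calF d Ul"
proof -
  define F where "F = ec_flux d Ul Ur"
  define B where "B = mean (\<lambda>U. mag U $ dir_idx d) Ul Ur"
  have "mean entropy_var Ul Ur \<bullet> F = (entropy_var Ul \<bullet> F + entropy_var Ur \<bullet> F) / 2"
    by (simp add: mean_def inner_add_left)
  moreover have "mean phi Ul Ur * B = (phi Ul * B + phi Ur * B) / 2"
    by (simp add: mean_real distrib_right)
  moreover have "entropy_var Ur \<bullet> F - entropy_var Ul \<bullet> F + (phi Ur * B - phi Ul * B) = calF d Ur - calF d Ul"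
    using ec_condition[OF assms, of d] by (simp add: F_def B_def inner_diff_left left_diff_distrib)
  ultimately show ?thesis
    unfolding ec_entropy_flux_def F_def[symmetric] B_def[symmetric] mean_real[of "calF d"]
    by (simp add: field_simps)
qed

lemma ec_entropy_flux_commute: "ec_entropy_flux d Ul Ur = ec_entropy_flux d Ur Ul"
  unfolding ec_entropy_flux_def by (simp only: mean_commute[of _ Ul Ur] ec_flux_commute[of d Ul Ur])

text \<open>Euler's relation: \<open>\<phi>\<close> is homogeneous of degree one in \<open>V\<close>.\<close>
lemma entropy_var_phi_grad: "U \<in> pos_states \<Longrightarrow> entropy_var U \<bullet> phi_grad U = phi U"
  by (simp add: inner_vec_def sum_9 sum_3 entropy_var_def phi_grad_def vector_9 phi_def algebra_simps)

section \<open>Rational functions of the state\<close>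

text \<open>Functions that agree on \<open>S\<close> with a rational expression without poles in \<open>S\<close>. This class is closed under
  partial derivatives, so that fluxes, their Jacobians and \<open>\<partial>U/\<partial>V\<close> are all covered, and each member is
  smooth along smooth curves and Lipschitz on compact sets. The rule \<open>cong\<close> identifies functions that
  agree on \<open>S\<close>, which is harmless for derivatives when \<open>S\<close> is open.\<close>
inductive rational_on :: "(real^'n) set \<Rightarrow> (real^'n \<Rightarrow> real) \<Rightarrow> bool" for S where
  component: "rational_on S (\<lambda>U. U $ i)"
| const: "rational_on S (\<lambda>U. c)"
| add: "rational_on S f \<Longrightarrow> rational_on S g \<Longrightarrow> rational_on S (\<lambda>U. f U + g U)"
| mult: "rational_on S f \<Longrightarrow> rational_on S g \<Longrightarrow> rational_on S (\<lambda>U. f U * g U)"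
| inverse: "rational_on S f \<Longrightarrow> (\<And>U. U \<in> S \<Longrightarrow> f U \<noteq> 0) \<Longrightarrow> rational_on S (\<lambda>U. inverse (f U))"
| cong: "rational_on S f \<Longrightarrow> (\<And>U. U \<in> S \<Longrightarrow> g U = f U) \<Longrightarrow> rational_on S g"

lemma rational_on_minus: "rational_on S f \<Longrightarrow> rational_on S (\<lambda>U. - f U)"
  using rational_on.mult[OF rational_on.const[of S "-1"]] by simp

lemma rational_on_diff: "rational_on S f \<Longrightarrow> rational_on S g \<Longrightarrow> rational_on S (\<lambda>U. f U - g U)"
  using rational_on.add[OF _ rational_on_minus] by fastforce

lemma rational_on_divide:
  "rational_on S f \<Longrightarrow> rational_on S g \<Longrightarrow> (\<And>U. U \<in> S \<Longrightarrow> g U \<noteq> 0) \<Longrightarrow> rational_on S (\<lambda>U. f U / g U)"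
  unfolding divide_inverse by (intro rational_on.mult rational_on.inverse)

lemma rational_on_power2: "rational_on S f \<Longrightarrow> rational_on S (\<lambda>U. (f U)\<^sup>2)"
  unfolding power2_eq_square by (intro rational_on.mult)

lemma rational_on_sum:
  "(\<And>i. i \<in> I \<Longrightarrow> rational_on S (f i)) \<Longrightarrow> rational_on S (\<lambda>U. \<Sum>i\<in>I. f i U)"
  by (induction I rule: infinite_finite_induct) (auto intro: rational_on.const rational_on.add)

lemmas rational_intros = rational_on.component rational_on.const rational_on.add rational_on.mult
  rational_on_minus rational_on_diff rational_on_divide rational_on_power2 rational_on_sum

lemma rational_on_subset: "rational_on S f \<Longrightarrow> S' \<subseteq> S \<Longrightarrow> rational_on S' f"
proof (induction rule: rational_on.induct)
  case (cong f g)
  show ?case by (rule rational_on.cong[OF cong.IH[OF cong.prems]]) (use cong in auto)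
next
  case (inverse f)
  show ?case by (rule rational_on.inverse[OF inverse.IH[OF inverse.prems]]) (use inverse in auto)
qed (auto intro: rational_on.intros)

lemma rational_on_continuous: "rational_on S f \<Longrightarrow> continuous_on S f"
proof (induction rule: rational_on.induct)
  case (cong f g)
  show ?case using cong(3) cong(2) continuous_on_cong[of S S g f] by auto
qed (auto intro!: continuous_intros)

lemma rational_on_bounded:
  assumes "rational_on S f" "compact C" "C \<subseteq> S"
  obtains M where "0 < M" "\<And>U. U \<in> C \<Longrightarrow> \<bar>f U\<bar> \<le> M"
proof -
  have "compact (f ` C)"
    using assms rational_on_continuous continuous_on_subset compact_continuous_image by blast
  then obtain M where "M > 0" "\<forall>x\<in>f ` C. norm x \<le> M" using compact_imp_bounded bounded_pos by blast
  then show thesis using that by auto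
qed

text \<open>An induction on the expression; the factors in the product and inverse cases are bounded by continuity on
  the compact set.\<close>
lemma rational_on_lipschitz:
  assumes "rational_on S f" "compact C" "C \<subseteq> S"
  shows "\<exists>L. \<forall>U\<in>C. \<forall>W\<in>C. \<bar>f U - f W\<bar> \<le> L * dist U W"
  using assms(1)
proof (induction rule: rational_on.induct)
  case (component i)
  show ?case
    by (rule exI[of _ 1]) (use component_le_norm_cart in \<open>force simp: dist_norm simp flip: vector_minus_component\<close>)
next
  case (const c)
  show ?case by (rule exI[of _ 0]) simp
next
  case (add f g)
  then obtain L N where "\<forall>U\<in>C. \<forall>W\<in>C. \<bar>f U - f W\<bar> \<le> L * dist U W"
    "\<forall>U\<in>C. \<forall>W\<in>C. \<bar>g U - g W\<bar> \<le> N * dist U W" by blast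
  then show ?case by (intro exI[of _ "L + N"]) (force simp: distrib_right)
next
  case (mult f g)
  obtain L N where L: "\<And>U W. U \<in> C \<Longrightarrow> W \<in> C \<Longrightarrow> \<bar>f U - f W\<bar> \<le> L * dist U W"
    "\<And>U W. U \<in> C \<Longrightarrow> W \<in> C \<Longrightarrow> \<bar>g U - g W\<bar> \<le> N * dist U W" using mult.IH by blast
  obtain A where A: "A > 0" "\<And>U. U \<in> C \<Longrightarrow> \<bar>f U\<bar> \<le> A" using rational_on_bounded[OF mult(1) assms(2,3)] by blast
  obtain B where B: "B > 0" "\<And>U. U \<in> C \<Longrightarrow> \<bar>g U\<bar> \<le> B" using rational_on_bounded[OF mult(2) assms(2,3)] by blast
  show ?case
  proof (intro exI[of _ "L * B + A * N"] ballI)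
    fix U W assume U: "U \<in> C" "W \<in> C"
    have "\<bar>f U * g U - f W * g W\<bar> = \<bar>(f U - f W) * g U + f W * (g U - g W)\<bar>" by (simp add: algebra_simps)
    also have "\<dots> \<le> \<bar>f U - f W\<bar> * \<bar>g U\<bar> + \<bar>f W\<bar> * \<bar>g U - g W\<bar>"
      using abs_triangle_ineq by (metis abs_mult)
    also have "\<dots> \<le> (L * dist U W) * B + A * (N * dist U W)"
      by (intro add_mono mult_mono) (use L[OF U] A B U in \<open>auto intro: order_trans[OF abs_ge_zero]\<close>)
    finally show "\<bar>f U * g U - f W * g W\<bar> \<le> (L * B + A * N) * dist U W" by (simp add: algebra_simps)
  qed
next
  case (inverse f)
  obtain L where L: "\<And>U W. U \<in> C \<Longrightarrow> W \<in> C \<Longrightarrow> \<bar>f U - f W\<bar> \<le> L * dist U W" using inverse.IH by blast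
  obtain A where A: "A > 0" "\<And>U. U \<in> C \<Longrightarrow> \<bar>inverse (f U)\<bar> \<le> A"
    using rational_on_bounded[OF rational_on.inverse[OF inverse(1,2)] assms(2,3)] by blast
  show ?case
  proof (intro exI[of _ "A * L * A"] ballI)
    fix U W assume U: "U \<in> C" "W \<in> C"
    have "f U \<noteq> 0" "f W \<noteq> 0" using inverse(2) assms(3) U by auto
    then have "inverse (f U) - inverse (f W) = - (inverse (f U) * (f U - f W) * inverse (f W))"
      by (simp add: field_simps)
    then have "\<bar>inverse (f U) - inverse (f W)\<bar> = \<bar>inverse (f U)\<bar> * \<bar>f U - f W\<bar> * \<bar>inverse (f W)\<bar>"
      by (simp add: abs_mult)
    also have "\<dots> \<le> A * (L * dist U W) * A"
      by (intro mult_mono) (use L[OF U] A U in \<open>auto intro: order_trans[OF abs_ge_zero] intro!: mult_nonneg_nonneg\<close>)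
    finally show "\<bar>inverse (f U) - inverse (f W)\<bar> \<le> A * L * A * dist U W" by (simp add: algebra_simps)
  qed
next
  case (cong f g)
  then show ?case using assms(3) by (metis subsetD)
qed

lemma rational_on_partial:
  fixes f :: "state \<Rightarrow> real"
  assumes "rational_on S f" "open S"
  shows "(\<forall>U\<in>S. f differentiable (at U)) \<and> (\<forall>j. rational_on S (\<lambda>U. grad f U $ j))"
  using assms(1)
proof (induction rule: rational_on.induct)
  case (component i)
  have d: "((\<lambda>U. U $ i) has_derivative (\<lambda>h. h $ i)) (at U)" for U :: state
    by (rule bounded_linear_imp_has_derivative[OF bounded_linear_vec_nth])
  then have "grad (\<lambda>U. U $ i) U $ j = (axis j 1 :: state) $ i" for U j
    using frechet_derivative_at[OF d] by (simp add: grad_def)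
  then show ?case using d by (auto simp: differentiable_def intro: rational_on.const)
next
  case (const c)
  have "grad (\<lambda>U. c) U $ j = 0" for U j by (simp add: grad_def)
  then show ?case by (auto intro: rational_on.const)
next
  case (add f g)
  show ?case
  proof (intro conjI ballI allI)
    fix j
    have "grad (\<lambda>U. f U + g U) U $ j = grad f U $ j + grad g U $ j" if "U \<in> S" for U
    proof -
      have "((\<lambda>U. f U + g U) has_derivative
          (\<lambda>h. frechet_derivative f (at U) h + frechet_derivative g (at U) h)) (at U)"
        using add.IH that by (intro has_derivative_add) (auto simp flip: frechet_derivative_works)
      from frechet_derivative_at[OF this, symmetric] show ?thesis by (simp add: grad_def)
    qed
    then show "rational_on S (\<lambda>U. grad (\<lambda>U. f U + g U) U $ j)"
      by (rule rational_on.cong[of S "\<lambda>U. grad f U $ j + grad g U $ j", rotated]) (use add in \<open>auto intro: rational_on.add\<close>)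
  qed (use add.IH in auto)
next
  case (mult f g)
  show ?case
  proof (intro conjI ballI allI)
    fix j
    have "grad (\<lambda>U. f U * g U) U $ j = f U * grad g U $ j + grad f U $ j * g U" if "U \<in> S" for U
    proof -
      have "((\<lambda>U. f U * g U) has_derivative
          (\<lambda>h. f U * frechet_derivative g (at U) h + frechet_derivative f (at U) h * g U)) (at U)"
        using mult.IH that by (intro has_derivative_mult) (auto simp flip: frechet_derivative_works)
      from frechet_derivative_at[OF this, symmetric] show ?thesis by (simp add: grad_def)
    qed
    then show "rational_on S (\<lambda>U. grad (\<lambda>U. f U * g U) U $ j)"
      by (rule rational_on.cong[of S "\<lambda>U. f U * grad g U $ j + grad f U $ j * g U", rotated])
        (use mult in \<open>auto intro!: rational_on.add rational_on.mult\<close>)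
  qed (use mult.IH in auto)
next
  case (inverse f)
  show ?case
  proof (intro conjI ballI allI)
    have d: "((\<lambda>U. inverse (f U)) has_derivative
          (\<lambda>h. - (inverse (f U) * frechet_derivative f (at U) h * inverse (f U)))) (at U)" if "U \<in> S" for U
        using inverse that by (intro Deriv.has_derivative_inverse) (auto simp flip: frechet_derivative_works)
    fix j
    have eq: "grad (\<lambda>U. inverse (f U)) U $ j = - (inverse (f U) * grad f U $ j * inverse (f U))" if "U \<in> S" for U
      using frechet_derivative_at[OF d[OF that], symmetric] by (simp add: grad_def)
    show "rational_on S (\<lambda>U. grad (\<lambda>U. inverse (f U)) U $ j)"
      by (rule rational_on.cong[OF _ eq], intro rational_on_minus rational_on.mult rational_on.inverse)
        (use inverse in auto)
    fix U assume "U \<in> S"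
    then show "(\<lambda>U. inverse (f U)) differentiable at U" using d by (auto simp: differentiable_def)
  qed
next
  case (cong f g)
  have d: "(g has_derivative frechet_derivative f (at U)) (at U)" if "U \<in> S" for U
    by (rule has_derivative_transform_within_open[of f _ U UNIV S])
       (use cong that assms(2) in \<open>auto simp flip: frechet_derivative_works\<close>)
  then have "grad g U $ j = grad f U $ j" if "U \<in> S" for U j
    using frechet_derivative_at[OF d[OF that]] by (simp add: grad_def)
  then have "rational_on S (\<lambda>U. grad g U $ j)" for j
    by (rule rational_on.cong[of S "\<lambda>U. grad f U $ j", rotated]) (use cong.IH in auto)
  then show ?case using d by (auto simp: differentiable_def)
qed

lemma rational_on_expandable:
  assumes "rational_on S f"
    and w: "\<And>i. expandable Z (\<lambda>z s. w z s $ i)"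
    and C: "compact C" "C \<subseteq> S" "\<And>z. z \<in> Z \<Longrightarrow> w z 0 \<in> C"
    and S: "near Z (\<lambda>z s. w z s \<in> S)"
  shows "expandable Z (\<lambda>z s. f (w z s))"
  using assms(1)
proof (induction rule: rational_on.induct)
  case (component i) then show ?case by (rule w)
next
  case (const c) then show ?case by (rule expandable_const)
next
  case (add f g) then show ?case by (intro expandable_add)
next
  case (mult f g) then show ?case by (intro expandable_mult)
next
  case (inverse f)
  obtain M where M: "M > 0" "\<And>U. U \<in> C \<Longrightarrow> \<bar>inverse (f U)\<bar> \<le> M"
    using rational_on_bounded[OF rational_on.inverse[OF inverse(1,2)] C(1,2)] by blast
  have "1 / M \<le> \<bar>f (w z 0)\<bar>" if "z \<in> Z" for z
  proof -
    have "f (w z 0) \<noteq> 0" using inverse(2) C that by auto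
    moreover have "\<bar>inverse (f (w z 0))\<bar> \<le> M" using M C that by auto
    ultimately show ?thesis using M(1) by (simp add: field_simps abs_inverse)
  qed
  then show ?case using inverse.IH M(1) by (intro expandable_inverse[of _ _ "1 / M"]) auto
next
  case (cong f g)
  show ?case by (rule expandable_cong[OF cong.IH near_mono[OF S]]) (use cong in auto)
qed

lemma rational_on_bounded_below:
  assumes "rational_on S f" "\<And>U. U \<in> S \<Longrightarrow> f U > 0"
    and C: "compact C" "C \<subseteq> S" "\<And>z. z \<in> Z \<Longrightarrow> w z 0 \<in> C"
  shows "bounded_below Z (\<lambda>z s. f (w z s))"
proof -
  obtain M where M: "M > 0" "\<And>U. U \<in> C \<Longrightarrow> \<bar>inverse (f U)\<bar> \<le> M"
  proof (rule rational_on_bounded[OF rational_on.inverse[OF assms(1)] C(1,2)])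
    show "\<And>U. U \<in> S \<Longrightarrow> f U \<noteq> 0" using assms(2) by force
  qed (rule that)
  have "1 / M \<le> f (w z 0)" if "z \<in> Z" for z
  proof -
    have "f (w z 0) > 0" using assms(2) C that by auto
    moreover have "\<bar>inverse (f (w z 0))\<bar> \<le> M" using M C that by auto
    ultimately show ?thesis using M(1) by (simp add: field_simps)
  qed
  then show ?thesis unfolding bounded_below_def using M(1) by (intro exI[of _ "1 / M"]) auto
qed

text \<open>Taylor's theorem along the line in direction \<open>e\<close>. The iterated directional derivatives are bounded on the
  compact set swept out by segments of length one, which gives the uniformity.\<close>
lemma smooth_line_expandable:
  fixes f :: "'a::euclidean_space \<Rightarrow> real^'n"
  assumes sm: "smooth_on f S" and K: "compact K" and e: "e \<in> Basis"
    and in_S: "\<And>z s. z \<in> K \<Longrightarrow> z + s *\<^sub>R e \<in> S"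
  shows "expandable K (\<lambda>z s. f (z + s *\<^sub>R e) $ i)"
  unfolding expandable_def
proof
  fix n
  \<comment> \<open>The iterated derivatives in direction \<open>e\<close>.\<close>
  define g where "g = rec_nat f (\<lambda>_ h x. frechet_derivative h (at x) e)"
  have g0: "g 0 = f" and gS: "g (Suc m) = (\<lambda>x. frechet_derivative (g m) (at x) e)" for m
    by (simp_all add: g_def)
  have Ck: "Ck_on k (g m) S" for k m
  proof (induction m arbitrary: k)
    case 0 then show ?case using sm by (simp add: smooth_on_def g0)
  next
    case (Suc m)
    show ?case using Suc[of "Suc k"] e by (simp add: gS)
  qed
  have cont: "continuous_on S (g m)" for m using Ck[of 0 m] by simp
  have der: "((\<lambda>t. g m (z + t *\<^sub>R e) $ i) has_real_derivative g (Suc m) (z + s *\<^sub>R e) $ i) (at s)"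
    if "z \<in> K" for m z s
  proof -
    have "g m differentiable at (z + s *\<^sub>R e)" using Ck[of "Suc 0" m] in_S[OF that] by simp
    then have "(g m has_derivative frechet_derivative (g m) (at (z + s *\<^sub>R e))) (at (z + s *\<^sub>R e))"
      by (simp flip: frechet_derivative_works)
    moreover have "((\<lambda>t. z + t *\<^sub>R e) has_derivative (\<lambda>h. h *\<^sub>R e)) (at s)"
      by (auto intro!: derivative_eq_intros)
    ultimately have "((\<lambda>t. g m (z + t *\<^sub>R e)) has_derivative
        (\<lambda>h. frechet_derivative (g m) (at (z + s *\<^sub>R e)) (h *\<^sub>R e))) (at s)"
      using has_derivative_compose by blast
    moreover have "linear (frechet_derivative (g m) (at (z + s *\<^sub>R e)))"
      using \<open>g m differentiable at _\<close> by (rule linear_frechet_derivative)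
    ultimately have "((\<lambda>t. g m (z + t *\<^sub>R e)) has_vector_derivative g (Suc m) (z + s *\<^sub>R e)) (at s)"
      by (simp add: has_vector_derivative_def gS linear_scale)
    then show ?thesis
      by (simp add: has_real_derivative_iff_has_vector_derivative bounded_linear.has_vector_derivative[OF bounded_linear_vec_nth])
  qed
  define K' where "K' = (\<lambda>(z, s). z + s *\<^sub>R e) ` (K \<times> {-1..1::real})"
  have "compact K'" unfolding K'_def
    by (rule compact_continuous_image) (auto intro!: continuous_intros compact_Times K simp: case_prod_unfold)
  moreover have "K' \<subseteq> S" using in_S by (auto simp: K'_def)
  ultimately have "bounded (g m ` K')" for m
    using cont continuous_on_subset compact_continuous_image compact_imp_bounded by metis
  then have "\<forall>m. \<exists>M>0. \<forall>x\<in>K'. norm (g m x) \<le> M" by (simp add: bounded_pos)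
  then obtain M where M: "\<And>m. M m > 0" "\<And>m x. x \<in> K' \<Longrightarrow> norm (g m x) \<le> M m" by metis
  have bd: "\<bar>g m (z + s *\<^sub>R e) $ i / fact m\<bar> \<le> (\<Sum>m\<le>n. M m)" if "m \<le> n" "z \<in> K" "\<bar>s\<bar> \<le> 1" for m z s
  proof -
    have "z + s *\<^sub>R e \<in> K'" using that unfolding K'_def by force
    then have "\<bar>g m (z + s *\<^sub>R e) $ i\<bar> \<le> M m" using M(2) component_le_norm_cart order_trans by blast
    moreover have "\<bar>g m (z + s *\<^sub>R e) $ i / fact m\<bar> \<le> \<bar>g m (z + s *\<^sub>R e) $ i\<bar>"
      using fact_ge_1[of m, where ?'a = real] by (simp add: abs_divide divide_le_eq mult_le_cancel_left1)
    moreover have "M m \<le> (\<Sum>m\<le>n. M m)" using that M(1) by (intro member_le_sum) (auto intro: less_imp_le)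
    ultimately show ?thesis by linarith
  qed
  show "expands n K (\<lambda>z s. f (z + s *\<^sub>R e) $ i)"
  proof (rule expands_polynomial_remainder[of n K "\<lambda>m z. g m z $ i / fact m" "\<Sum>m\<le>n. M m" 1])
    show "\<bar>g m z $ i / fact m\<bar> \<le> (\<Sum>m\<le>n. M m)" if "m < n" "z \<in> K" for m z
      using bd[of m z 0] that by simp
    show "0 \<le> (\<Sum>m\<le>n. M m)" using M(1) by (intro sum_nonneg) (auto intro: less_imp_le)
    fix z :: "'a" and s :: real assume z: "z \<in> K" and s: "\<bar>s\<bar> < 1"
    obtain t where t: "\<bar>t\<bar> \<le> \<bar>s\<bar>" "f (z + s *\<^sub>R e) $ i = (\<Sum>m<n. g m (z + 0 *\<^sub>R e) $ i / fact m * s ^ m)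
        + g n (z + t *\<^sub>R e) $ i / fact n * s ^ n"
      using Maclaurin_bi_le[of "\<lambda>m t. g m (z + t *\<^sub>R e) $ i" "\<lambda>t. f (z + t *\<^sub>R e) $ i" n s] der[OF z]
      by (auto simp: g0)
    then show "\<exists>r. \<bar>r\<bar> \<le> (\<Sum>m\<le>n. M m) \<and>
        f (z + s *\<^sub>R e) $ i = (\<Sum>m<n. g m z $ i / fact m * s ^ m) + r * s ^ n"
      using bd[of n z t] z s by (intro exI[of _ "g n (z + t *\<^sub>R e) $ i / fact n"]) auto
  qed simp
qed

section \<open>The fluxes and the nonconservative matrices\<close>

lemma rational_p_perp: "rational_on {U. U $ 1 > 0} p_perp"
  unfolding p_perp_alt[abs_def] by (intro rational_intros) auto

lemma open_pos_states: "open pos_states"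
proof -
  have 1: "open {U :: state. U $ 1 > 0}" "open {U :: state. U $ 5 > 0}"
    by (auto intro!: open_Collect_less continuous_intros)
  have "open ({U :: state. U $ 1 > 0} \<inter> p_perp -` {0<..})"
    by (rule continuous_open_preimage[OF rational_on_continuous[OF rational_p_perp] 1(1)]) simp
  moreover have "pos_states = ({U. U $ 1 > 0} \<inter> p_perp -` {0<..}) \<inter> {U. U $ 5 > 0}"
    by (auto simp: pos_states_def rho_def p_par_def)
  ultimately show ?thesis using 1(2) by (metis open_Int)
qed

text \<open>The set on which the field direction is differentiable. Unlike \<open>Omega\<close> it is open.\<close>
definition magnetized :: "state set" where
  "magnetized = {U \<in> pos_states. mag U \<noteq> 0}"

lemma rational_state_functions:
  "rational_on pos_states rho" "rational_on pos_states p_par" "rational_on pos_states energy"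
  "rational_on pos_states p_perp" "rational_on pos_states beta_perp" "rational_on pos_states beta_par"
proof -
  show r: "rational_on pos_states rho" and pp: "rational_on pos_states p_par"
    and "rational_on pos_states energy"
    unfolding rho_def[abs_def] p_par_def[abs_def] energy_def[abs_def] by (intro rational_intros)+
  show pt: "rational_on pos_states p_perp"
    by (rule rational_on_subset[OF rational_p_perp]) (auto simp: pos_states_def rho_def)
  show "rational_on pos_states beta_perp" "rational_on pos_states beta_par"
    unfolding beta_perp_def[abs_def] beta_par_def[abs_def]
    using rational_on_divide[OF r pt] rational_on_divide[OF r pp] by (auto simp: pos_states_def)
qed

lemma rational_vel: "rational_on pos_states (\<lambda>U. vel U $ i)"
proof -
  have "rational_on pos_states (\<lambda>U. vel U $ 1)" "rational_on pos_states (\<lambda>U. vel U $ 2)"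
    "rational_on pos_states (\<lambda>U. vel U $ 3)"
    unfolding vel_def vector_3 by (intro rational_intros; auto simp: pos_states_def rho_def)+
  then show ?thesis using exhaust_3[of i] by auto
qed

lemma rational_mag: "rational_on S (\<lambda>U. mag U $ i)"
proof -
  have "rational_on S (\<lambda>U. mag U $ 1)" "rational_on S (\<lambda>U. mag U $ 2)" "rational_on S (\<lambda>U. mag U $ 3)"
    unfolding mag_def vector_3 by (intro rational_intros)+
  then show ?thesis using exhaust_3[of i] by auto
qed

lemma rational_norms:
  "rational_on pos_states (\<lambda>U. (norm (vel U))\<^sup>2)" "rational_on S (\<lambda>U. (norm (mag U))\<^sup>2)"
  "rational_on pos_states (\<lambda>U. vel U \<bullet> mag U)" "rational_on pos_states (\<lambda>U. mag U \<bullet> vel U)"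
  unfolding norm_sq_3 inner_vec_def inner_real_def
  by (intro rational_intros rational_vel rational_mag)+

lemmas state_intros = rational_norms rational_intros rational_state_functions rational_vel rational_mag

lemma exhaust_9: "i = 1 \<or> i = 2 \<or> i = 3 \<or> i = 4 \<or> i = 5 \<or> i = 6 \<or> i = 7 \<or> i = 8 \<or> i = (9 :: 9)"
  using UNIV_9 by (metis UNIV_I empty_iff insertE)

lemma rational_vector_9:
  assumes "rational_on S f1" "rational_on S f2" "rational_on S f3" "rational_on S f4" "rational_on S f5"
    "rational_on S f6" "rational_on S f7" "rational_on S f8" "rational_on S f9"
  shows "rational_on S (\<lambda>U. (vector [f1 U, f2 U, f3 U, f4 U, f5 U, f6 U, f7 U, f8 U, f9 U] :: real^9) $ i)"
  using exhaust_9[of i] assms by (elim disjE) (simp_all only: vector_9)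

lemma rational_flux: "rational_on pos_states (\<lambda>U. flux d U $ i)"
  unfolding flux_def Let_def
  by (rule rational_vector_9;
      (simp only: vector_minus_component vector_add_component vector_scaleR_component real_scaleR_def)?;
      intro state_intros; simp)

lemma rational_phi_grad: "rational_on pos_states (\<lambda>U. phi_grad U $ i)"
  unfolding phi_grad_def by (rule rational_vector_9; intro state_intros)

lemma rational_on_has_derivative:
  assumes "rational_on S f" "open S" "U \<in> S"
  shows "(f has_derivative (\<lambda>h. grad f U \<bullet> h)) (at U)"
proof -
  have d: "f differentiable (at U)" using rational_on_partial[OF assms(1,2)] assms(3) by blast
  have lin: "linear (frechet_derivative f (at U))" by (rule linear_frechet_derivative[OF d])
  have eq: "frechet_derivative f (at U) h = grad f U \<bullet> h" for h
  proof -
    have "h = (\<Sum>j\<in>UNIV. h $ j *\<^sub>R axis j 1)" using basis_expansion[of h] by (simp add: scalar_mult_eq_scaleR)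
    then have "frechet_derivative f (at U) h = frechet_derivative f (at U) (\<Sum>j\<in>UNIV. h $ j *\<^sub>R axis j 1)"
      by simp
    also have "\<dots> = (\<Sum>j\<in>UNIV. h $ j * frechet_derivative f (at U) (axis j 1))"
      by (simp add: linear_sum[OF lin] linear_scale[OF lin])
    also have "\<dots> = grad f U \<bullet> h" by (simp add: inner_vec_def grad_def mult.commute)
    finally show ?thesis .
  qed
  then have "frechet_derivative f (at U) = (\<lambda>h. grad f U \<bullet> h)" by (rule ext)
  then show ?thesis using d by (simp add: frechet_derivative_works)
qed

lemma rational_grad: "rational_on S f \<Longrightarrow> open S \<Longrightarrow> rational_on S (\<lambda>U. grad f U $ j)"
  using rational_on_partial by blast

lemma rational_Amat: "rational_on pos_states (\<lambda>U. Amat d U $ i $ j)"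
proof (rule rational_on.cong)
  show "rational_on pos_states (\<lambda>U. grad (\<lambda>W. flux d W $ i) U $ j
      + phi_grad U $ i * grad (\<lambda>W. mag W $ dir_idx d) U $ j)"
    by (intro rational_intros rational_grad rational_flux rational_mag open_pos_states rational_phi_grad)
  fix U assume U: "U \<in> pos_states"
  have "(flux d has_derivative (\<lambda>h. \<chi> i. grad (\<lambda>W. flux d W $ i) U \<bullet> h)) (at U)"
    unfolding has_derivative_componentwise_within[where f = "flux d"]
    using rational_on_has_derivative[OF rational_flux open_pos_states U]
    by (auto simp: Basis_vec_def inner_axis)
  from frechet_derivative_at[OF this, symmetric]
  show "Amat d U $ i $ j = grad (\<lambda>W. flux d W $ i) U $ j
      + phi_grad U $ i * grad (\<lambda>W. mag W $ dir_idx d) U $ j"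
    by (simp add: Amat_def jacobian_def matrix_def inner_axis)
qed

lemma open_magnetized: "open magnetized"
proof -
  have "open (pos_states \<inter> (\<lambda>U. (norm (mag U))\<^sup>2) -` {0<..})"
    by (rule continuous_open_preimage[OF rational_on_continuous open_pos_states])
       (auto intro: rational_norms)
  moreover have "magnetized = pos_states \<inter> (\<lambda>U. (norm (mag U))\<^sup>2) -` {0<..}"
    by (auto simp: magnetized_def)
  ultimately show ?thesis by simp
qed

lemma magnetized_subset: "magnetized \<subseteq> pos_states" "Omega \<subseteq> magnetized"
  by (auto simp: magnetized_def Omega_def)

text \<open>Products of two components of the field direction contain no square root.\<close>
lemma bdir_product: "bdir W $ d * bdir W $ l = mag W $ d * mag W $ l / (norm (mag W))\<^sup>2"
  by (simp add: bdir_def power2_eq_square field_simps)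

lemmas on_magnetized = rational_on_subset[OF _ magnetized_subset(1)]

lemma rational_bdir: "rational_on magnetized (\<lambda>W. bdir W $ d * bdir W $ l)"
  unfolding bdir_product
  by (intro rational_intros rational_mag rational_norms) (auto simp: magnetized_def)

lemma rational_stress: "rational_on magnetized (\<lambda>W. delta_p W * bdir W $ d * bdir W $ l)"
  unfolding mult.assoc delta_p_def[abs_def]
  by (intro rational_intros rational_bdir) (intro on_magnetized state_intros)+

lemma rational_vel_magnetized: "rational_on magnetized (\<lambda>W. vel W $ l)"
  by (intro on_magnetized rational_vel)

lemma stress_power: "delta_p W * bdir W $ d * (bdir W \<bullet> vel W)
    = (\<Sum>l\<in>UNIV. delta_p W * bdir W $ d * bdir W $ l * vel W $ l)"
  by (simp add: inner_vec_def sum_distrib_left mult.assoc)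

lemma rational_stress_power: "rational_on magnetized (\<lambda>W. delta_p W * bdir W $ d * (bdir W \<bullet> vel W))"
  unfolding stress_power by (intro rational_intros rational_stress rational_vel_magnetized)

lemma vector_9_nth:
  fixes a :: "'a::zero"
  shows "(vector [a, b, c, d, e, f, g, h, k] :: 'a^9) $ 1 = a"
    "(vector [a, b, c, d, e, f, g, h, k] :: 'a^9) $ 2 = b"
    "(vector [a, b, c, d, e, f, g, h, k] :: 'a^9) $ 3 = c"
    "(vector [a, b, c, d, e, f, g, h, k] :: 'a^9) $ 4 = d"
    "(vector [a, b, c, d, e, f, g, h, k] :: 'a^9) $ 5 = e"
    "(vector [a, b, c, d, e, f, g, h, k] :: 'a^9) $ 6 = f"
    "(vector [a, b, c, d, e, f, g, h, k] :: 'a^9) $ 7 = g"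
    "(vector [a, b, c, d, e, f, g, h, k] :: 'a^9) $ 8 = h"
    "(vector [a, b, c, d, e, f, g, h, k] :: 'a^9) $ 9 = k"
  unfolding vector_def by simp_all

lemma rational_Cmat: "rational_on magnetized (\<lambda>U. Cmat d U $ i $ j)"
proof -
  have z: "rational_on magnetized (\<lambda>U. (0 :: real^9) $ j)" by (simp add: rational_on.const)
  have r: "rational_on magnetized (\<lambda>U. grad (\<lambda>W. delta_p W * bdir W $ dir_idx d * bdir W $ l) U $ j)" for l
    by (intro rational_grad rational_stress open_magnetized)
  have e: "rational_on magnetized (\<lambda>U. grad (\<lambda>W. delta_p W * bdir W $ dir_idx d * (bdir W \<bullet> vel W)) U $ j)"
    by (intro rational_grad rational_stress_power open_magnetized)
  have p: "rational_on magnetized (\<lambda>U. ((2 * p_par U * bdir U $ dir_idx d) *\<^sub>R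
      (\<Sum>l\<in>UNIV. bdir U $ l *\<^sub>R grad (\<lambda>W. vel W $ l) U)) $ j)"
  proof -
    have eq: "((2 * p_par U * bdir U $ dir_idx d) *\<^sub>R (\<Sum>l\<in>UNIV. bdir U $ l *\<^sub>R grad (\<lambda>W. vel W $ l) U)) $ j
        = 2 * p_par U * (\<Sum>l\<in>UNIV. (bdir U $ dir_idx d * bdir U $ l) * grad (\<lambda>W. vel W $ l) U $ j)" for U
      by (simp add: sum_distrib_left mult.assoc)
    show "rational_on magnetized (\<lambda>U. ((2 * p_par U * bdir U $ dir_idx d) *\<^sub>R
      (\<Sum>l\<in>UNIV. bdir U $ l *\<^sub>R grad (\<lambda>W. vel W $ l) U)) $ j)" unfolding eq
      by (intro rational_intros rational_bdir rational_grad rational_vel_magnetized open_magnetized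
          on_magnetized[OF rational_state_functions(2)])
  qed
  show ?thesis
    unfolding Cmat_def Let_def using exhaust_9[of i] z r e p
    by (elim disjE) (simp_all only: vector_9_nth)
qed

lemma matrix_vector_mult_nth: "(M *v w) $ i = M $ i \<bullet> (w :: real^9)"
  by (simp add: matrix_vector_mult_def inner_vec_def)

lemma Cmat_row:
  "(Cmat d U *v w) $ 1 = 0" "(Cmat d U *v w) $ 7 = 0" "(Cmat d U *v w) $ 8 = 0" "(Cmat d U *v w) $ 9 = 0"
  "(Cmat d U *v w) $ 2 = grad (\<lambda>W. delta_p W * bdir W $ dir_idx d * bdir W $ 1) U \<bullet> w"
  "(Cmat d U *v w) $ 3 = grad (\<lambda>W. delta_p W * bdir W $ dir_idx d * bdir W $ 2) U \<bullet> w"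
  "(Cmat d U *v w) $ 4 = grad (\<lambda>W. delta_p W * bdir W $ dir_idx d * bdir W $ 3) U \<bullet> w"
  "(Cmat d U *v w) $ 5 = 2 * p_par U * bdir U $ dir_idx d * (\<Sum>l\<in>UNIV. bdir U $ l * (grad (\<lambda>W. vel W $ l) U \<bullet> w))"
  "(Cmat d U *v w) $ 6 = grad (\<lambda>W. delta_p W * bdir W $ dir_idx d * (bdir W \<bullet> vel W)) U \<bullet> w"
  unfolding matrix_vector_mult_nth Cmat_def Let_def vector_9_nth
  by (simp_all only: inner_zero_left inner_scaleR_left inner_sum_left)

text \<open>By the product rule, the gradient of \<open>\<Delta>P b\<^sub>d (b \<bullet> u)\<close> splits into \<open>\<Sum> u\<^sub>l \<nabla>(\<Delta>P b\<^sub>d b\<^sub>l)\<close>, which cancels the momentum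
  rows, and \<open>\<Delta>P b\<^sub>d \<Sum> b\<^sub>l \<nabla>u\<^sub>l\<close>, which cancels the row of the parallel pressure since
  \<open>(\<beta>_perp - \<beta>_par) p_par = \<beta>_perp \<Delta>P\<close>.\<close>
lemma entropy_var_Cmat:
  assumes "U \<in> magnetized"
  shows "entropy_var U \<bullet> (Cmat d U *v w) = 0"
proof -
  have p: "rho U > 0" "p_par U > 0" "p_perp U > 0" using assms by (auto simp: magnetized_def pos_states_def)
  define T where "T l W = delta_p W * bdir W $ dir_idx d * bdir W $ l" for l W
  define u' where "u' l = grad (\<lambda>W. vel W $ l) U \<bullet> w" for l
  define T' where "T' l = grad (T l) U \<bullet> w" for l
  have sp: "delta_p W * bdir W $ dir_idx d * (bdir W \<bullet> vel W) = T 1 W * vel W $ 1 + T 2 W * vel W $ 2 + T 3 W * vel W $ 3" for W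
    unfolding stress_power T_def by (simp add: sum_3)
  have dT: "(T l has_derivative (\<lambda>h. grad (T l) U \<bullet> h)) (at U)" for l
    unfolding T_def by (rule rational_on_has_derivative[OF rational_stress open_magnetized assms])
  have du: "((\<lambda>W. vel W $ l) has_derivative (\<lambda>h. grad (\<lambda>W. vel W $ l) U \<bullet> h)) (at U)" for l
    by (rule rational_on_has_derivative[OF rational_vel_magnetized open_magnetized assms])
  note dTu = has_derivative_mult[OF dT du]
  have "grad (\<lambda>W. T 1 W * vel W $ 1 + T 2 W * vel W $ 2 + T 3 W * vel W $ 3) U \<bullet> w
     = frechet_derivative (\<lambda>W. T 1 W * vel W $ 1 + T 2 W * vel W $ 2 + T 3 W * vel W $ 3) (at U) w"
  proof -
    have "rational_on magnetized (\<lambda>W. T 1 W * vel W $ 1 + T 2 W * vel W $ 2 + T 3 W * vel W $ 3)"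
      using rational_stress_power[of "dir_idx d"] unfolding sp .
    from frechet_derivative_at[OF rational_on_has_derivative[OF this open_magnetized assms], symmetric]
    show ?thesis by simp
  qed
  also have "\<dots> = (T 1 U * u' 1 + T' 1 * vel U $ 1) + (T 2 U * u' 2 + T' 2 * vel U $ 2) + (T 3 U * u' 3 + T' 3 * vel U $ 3)"
    using frechet_derivative_at[OF has_derivative_add[OF has_derivative_add[OF dTu[of 1 1] dTu[of 2 2]] dTu[of 3 3]], symmetric]
    by (simp add: u'_def T'_def)
  finally have r6: "(Cmat d U *v w) $ 6 = (T 1 U * u' 1 + T' 1 * vel U $ 1) + (T 2 U * u' 2 + T' 2 * vel U $ 2) + (T 3 U * u' 3 + T' 3 * vel U $ 3)"
    unfolding Cmat_row sp .
  have r5: "(- beta_par U + beta_perp U) * (Cmat d U *v w) $ 5 = 2 * beta_perp U * (T 1 U * u' 1 + T 2 U * u' 2 + T 3 U * u' 3)"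
  proof -
    have k: "(- beta_par U + beta_perp U) * p_par U = beta_perp U * delta_p U"
      using p by (simp add: beta_par_def beta_perp_def delta_p_def field_simps)
    have "(- beta_par U + beta_perp U) * (Cmat d U *v w) $ 5
        = 2 * ((- beta_par U + beta_perp U) * p_par U) * bdir U $ dir_idx d * (\<Sum>l\<in>UNIV. bdir U $ l * u' l)"
      unfolding Cmat_row u'_def by (simp only: mult_ac)
    also have "\<dots> = 2 * (beta_perp U * delta_p U) * bdir U $ dir_idx d * (\<Sum>l\<in>UNIV. bdir U $ l * u' l)"
      unfolding k ..
    finally show ?thesis by (simp add: sum_3 T_def algebra_simps)
  qed
  have r: "(Cmat d U *v w) $ 2 = T' 1" "(Cmat d U *v w) $ 3 = T' 2" "(Cmat d U *v w) $ 4 = T' 3"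
    unfolding Cmat_row T'_def T_def[abs_def] by simp_all
  have "entropy_var U \<bullet> (Cmat d U *v w)
      = 2 * beta_perp U * (vel U $ 1 * T' 1 + vel U $ 2 * T' 2 + vel U $ 3 * T' 3)
        + (- beta_par U + beta_perp U) * (Cmat d U *v w) $ 5 - 2 * beta_perp U * (Cmat d U *v w) $ 6"
    by (simp add: inner_vec_def sum_9 entropy_var_def vector_9 Cmat_row(1-4) r algebra_simps)
  then show ?thesis unfolding r5 r6 by (simp add: algebra_simps)
qed

section \<open>The Jacobian of the inverse entropy-variable map\<close>

lemma rational_on_compose:
  assumes "rational_on S' f" "\<And>j. rational_on S (\<lambda>U. w U $ j)" "\<And>U. U \<in> S \<Longrightarrow> w U \<in> S'"
  shows "rational_on S (\<lambda>U. f (w U))"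
  using assms(1)
proof (induction rule: rational_on.induct)
  case (inverse f)
  show ?case by (rule rational_on.inverse[OF inverse.IH]) (use inverse assms(3) in auto)
next
  case (cong f g)
  show ?case by (rule rational_on.cong[OF cong.IH]) (use cong assms(3) in auto)
qed (auto intro: rational_on.intros(2-4) assms(2))

text \<open>The functions \<open>bperp_of\<close>, \<open>bpar_of\<close>, \<open>kin_of\<close> recover \<open>\<beta>_perp\<close>, \<open>\<beta>_par\<close> and \<open>\<beta>_perp |u|\<^sup>2\<close> from the entropy variable.\<close>
definition bperp_of :: "real^9 \<Rightarrow> real" where "bperp_of V = - V $ 6 / 2"

definition bpar_of :: "real^9 \<Rightarrow> real" where "bpar_of V = bperp_of V - V $ 5"

definition kin_of :: "real^9 \<Rightarrow> real" where
  "kin_of V = ((V $ 2)\<^sup>2 + (V $ 3)\<^sup>2 + (V $ 4)\<^sup>2) / (4 * bperp_of V)"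

definition entropy_domain :: "(real^9) set" where
  "entropy_domain = {V. bperp_of V > 0 \<and> bpar_of V > 0}"

text \<open>The conserved variables as rational functions of the density and of \<open>V\<^sub>2, \<dots>, V\<^sub>9\<close>. Only the density, in
  place of \<open>V\<^sub>1\<close>, depends on \<open>V\<close> through a logarithm; separating it keeps the derivative rational.\<close>
definition cons_of :: "real^9 \<Rightarrow> state" where
  "cons_of Y = vector [Y $ 1, Y $ 1 * Y $ 2 / (2 * bperp_of Y), Y $ 1 * Y $ 3 / (2 * bperp_of Y),
     Y $ 1 * Y $ 4 / (2 * bperp_of Y), Y $ 1 / bpar_of Y,
     Y $ 1 / bperp_of Y + Y $ 1 * kin_of Y / (2 * bperp_of Y)
       + ((Y $ 7)\<^sup>2 + (Y $ 8)\<^sup>2 + (Y $ 9)\<^sup>2) / (8 * (bperp_of Y)\<^sup>2) + Y $ 1 / (2 * bpar_of Y),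
     Y $ 7 / (2 * bperp_of Y), Y $ 8 / (2 * bperp_of Y), Y $ 9 / (2 * bperp_of Y)]"

definition drop_first :: "real^9 \<Rightarrow> real^9" where
  "drop_first V = (\<chi> i. if i = 1 then 0 else V $ i)"

text \<open>Solves \<open>s = - ln (\<rho>\<^sup>2 \<beta>_par \<beta>_perp\<^sup>2)\<close> for \<open>ln \<rho>\<close>, where \<open>s = 5 - V\<^sub>1 - \<beta>_perp |u|\<^sup>2\<close>.\<close>
definition log_rho_of :: "real^9 \<Rightarrow> real" where
  "log_rho_of V = (V $ 1 + kin_of (drop_first V) - 5) / 2 - ln (bperp_of (drop_first V))
     - ln (bpar_of (drop_first V)) / 2"

definition with_rho :: "real^9 \<Rightarrow> real^9" where
  "with_rho V = drop_first V + exp (log_rho_of V) *\<^sub>R axis 1 1"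

definition state_of :: "real^9 \<Rightarrow> state" where
  "state_of V = cons_of (with_rho V)"

lemma nine_neq_one: "(2::9) \<noteq> 1" "(3::9) \<noteq> 1" "(4::9) \<noteq> 1" "(5::9) \<noteq> 1" "(6::9) \<noteq> 1" "(7::9) \<noteq> 1"
  "(8::9) \<noteq> 1" "(9::9) \<noteq> 1"
  by simp_all

lemma drop_first_nth:
  "drop_first V $ 1 = 0" "i \<noteq> 1 \<Longrightarrow> drop_first V $ i = V $ i"
  by (simp_all add: drop_first_def)

lemma with_rho_nth: "with_rho V $ 1 = exp (log_rho_of V)" "i \<noteq> 1 \<Longrightarrow> with_rho V $ i = V $ i"
  by (simp_all add: with_rho_def drop_first_nth axis_def)

lemma of_drop:
  "bperp_of (drop_first V) = bperp_of V" "bpar_of (drop_first V) = bpar_of V" "kin_of (drop_first V) = kin_of V"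
  "bperp_of (with_rho V) = bperp_of V" "bpar_of (with_rho V) = bpar_of V" "kin_of (with_rho V) = kin_of V"
  "drop_first V \<in> entropy_domain \<longleftrightarrow> V \<in> entropy_domain" "with_rho V \<in> entropy_domain \<longleftrightarrow> V \<in> entropy_domain"
  by (simp_all add: bperp_of_def bpar_of_def kin_of_def drop_first_nth with_rho_nth entropy_domain_def)

lemma of_entropy_var:
  assumes "U \<in> pos_states"
  shows "bperp_of (entropy_var U) = beta_perp U" "bpar_of (entropy_var U) = beta_par U"
    "kin_of (entropy_var U) = beta_perp U * (norm (vel U))\<^sup>2"
    "log_rho_of (entropy_var U) = ln (rho U)" "entropy_var U \<in> entropy_domain"
proof -
  have p: "rho U > 0" "beta_perp U > 0" "beta_par U > 0"
    using assms by (auto simp: pos_states_def beta_perp_def beta_par_def)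
  show b: "bperp_of (entropy_var U) = beta_perp U" and c: "bpar_of (entropy_var U) = beta_par U"
    by (simp_all add: bperp_of_def bpar_of_def entropy_var_def vector_9)
  show k: "kin_of (entropy_var U) = beta_perp U * (norm (vel U))\<^sup>2"
    unfolding kin_of_def b norm_sq_3 using p by (simp add: entropy_var_def vector_9 field_simps power2_eq_square)
  show "log_rho_of (entropy_var U) = ln (rho U)"
    unfolding log_rho_of_def of_drop b c k
    by (simp add: entropy_var_def vector_9 spec_entropy_alt[OF assms] add_divide_distrib)
  show "entropy_var U \<in> entropy_domain" using p by (simp add: entropy_domain_def b c)
qed

lemma state_of_entropy_var:
  assumes "U \<in> pos_states"
  shows "state_of (entropy_var U) = U"
proof -
  have p: "rho U > 0" "p_par U > 0" "p_perp U > 0" using assms by (auto simp: pos_states_def)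
  then have b: "beta_perp U > 0" "beta_par U > 0" by (auto simp: beta_perp_def beta_par_def)
  have Y: "with_rho (entropy_var U) $ 1 = rho U" using p by (simp add: with_rho_nth of_entropy_var[OF assms])
  have V: "entropy_var U $ 2 = 2 * beta_perp U * (U $ 2 / rho U)" "entropy_var U $ 3 = 2 * beta_perp U * (U $ 3 / rho U)"
    "entropy_var U $ 4 = 2 * beta_perp U * (U $ 4 / rho U)" "entropy_var U $ 7 = 2 * beta_perp U * U $ 7"
    "entropy_var U $ 8 = 2 * beta_perp U * U $ 8" "entropy_var U $ 9 = 2 * beta_perp U * U $ 9"
    by (simp_all add: entropy_var_def vector_9 vel_def mag_def rho_def)
  have r: "rho U / beta_par U = p_par U" "rho U / beta_perp U = p_perp U"
    using p by (simp_all add: beta_par_def beta_perp_def)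
  have "rho U * (beta_perp U * (norm (vel U))\<^sup>2) / (2 * beta_perp U) = rho U * (norm (vel U))\<^sup>2 / 2"
    "rho U / (2 * beta_par U) = p_par U / 2"
    using b r by auto
  moreover have "((2 * beta_perp U * U $ 7)\<^sup>2 + (2 * beta_perp U * U $ 8)\<^sup>2 + (2 * beta_perp U * U $ 9)\<^sup>2) / (8 * (beta_perp U)\<^sup>2)
      = (norm (mag U))\<^sup>2 / 2"
    unfolding norm_sq_3 mag_def vector_3 using b by (simp add: field_simps power2_eq_square)
  ultimately have e: "rho U / beta_perp U + rho U * (beta_perp U * (norm (vel U))\<^sup>2) / (2 * beta_perp U)
      + ((2 * beta_perp U * U $ 7)\<^sup>2 + (2 * beta_perp U * U $ 8)\<^sup>2 + (2 * beta_perp U * U $ 9)\<^sup>2) / (8 * (beta_perp U)\<^sup>2)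
      + rho U / (2 * beta_par U) = U $ 6"
    using r by (simp add: p_perp_def energy_def)
  show ?thesis
    unfolding vec_eq_9 state_of_def cons_of_def vector_9 of_drop of_entropy_var[OF assms] Y
      with_rho_nth(2)[OF nine_neq_one(1)] with_rho_nth(2)[OF nine_neq_one(2)] with_rho_nth(2)[OF nine_neq_one(3)]
      with_rho_nth(2)[OF nine_neq_one(6)] with_rho_nth(2)[OF nine_neq_one(7)] with_rho_nth(2)[OF nine_neq_one(8)] V e
    using p b r by (simp add: rho_def[symmetric] p_par_def[symmetric])
qed

lemma entropy_var_state_of:
  assumes "V \<in> entropy_domain"
  shows "state_of V \<in> pos_states" "entropy_var (state_of V) = V"
proof -
  define b c r U where "b = bperp_of V" and "c = bpar_of V" and "r = exp (log_rho_of V)" and "U = state_of V"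
  have bc: "b > 0" "c > 0" "r > 0" using assms by (auto simp: entropy_domain_def b_def c_def r_def)
  have nz: "b \<noteq> 0" "c \<noteq> 0" "r \<noteq> 0" using bc by auto
  have U: "U $ 1 = r" "U $ 2 = r * V $ 2 / (2 * b)" "U $ 3 = r * V $ 3 / (2 * b)" "U $ 4 = r * V $ 4 / (2 * b)"
    "U $ 5 = r / c" "U $ 6 = r / b + r * kin_of V / (2 * b) + ((V $ 7)\<^sup>2 + (V $ 8)\<^sup>2 + (V $ 9)\<^sup>2) / (8 * b\<^sup>2) + r / (2 * c)"
    "U $ 7 = V $ 7 / (2 * b)" "U $ 8 = V $ 8 / (2 * b)" "U $ 9 = V $ 9 / (2 * b)"
    by (simp_all add: U_def state_of_def cons_of_def vector_9 of_drop with_rho_nth b_def c_def r_def)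
  have v: "vel U $ 1 = V $ 2 / (2 * b)" "vel U $ 2 = V $ 3 / (2 * b)" "vel U $ 3 = V $ 4 / (2 * b)"
    and m: "mag U $ 1 = V $ 7 / (2 * b)" "mag U $ 2 = V $ 8 / (2 * b)" "mag U $ 3 = V $ 9 / (2 * b)"
    using nz by (simp_all add: vel_def mag_def U)
  have k: "(norm (vel U))\<^sup>2 = kin_of V / b"
    unfolding norm_sq_3 v kin_of_def b_def[symmetric] using nz by (simp add: field_simps power2_eq_square)
  have B: "(norm (mag U))\<^sup>2 = ((V $ 7)\<^sup>2 + (V $ 8)\<^sup>2 + (V $ 9)\<^sup>2) / (4 * b\<^sup>2)"
    unfolding norm_sq_3 m using nz by (simp add: field_simps power2_eq_square)
  have pt: "p_perp U = r / b"
    unfolding p_perp_def energy_def rho_def p_par_def k B U using nz by (simp add: field_simps)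
  have pos: "U \<in> pos_states" using bc by (simp add: pos_states_def rho_def p_par_def U pt)
  then show "state_of V \<in> pos_states" by (simp add: U_def)
  have beta: "beta_perp U = b" "beta_par U = c" using nz by (simp_all add: beta_perp_def beta_par_def rho_def p_par_def U pt)
  have s: "spec_entropy U = 5 - V $ 1 - kin_of V"
    unfolding spec_entropy_alt[OF pos] beta rho_def U r_def
    by (simp add: log_rho_of_def of_drop b_def c_def field_simps)
  have V5: "- c + b = V $ 5" and V6: "- 2 * b = V $ 6" by (simp_all add: b_def c_def bpar_of_def bperp_of_def)
  have "entropy_var U = V"
    unfolding vec_eq_9 entropy_var_def vector_9 s beta k v m V5 V6 using nz by simp
  then show "entropy_var (state_of V) = V" by (simp add: U_def)
qed

lemma inv_entropy_var:
  assumes "V \<in> entropy_domain"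
  shows "inv_into pos_states entropy_var V = state_of V"
proof -
  have "inj_on entropy_var pos_states" by (rule inj_on_inverseI) (rule state_of_entropy_var)
  from inv_into_f_f[OF this entropy_var_state_of(1)[OF assms]] show ?thesis
    by (simp add: entropy_var_state_of(2)[OF assms])
qed

lemma rational_of: "rational_on entropy_domain bperp_of" "rational_on entropy_domain bpar_of"
  "rational_on entropy_domain kin_of"
  unfolding bperp_of_def[abs_def] bpar_of_def[abs_def] kin_of_def[abs_def]
  by (intro rational_intros; auto simp: entropy_domain_def bperp_of_def)+

lemma rational_cons_of: "rational_on entropy_domain (\<lambda>Y. cons_of Y $ i)"
  unfolding cons_of_def
  by (rule rational_vector_9; intro rational_intros rational_of; auto simp: entropy_domain_def)

lemma open_entropy_domain: "open entropy_domain"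
  unfolding entropy_domain_def bperp_of_def bpar_of_def
  by (intro open_Collect_conj open_Collect_less continuous_intros) simp_all

lemma rational_drop_entropy_var: "rational_on pos_states (\<lambda>U. drop_first (entropy_var U) $ j)"
proof -
  have "drop_first (entropy_var U) = vector [0, 2 * beta_perp U * vel U $ 1, 2 * beta_perp U * vel U $ 2,
      2 * beta_perp U * vel U $ 3, - beta_par U + beta_perp U, - 2 * beta_perp U,
      2 * beta_perp U * mag U $ 1, 2 * beta_perp U * mag U $ 2, 2 * beta_perp U * mag U $ 3]" for U
    unfolding vec_eq_9 by (simp add: drop_first_nth entropy_var_def vector_9)
  then show ?thesis by (simp only:) (rule rational_vector_9; intro state_intros)
qed

lemma rational_with_rho_entropy_var: "rational_on pos_states (\<lambda>U. with_rho (entropy_var U) $ j)"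
proof (rule rational_on.cong)
  show "rational_on pos_states (\<lambda>U. drop_first (entropy_var U) $ j + rho U * axis 1 1 $ j)"
    by (intro rational_intros rational_drop_entropy_var rational_state_functions)
  show "with_rho (entropy_var U) $ j = drop_first (entropy_var U) $ j + rho U * axis 1 1 $ j"
    if "U \<in> pos_states" for U
    using that of_entropy_var(4)[OF that] by (simp add: with_rho_def pos_states_def)
qed

text \<open>The derivative of \<open>log_rho_of\<close> in direction \<open>h\<close>; it involves \<open>V\<close> only through \<open>W = drop_first V\<close>, whose components
  are rational in the state although \<open>V\<^sub>1\<close> is not.\<close>
definition log_rho_slope :: "real^9 \<Rightarrow> real^9 \<Rightarrow> real" where
  "log_rho_slope W h = (h $ 1 + grad kin_of W \<bullet> drop_first h) / 2
     - (grad bperp_of W \<bullet> drop_first h) / bperp_of W - (grad bpar_of W \<bullet> drop_first h) / bpar_of W / 2"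

lemma linear_drop_first: "bounded_linear drop_first"
  by (rule linear_conv_bounded_linear[THEN iffD1], rule linearI) (auto simp: drop_first_def vec_eq_iff)

lemma state_of_has_derivative:
  assumes V: "V \<in> entropy_domain"
  shows "((\<lambda>V. state_of V $ i) has_derivative (\<lambda>h. grad (\<lambda>Y. cons_of Y $ i) (with_rho V)
     \<bullet> (drop_first h + (exp (log_rho_of V) * log_rho_slope (drop_first V) h) *\<^sub>R axis 1 1))) (at V)"
proof -
  have W: "drop_first V \<in> entropy_domain" using V by (simp add: of_drop)
  have pos: "bperp_of (drop_first V) > 0" "bpar_of (drop_first V) > 0" using W by (auto simp: entropy_domain_def)
  note dd = bounded_linear_imp_has_derivative[OF linear_drop_first, of "at V"]
  have of: "((\<lambda>V. f (drop_first V)) has_derivative (\<lambda>h. grad f (drop_first V) \<bullet> drop_first h)) (at V)"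
    if "rational_on entropy_domain f" for f
    by (rule has_derivative_compose[OF dd rational_on_has_derivative[OF that open_entropy_domain W]])
  have b: "((\<lambda>V. ln (bperp_of (drop_first V))) has_derivative
      (\<lambda>h. (grad bperp_of (drop_first V) \<bullet> drop_first h) / bperp_of (drop_first V))) (at V)"
    by (rule has_derivative_eq_rhs[OF has_derivative_ln[OF pos(1) of[OF rational_of(1)]]])
      (simp add: fun_eq_iff divide_inverse)
  have c: "((\<lambda>V. ln (bpar_of (drop_first V))) has_derivative
      (\<lambda>h. (grad bpar_of (drop_first V) \<bullet> drop_first h) / bpar_of (drop_first V))) (at V)"
    by (rule has_derivative_eq_rhs[OF has_derivative_ln[OF pos(2) of[OF rational_of(2)]]])
      (simp add: fun_eq_iff divide_inverse)
  have n: "((\<lambda>V. V $ 1) has_derivative (\<lambda>h. h $ 1)) (at V)"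
    by (rule bounded_linear_imp_has_derivative[OF bounded_linear_vec_nth])
  have half: "((\<lambda>V. f V / 2) has_derivative (\<lambda>h. f' h / 2)) (at V)"
    if "(f has_derivative f') (at V)" for f f' :: "real^9 \<Rightarrow> real"
    using has_derivative_mult_left[OF that, of "1 / 2"] by simp
  have "(log_rho_of has_derivative (\<lambda>h. (h $ 1 + grad kin_of (drop_first V) \<bullet> drop_first h - 0) / 2
      - (grad bperp_of (drop_first V) \<bullet> drop_first h) / bperp_of (drop_first V)
      - (grad bpar_of (drop_first V) \<bullet> drop_first h) / bpar_of (drop_first V) / 2)) (at V)"
    unfolding log_rho_of_def[abs_def]
    by (intro has_derivative_diff has_derivative_add half has_derivative_const n b c of[OF rational_of(3)])
  then have "(log_rho_of has_derivative log_rho_slope (drop_first V)) (at V)"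
    by (rule has_derivative_eq_rhs) (simp add: fun_eq_iff log_rho_slope_def)
  from has_derivative_exp[OF this]
  have "((\<lambda>V. exp (log_rho_of V)) has_derivative (\<lambda>h. exp (log_rho_of V) * log_rho_slope (drop_first V) h)) (at V)"
    by (rule has_derivative_eq_rhs) (simp add: fun_eq_iff)
  from has_derivative_add[OF dd has_derivative_scaleR[OF this has_derivative_const[of "axis 1 1"]]]
  have "(with_rho has_derivative (\<lambda>h. drop_first h + (exp (log_rho_of V) * log_rho_slope (drop_first V) h) *\<^sub>R axis 1 1)) (at V)"
    unfolding with_rho_def[abs_def] by (rule has_derivative_eq_rhs) (simp add: fun_eq_iff)
  from has_derivative_compose[OF this rational_on_has_derivative[OF rational_cons_of open_entropy_domain]]
  show ?thesis unfolding state_of_def using V by (simp add: of_drop)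
qed

text \<open>By the chain rule for \<open>cons_of\<close> after \<open>with_rho\<close>. At \<open>V = V(U)\<close> the exponential of \<open>log_rho_of\<close> is \<open>\<rho>\<close>, so no
  transcendental function is left.\<close>
lemma rational_dU_dV: "rational_on pos_states (\<lambda>U. dU_dV U $ i $ j)"
proof (rule rational_on.cong)
  let ?W = "\<lambda>U. drop_first (entropy_var U)" and ?Y = "\<lambda>U. with_rho (entropy_var U)"
  have W: "?W U \<in> entropy_domain" "?Y U \<in> entropy_domain" if "U \<in> pos_states" for U
    using of_entropy_var(5)[OF that] by (simp_all add: of_drop)
  note cW = rational_on_compose[OF _ rational_drop_entropy_var W(1)]
  note cY = rational_on_compose[OF _ rational_with_rho_entropy_var W(2)]
  have slope: "rational_on pos_states (\<lambda>U. log_rho_slope (?W U) h)" for h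
    unfolding log_rho_slope_def inner_vec_def inner_real_def
    by (intro rational_intros cW rational_grad rational_of open_entropy_domain)
       (use W(1) in \<open>auto simp: entropy_domain_def\<close>)
  show "rational_on pos_states (\<lambda>U. \<Sum>k\<in>UNIV. grad (\<lambda>Y. cons_of Y $ i) (?Y U) $ k
      * (drop_first (axis j 1) $ k + rho U * log_rho_slope (?W U) (axis j 1) * axis 1 1 $ k))"
    by (intro rational_intros cY rational_grad rational_cons_of open_entropy_domain rational_state_functions slope)
  fix U assume U: "U \<in> pos_states"
  define V where "V = entropy_var U"
  have V: "V \<in> entropy_domain" using of_entropy_var(5)[OF U] by (simp add: V_def)
  have rho: "exp (log_rho_of V) = rho U" using U of_entropy_var(4)[OF U] by (simp add: V_def pos_states_def)
  have "(state_of has_derivative (\<lambda>h. \<chi> i. grad (\<lambda>Y. cons_of Y $ i) (with_rho V)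
     \<bullet> (drop_first h + (exp (log_rho_of V) * log_rho_slope (drop_first V) h) *\<^sub>R axis 1 1))) (at V)"
    unfolding has_derivative_componentwise_within[where f = state_of]
    using state_of_has_derivative[OF V] by (auto simp: Basis_vec_def inner_axis)
  then have "(inv_into pos_states entropy_var has_derivative (\<lambda>h. \<chi> i. grad (\<lambda>Y. cons_of Y $ i) (with_rho V)
     \<bullet> (drop_first h + (exp (log_rho_of V) * log_rho_slope (drop_first V) h) *\<^sub>R axis 1 1))) (at V)"
    by (rule has_derivative_transform_within_open[OF _ open_entropy_domain V]) (simp add: inv_entropy_var)
  from frechet_derivative_at[OF this, symmetric]
  show "dU_dV U $ i $ j = (\<Sum>k\<in>UNIV. grad (\<lambda>Y. cons_of Y $ i) (?Y U) $ k
      * (drop_first (axis j 1) $ k + rho U * log_rho_slope (?W U) (axis j 1) * axis 1 1 $ k))"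
    unfolding rho by (simp add: dU_dV_def jacobian_def matrix_def V_def[symmetric] inner_vec_def)
qed

section \<open>Spectral radius and diffusion matrices\<close>

lemma matrix_inv_inverse:
  assumes "invertible (A :: real^'n^'n)"
  shows "A ** matrix_inv A = mat 1" "matrix_inv A ** A = mat 1"
proof -
  have "\<exists>B. A ** B = mat 1 \<and> B ** A = mat 1" using assms by (simp add: invertible_def)
  from someI_ex[OF this] show "A ** matrix_inv A = mat 1" "matrix_inv A ** A = mat 1"
    by (simp_all add: matrix_inv_def)
qed

lemma invertible_transposeI:
  assumes "invertible (A :: real^'n^'n)"
  shows "invertible (transpose A)"
proof -
  obtain B where "A ** B = mat 1" "B ** A = mat 1" using assms by (auto simp: invertible_def)
  then have "transpose B ** transpose A = mat 1" "transpose A ** transpose B = mat 1"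
    by (simp_all flip: matrix_transpose_mul add: transpose_mat)
  then show ?thesis unfolding invertible_def by blast
qed

lemma invertible_mult_eq_iff:
  assumes "invertible (R :: real^'n^'n)"
  shows "R *v x = R *v y \<longleftrightarrow> x = y"
proof
  assume "R *v x = R *v y"
  then have "matrix_inv R *v (R *v x) = matrix_inv R *v (R *v y)" by simp
  then show "x = y" by (simp add: matrix_vector_mul_assoc matrix_inv_inverse[OF assms])
qed simp

lemma mult_eigenvector_basis:
  fixes A R :: "real^'n^'n"
  assumes "\<And>m. A *v column m R = l m *s column m R"
  shows "A *v (R *v w) = R *v (\<chi> m. l m * w $ m)"
proof -
  have "A *v (R *v w) = A *v (\<Sum>m\<in>UNIV. w $ m *\<^sub>R column m R)"
    by (simp add: matrix_mult_sum scalar_mult_eq_scaleR)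
  also have "\<dots> = (\<Sum>m\<in>UNIV. w $ m *\<^sub>R (A *v column m R))"
    by (simp add: linear_sum[OF matrix_vector_mul_linear] linear_scale[OF matrix_vector_mul_linear])
  also have "\<dots> = (\<Sum>m\<in>UNIV. (l m * w $ m) *\<^sub>R column m R)"
    by (simp add: assms scalar_mult_eq_scaleR mult.commute)
  also have "\<dots> = R *v (\<chi> m. l m * w $ m)"
    by (simp add: matrix_mult_sum scalar_mult_eq_scaleR)
  finally show ?thesis .
qed

lemma eigenvalues_of_basis:
  fixes A R :: "real^'n^'n"
  assumes inv: "invertible R" and ev: "\<And>m. A *v column m R = l m *s column m R"
  shows "{c. \<exists>v. v \<noteq> 0 \<and> A *v v = c *s v} = range l"
proof (intro equalityI subsetI)
  fix c assume "c \<in> {c. \<exists>v. v \<noteq> 0 \<and> A *v v = c *s v}"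
  then obtain v where v: "v \<noteq> 0" "A *v v = c *s v" by blast
  define w where "w = matrix_inv R *v v"
  have vw: "v = R *v w" by (simp add: w_def matrix_vector_mul_assoc matrix_inv_inverse[OF inv])
  have "R *v (\<chi> m. l m * w $ m) = R *v (c *\<^sub>R w)"
    using v(2) mult_eigenvector_basis[OF ev, of w] unfolding vw
    by (simp add: scalar_mult_eq_scaleR linear_scale[OF matrix_vector_mul_linear])
  then have *: "l m * w $ m = c * w $ m" for m
    unfolding invertible_mult_eq_iff[OF inv] by (simp add: vec_eq_iff)
  have "w \<noteq> 0" using v(1) vw by auto
  then obtain m where "w $ m \<noteq> 0" by (auto simp: vec_eq_iff)
  with *[of m] show "c \<in> range l" by auto
next
  fix c assume "c \<in> range l"
  then obtain m where m: "c = l m" by blast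
  have "R *v axis m 1 \<noteq> R *v 0" unfolding invertible_mult_eq_iff[OF inv] by (simp add: axis_eq_0_iff)
  then have "column m R \<noteq> 0" by (simp add: matrix_vector_mult_basis)
  then show "c \<in> {c. \<exists>v. v \<noteq> 0 \<and> A *v v = c *s v}" using ev[of m] m by blast
qed

lemma max_abs_eigenvalue_basis:
  fixes A R :: "real^9^9"
  assumes "invertible R" "\<And>m. A *v column m R = l m *s column m R"
  shows "max_abs_eigenvalue A = Max (range (\<lambda>m. \<bar>l m\<bar>))"
proof -
  have "{\<bar>c\<bar> | c. \<exists>v. v \<noteq> 0 \<and> A *v v = c *s v} = abs ` {c. \<exists>v. v \<noteq> 0 \<and> A *v v = c *s v}" by auto
  then show ?thesis unfolding max_abs_eigenvalue_def eigenvalues_of_basis[OF assms] by (simp add: image_image)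
qed

lemma inner_mult_transpose: "x \<bullet> (R *v y) = (transpose R *v x) \<bullet> (y :: real^'n)"
  by (simp add: dot_lmul_matrix)

text \<open>In the coordinates \<open>y = R\<^sup>T x\<close> the form of \<open>R R\<^sup>T\<close> is \<open>\<Sum> y\<^sub>m\<^sup>2\<close> and that of \<open>A R R\<^sup>T\<close> is \<open>\<Sum> l\<^sub>m y\<^sub>m\<^sup>2\<close> with the
  eigenvalues \<open>l\<^sub>m\<close>. Thus the spectral radius of the nonsymmetric matrix \<open>A\<close> is a maximum of quotients of quadratic
  forms whose coefficients depend smoothly on the state.\<close>
lemma rayleigh_quotient:
  fixes A R :: "real^9^9"
  assumes inv: "invertible R" and ev: "\<And>m. \<exists>c. A *v column m R = c *s column m R"
  shows "0 \<le> max_abs_eigenvalue A"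
    and "x \<bullet> ((R ** transpose R) *v x) = (norm (transpose R *v x))\<^sup>2"
    and "\<bar>x \<bullet> ((A ** (R ** transpose R)) *v x)\<bar> \<le> max_abs_eigenvalue A * (x \<bullet> ((R ** transpose R) *v x))"
    and "\<exists>y. y \<bullet> ((R ** transpose R) *v y) = 1 \<and>
      \<bar>y \<bullet> ((A ** (R ** transpose R)) *v y)\<bar> = max_abs_eigenvalue A"
proof -
  obtain l where l: "\<And>m. A *v column m R = l m *s column m R" using ev by metis
  have mx: "max_abs_eigenvalue A = Max (range (\<lambda>m. \<bar>l m\<bar>))" by (rule max_abs_eigenvalue_basis[OF inv l])
  have le: "\<bar>l m\<bar> \<le> max_abs_eigenvalue A" for m unfolding mx by (rule Max_ge) auto
  show "0 \<le> max_abs_eigenvalue A" using le[of undefined] by linarith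
  have H: "x \<bullet> ((R ** transpose R) *v x) = (norm (transpose R *v x))\<^sup>2" for x
    by (simp add: matrix_vector_mul_assoc[symmetric] inner_mult_transpose power2_norm_eq_inner)
  show "x \<bullet> ((R ** transpose R) *v x) = (norm (transpose R *v x))\<^sup>2" by (rule H)
  have S: "x \<bullet> ((A ** (R ** transpose R)) *v x) = (\<Sum>m\<in>UNIV. l m * ((transpose R *v x) $ m)\<^sup>2)" for x
    by (simp add: matrix_vector_mul_assoc[symmetric] mult_eigenvector_basis[OF l] inner_mult_transpose)
       (simp add: inner_vec_def power2_eq_square algebra_simps)
  have N: "(norm y)\<^sup>2 = (\<Sum>m\<in>UNIV. (y $ m)\<^sup>2)" for y :: "real^9"
    unfolding power2_norm_eq_inner inner_vec_def by (simp add: power2_eq_square)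
  show "\<bar>x \<bullet> ((A ** (R ** transpose R)) *v x)\<bar> \<le> max_abs_eigenvalue A * (x \<bullet> ((R ** transpose R) *v x))"
  proof -
    have "\<bar>\<Sum>m\<in>UNIV. l m * ((transpose R *v x) $ m)\<^sup>2\<bar> \<le> (\<Sum>m\<in>UNIV. \<bar>l m * ((transpose R *v x) $ m)\<^sup>2\<bar>)"
      by (rule sum_abs)
    also have "\<dots> \<le> (\<Sum>m\<in>UNIV. max_abs_eigenvalue A * ((transpose R *v x) $ m)\<^sup>2)"
      by (rule sum_mono) (simp add: abs_mult mult_right_mono le)
    finally show ?thesis unfolding S H N by (simp add: sum_distrib_left)
  qed
  have "Max (range (\<lambda>m. \<bar>l m\<bar>)) \<in> range (\<lambda>m. \<bar>l m\<bar>)" by (rule Max_in) auto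
  then obtain k where k: "max_abs_eigenvalue A = \<bar>l k\<bar>" unfolding mx by blast
  have invT: "invertible (transpose R)" using inv by (simp add: invertible_transposeI)
  define y where "y = matrix_inv (transpose R) *v axis k 1"
  have y: "transpose R *v y = axis k 1"
    by (simp add: y_def matrix_vector_mul_assoc matrix_inv_inverse[OF invT])
  have "(\<Sum>m\<in>UNIV. l m * ((axis k 1 :: real^9) $ m)\<^sup>2) = (\<Sum>m\<in>UNIV. if m = k then l m else 0)"
    by (rule sum.cong) (auto simp: axis_def)
  then show "\<exists>y. y \<bullet> ((R ** transpose R) *v y) = 1 \<and>
      \<bar>y \<bullet> ((A ** (R ** transpose R)) *v y)\<bar> = max_abs_eigenvalue A"
    by (intro exI[of _ y]) (simp only: H S y k norm_axis_1 power_one if_distrib sum.delta, simp)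
qed

definition entry_norm :: "real^9^9 \<Rightarrow> real" where
  "entry_norm B = (\<Sum>i\<in>UNIV. \<Sum>j\<in>UNIV. \<bar>B $ i $ j\<bar>)"

lemma norm_mult_le_entry_norm: "norm (B *v x) \<le> entry_norm B * norm x"
proof -
  have "norm (B *v x) \<le> (\<Sum>i\<in>UNIV. \<bar>(B *v x) $ i\<bar>)" by (rule norm_le_l1_cart)
  also have "\<dots> \<le> (\<Sum>i\<in>UNIV. \<Sum>j\<in>UNIV. \<bar>B $ i $ j\<bar> * norm x)"
  proof (rule sum_mono)
    fix i
    have "\<bar>(B *v x) $ i\<bar> \<le> (\<Sum>j\<in>UNIV. \<bar>B $ i $ j * x $ j\<bar>)"
      unfolding matrix_vector_mult_def by (simp add: sum_abs)
    also have "\<dots> \<le> (\<Sum>j\<in>UNIV. \<bar>B $ i $ j\<bar> * norm x)"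
      by (rule sum_mono) (simp add: abs_mult mult_left_mono component_le_norm_cart)
    finally show "\<bar>(B *v x) $ i\<bar> \<le> (\<Sum>j\<in>UNIV. \<bar>B $ i $ j\<bar> * norm x)" .
  qed
  also have "\<dots> = entry_norm B * norm x" by (simp add: entry_norm_def sum_distrib_right)
  finally show ?thesis .
qed

lemma abs_quadratic_form_le: "\<bar>x \<bullet> (B *v x)\<bar> \<le> entry_norm B * (norm x)\<^sup>2"
proof -
  have "\<bar>x \<bullet> (B *v x)\<bar> \<le> norm x * norm (B *v x)" by (rule Cauchy_Schwarz_ineq2)
  also have "\<dots> \<le> norm x * (entry_norm B * norm x)"
    by (rule mult_left_mono[OF norm_mult_le_entry_norm]) simp
  finally show ?thesis by (simp add: power2_eq_square algebra_simps)
qed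

lemma rational_matrix_lipschitz:
  assumes B: "\<And>i j. rational_on S (\<lambda>U. B U $ i $ j)" and M: "compact M" "M \<subseteq> S"
  obtains L where "0 \<le> L" "\<And>U W. U \<in> M \<Longrightarrow> W \<in> M \<Longrightarrow> entry_norm (B U - B W) \<le> L * dist U W"
    "\<And>U. U \<in> M \<Longrightarrow> entry_norm (B U) \<le> L"
proof -
  have "\<forall>i j. \<exists>l. \<forall>U\<in>M. \<forall>W\<in>M. \<bar>B U $ i $ j - B W $ i $ j\<bar> \<le> l * dist U W"
    using rational_on_lipschitz[OF B M] by blast
  then obtain l where l: "\<And>i j U W. U \<in> M \<Longrightarrow> W \<in> M \<Longrightarrow> \<bar>B U $ i $ j - B W $ i $ j\<bar> \<le> l i j * dist U W"
    by metis
  have "\<forall>i j. \<exists>k. \<forall>U\<in>M. \<bar>B U $ i $ j\<bar> \<le> k" using rational_on_bounded[OF B M] by metis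
  then obtain k where k: "\<And>i j U. U \<in> M \<Longrightarrow> \<bar>B U $ i $ j\<bar> \<le> k i j" by metis
  define L K where "L = (\<Sum>i\<in>UNIV. \<Sum>j\<in>UNIV. l i j)" and "K = (\<Sum>i\<in>UNIV. \<Sum>j\<in>UNIV. k i j)"
  have 1: "entry_norm (B U - B W) \<le> L * dist U W" if "U \<in> M" "W \<in> M" for U W
    unfolding entry_norm_def L_def sum_distrib_right
    by (intro sum_mono) (simp add: l that)
  have 2: "entry_norm (B U) \<le> K" if "U \<in> M" for U
    unfolding entry_norm_def K_def by (intro sum_mono k that)
  show thesis
  proof (rule that[of "\<bar>L\<bar> + \<bar>K\<bar>"])
    show "entry_norm (B U - B W) \<le> (\<bar>L\<bar> + \<bar>K\<bar>) * dist U W" if "U \<in> M" "W \<in> M" for U W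
      by (rule order_trans[OF 1[OF that]]) (simp add: mult_right_mono)
    show "entry_norm (B U) \<le> \<bar>L\<bar> + \<bar>K\<bar>" if "U \<in> M" for U using 2[OF that] by linarith
  qed simp
qed

text \<open>Compactness of \<open>M\<close> times the unit sphere.\<close>
lemma uniformly_coercive:
  fixes H :: "'a::metric_space \<Rightarrow> real^9^9"
  assumes "compact M" and cont: "\<And>i j. continuous_on M (\<lambda>U. H U $ i $ j)"
    and pos: "\<And>U x. U \<in> M \<Longrightarrow> x \<noteq> 0 \<Longrightarrow> 0 < x \<bullet> (H U *v x)"
  obtains C where "0 \<le> C" "\<And>U x. U \<in> M \<Longrightarrow> (norm x)\<^sup>2 \<le> C * (x \<bullet> (H U *v x))"
proof (cases "M = {}")
  case True then show thesis using that[of 0] by simp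
next
  case False
  let ?q = "\<lambda>p. snd p \<bullet> (H (fst p) *v snd p)"
  have cmp: "compact (M \<times> sphere (0::real^9) 1)" by (intro compact_Times assms compact_sphere)
  have "axis 1 1 \<in> sphere (0::real^9) 1" by (simp add: norm_axis_1)
  with False have ne: "M \<times> sphere (0::real^9) 1 \<noteq> {}" by blast
  have cH: "continuous_on (M \<times> sphere (0::real^9) 1) (\<lambda>p. H (fst p) $ i $ j)" for i j
    by (rule continuous_on_compose2[OF cont continuous_on_fst]) (auto intro: continuous_on_id)
  have "continuous_on (M \<times> sphere (0::real^9) 1) ?q"
    unfolding inner_vec_def matrix_vector_mult_def by (simp, intro continuous_intros cH)
  from continuous_attains_inf[OF cmp ne this] obtain p where
    p: "p \<in> M \<times> sphere (0::real^9) 1" "\<And>p'. p' \<in> M \<times> sphere (0::real^9) 1 \<Longrightarrow> ?q p \<le> ?q p'" by blast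
  have q0: "0 < ?q p" using p(1) by (intro pos) auto
  show thesis
  proof (rule that[of "1 / ?q p"])
    show "0 \<le> 1 / ?q p" using q0 by simp
    fix U x assume U: "U \<in> M"
    show "(norm x)\<^sup>2 \<le> 1 / ?q p * (x \<bullet> (H U *v x))"
    proof (cases "x = 0")
      case False
      have "?q p \<le> ?q (U, x /\<^sub>R norm x)" by (rule p(2)) (use U False in simp)
      also have "\<dots> = (x \<bullet> (H U *v x)) / (norm x)\<^sup>2"
        by (simp add: linear_scale[OF matrix_vector_mul_linear] divide_inverse power2_eq_square)
      finally show ?thesis using q0 False by (simp add: field_simps)
    qed simp
  qed
qed

text \<open>If \<open>y\<close> attains the Rayleigh quotient at \<open>U\<close>, inserting \<open>y\<close> in the quotient at \<open>W\<close> costs at most a multiple of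
  \<open>dist U W\<close>, because \<open>|y|\<^sup>2\<close> is controlled by coercivity. Exchanging \<open>U\<close> and \<open>W\<close> gives the Lipschitz bound for the
  spectral radius, although single eigenvectors may jump.\<close>
lemma scaled_diffusion_lipschitz:
  fixes A H :: "state \<Rightarrow> real^9^9"
  assumes A: "\<And>i j. rational_on S (\<lambda>U. A U $ i $ j)" and H: "\<And>i j. rational_on S (\<lambda>U. H U $ i $ j)"
    and M: "compact M" "M \<subseteq> S"
    and R: "\<And>U. U \<in> M \<Longrightarrow> \<exists>R :: real^9^9. invertible R \<and> (\<forall>m. \<exists>c. A U *v column m R = c *s column m R)
      \<and> H U = R ** transpose R"
  obtains L where "0 \<le> L"
    "\<And>U x. U \<in> M \<Longrightarrow> norm ((max_abs_eigenvalue (A U) *\<^sub>R H U) *v x) \<le> L * norm x"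
    "\<And>U W x. U \<in> M \<Longrightarrow> W \<in> M \<Longrightarrow> norm ((max_abs_eigenvalue (A U) *\<^sub>R H U) *v x
        - (max_abs_eigenvalue (A W) *\<^sub>R H W) *v x) \<le> L * dist U W * norm x"
proof -
  define lam where "lam U = max_abs_eigenvalue (A U)" for U
  define Q where "Q U = A U ** H U" for U
  have "rational_on S (\<lambda>U. Q U $ i $ j)" for i j
    unfolding Q_def matrix_matrix_mult_def by (simp, intro rational_intros A H)
  from rational_matrix_lipschitz[OF this M] obtain LQ where
    LQ: "0 \<le> LQ" "\<And>U W. U \<in> M \<Longrightarrow> W \<in> M \<Longrightarrow> entry_norm (Q U - Q W) \<le> LQ * dist U W"
      "\<And>U. U \<in> M \<Longrightarrow> entry_norm (Q U) \<le> LQ" by blast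
  from rational_matrix_lipschitz[OF H M] obtain LH where
    LH: "0 \<le> LH" "\<And>U W. U \<in> M \<Longrightarrow> W \<in> M \<Longrightarrow> entry_norm (H U - H W) \<le> LH * dist U W"
      "\<And>U. U \<in> M \<Longrightarrow> entry_norm (H U) \<le> LH" by blast
  have posH: "0 < x \<bullet> (H U *v x)" if U: "U \<in> M" and x: "x \<noteq> 0" for U x
  proof -
    obtain R :: "real^9^9" where r: "invertible R" "\<forall>m. \<exists>c. A U *v column m R = c *s column m R" "H U = R ** transpose R"
      using R[OF U] by blast
    have "invertible (transpose R)" using r(1) by (simp add: invertible_transposeI)
    from invertible_mult_eq_iff[OF this, of x 0] x have "transpose R *v x \<noteq> 0" by simp
    then show ?thesis using rayleigh_quotient(2)[OF r(1), of "A U" x] r by simp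
  qed
  have contH: "continuous_on M (\<lambda>U. H U $ i $ j)" for i j
    by (rule continuous_on_subset[OF rational_on_continuous[OF H] M(2)])
  obtain C where C: "0 \<le> C" "\<And>U x. U \<in> M \<Longrightarrow> (norm x)\<^sup>2 \<le> C * (x \<bullet> (H U *v x))"
    using uniformly_coercive[OF M(1) contH posH] by blast
  have attained: "\<exists>y. y \<bullet> (H U *v y) = 1 \<and> \<bar>y \<bullet> (Q U *v y)\<bar> = lam U \<and> (norm y)\<^sup>2 \<le> C"
    and ray: "\<bar>x \<bullet> (Q U *v x)\<bar> \<le> lam U * (x \<bullet> (H U *v x))" and lam0: "0 \<le> lam U"
    if U: "U \<in> M" for U x
  proof -
    obtain R :: "real^9^9" where r: "invertible R" "\<And>m. \<exists>c. A U *v column m R = c *s column m R" "H U = R ** transpose R"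
      using R[OF U] by blast
    note rq = rayleigh_quotient[OF r(1,2), folded r(3)]
    show "\<bar>x \<bullet> (Q U *v x)\<bar> \<le> lam U * (x \<bullet> (H U *v x))" "0 \<le> lam U"
      unfolding lam_def Q_def by (rule rq)+
    show "\<exists>y. y \<bullet> (H U *v y) = 1 \<and> \<bar>y \<bullet> (Q U *v y)\<bar> = lam U \<and> (norm y)\<^sup>2 \<le> C"
    proof -
      obtain y where y: "y \<bullet> (H U *v y) = 1" "\<bar>y \<bullet> (Q U *v y)\<bar> = lam U"
        using rq(4) unfolding lam_def Q_def by blast
      then show ?thesis using C(2)[OF U, of y] by auto
    qed
  qed
  have lamB: "lam U \<le> LQ * C" if U: "U \<in> M" for U
  proof -
    obtain y where y: "\<bar>y \<bullet> (Q U *v y)\<bar> = lam U" "(norm y)\<^sup>2 \<le> C" using attained[OF U] by blast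
    have "lam U \<le> entry_norm (Q U) * (norm y)\<^sup>2" unfolding y(1)[symmetric] by (rule abs_quadratic_form_le)
    also have "\<dots> \<le> LQ * C" by (intro mult_mono LQ U y C) (simp_all add: LQ)
    finally show ?thesis .
  qed
  \<comment> \<open>The Lipschitz constant of the spectral radius, from changing the denominator and the numerator.\<close>
  define N where "N = LQ * C * (LH * C) + LQ * C"
  have N0: "0 \<le> N" unfolding N_def by (intro add_nonneg_nonneg mult_nonneg_nonneg LQ LH C)
  have lamL: "lam U - lam W \<le> N * dist U W" if U: "U \<in> M" and W: "W \<in> M" for U W
  proof -
    obtain y where y: "y \<bullet> (H U *v y) = 1" "\<bar>y \<bullet> (Q U *v y)\<bar> = lam U" "(norm y)\<^sup>2 \<le> C"
      using attained[OF U] by blast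
    have q: "\<bar>y \<bullet> (Q U *v y) - y \<bullet> (Q W *v y)\<bar> \<le> LQ * dist U W * C"
    proof -
      have "\<bar>y \<bullet> ((Q U - Q W) *v y)\<bar> \<le> entry_norm (Q U - Q W) * (norm y)\<^sup>2" by (rule abs_quadratic_form_le)
      also have "\<dots> \<le> LQ * dist U W * C" by (intro mult_mono LQ U W y) (simp_all add: LQ)
      finally show ?thesis by (simp add: matrix_vector_mult_diff_rdistrib inner_diff_right)
    qed
    have h: "\<bar>y \<bullet> (H W *v y) - y \<bullet> (H U *v y)\<bar> \<le> LH * dist U W * C"
    proof -
      have "\<bar>y \<bullet> ((H W - H U) *v y)\<bar> \<le> entry_norm (H W - H U) * (norm y)\<^sup>2" by (rule abs_quadratic_form_le)
      also have "\<dots> \<le> LH * dist W U * C" by (intro mult_mono LH U W y) (simp_all add: LH)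
      finally show ?thesis by (simp add: matrix_vector_mult_diff_rdistrib inner_diff_right dist_commute)
    qed
    have "lam U \<le> \<bar>y \<bullet> (Q W *v y)\<bar> + LQ * dist U W * C" using q y(2) by linarith
    also have "\<bar>y \<bullet> (Q W *v y)\<bar> \<le> lam W * (y \<bullet> (H W *v y))" by (rule ray[OF W])
    also have "\<dots> \<le> lam W * (1 + LH * dist U W * C)"
      using h y(1) by (intro mult_left_mono lam0 W) linarith
    also have "\<dots> = lam W + lam W * (LH * dist U W * C)" by (simp add: algebra_simps)
    also have "lam W * (LH * dist U W * C) \<le> LQ * C * (LH * dist U W * C)"
      by (intro mult_right_mono lamB W) (simp add: LH C)
    finally show ?thesis unfolding N_def by (simp add: algebra_simps)
  qed
  define L where "L = LQ * C * LH + N * LH"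
  show thesis
  proof (rule that[of L])
    show "0 \<le> L" unfolding L_def by (intro add_nonneg_nonneg mult_nonneg_nonneg LQ LH C N0)
    fix U x assume U: "U \<in> M"
    have "norm ((lam U *\<^sub>R H U) *v x) = lam U * norm (H U *v x)"
      using lam0[OF U] by (simp add: scaleR_matrix_vector_assoc[symmetric])
    also have "\<dots> \<le> (LQ * C) * (LH * norm x)"
    proof (intro mult_mono lamB U)
      show "norm (H U *v x) \<le> LH * norm x"
        by (rule order_trans[OF norm_mult_le_entry_norm mult_right_mono[OF LH(3)[OF U]]]) simp
    qed (simp_all add: LQ C)
    also have "\<dots> \<le> L * norm x" unfolding L_def by (simp add: distrib_right N0 LH mult.assoc)
    finally show "norm ((max_abs_eigenvalue (A U) *\<^sub>R H U) *v x) \<le> L * norm x" by (simp add: lam_def)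
  next
    fix U W x assume U: "U \<in> M" and W: "W \<in> M"
    have "(lam U *\<^sub>R H U) *v x - (lam W *\<^sub>R H W) *v x = lam U *\<^sub>R ((H U - H W) *v x) + (lam U - lam W) *\<^sub>R (H W *v x)"
      by (simp add: scaleR_matrix_vector_assoc[symmetric] matrix_vector_mult_diff_rdistrib algebra_simps)
    also have "norm \<dots> \<le> lam U * norm ((H U - H W) *v x) + \<bar>lam U - lam W\<bar> * norm (H W *v x)"
      using lam0[OF U] by (intro order_trans[OF norm_triangle_ineq]) simp
    also have "\<dots> \<le> (LQ * C) * (LH * dist U W * norm x) + (N * dist U W) * (LH * norm x)"
    proof (intro add_mono mult_mono lamB U)
      show "norm ((H U - H W) *v x) \<le> LH * dist U W * norm x"
        by (rule order_trans[OF norm_mult_le_entry_norm mult_right_mono[OF LH(2)[OF U W]]]) simp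
      show "norm (H W *v x) \<le> LH * norm x"
        by (rule order_trans[OF norm_mult_le_entry_norm mult_right_mono[OF LH(3)[OF W]]]) simp
      show "\<bar>lam U - lam W\<bar> \<le> N * dist U W"
        using lamL[OF U W] lamL[OF W U] by (simp add: dist_commute abs_le_iff)
    qed (simp_all add: LQ C N0)
    also have "\<dots> = L * dist U W * norm x" unfolding L_def by (simp add: algebra_simps)
    finally show "norm ((max_abs_eigenvalue (A U) *\<^sub>R H U) *v x
        - (max_abs_eigenvalue (A W) *\<^sub>R H W) *v x) \<le> L * dist U W * norm x" by (simp add: lam_def)
  qed
qed

lemma diffusion_matrix_eq:
  assumes "entropy_scaled_eigenvectors d U R"
  shows "R ** Lambda d U ** transpose R = max_abs_eigenvalue (Amat d U) *\<^sub>R dU_dV U"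
  using assms
  by (simp add: entropy_scaled_eigenvectors_def Lambda_def matrix_scalar_ac scalar_matrix_assoc matrix_scaleR matrix_mul_assoc)

lemma transpose_mult_V_jump:
  assumes "invertible (R d (avg (a i) (a (i + 1))))"
  shows "transpose (iface_mats avg R d a i) *v V_jump avg R rec d a i
    = rec Minus (iface_mats avg R d a) (\<lambda>m. entropy_var (a m)) (i + 1)
      - rec Plus (iface_mats avg R d a) (\<lambda>m. entropy_var (a m)) i"
proof -
  have "invertible (transpose (iface_mats avg R d a i))"
    using assms by (simp add: iface_mats_def invertible_transposeI)
  from matrix_inv_inverse(1)[OF this] show ?thesis
    by (simp add: V_jump_def V_hat_def matrix_vector_mult_diff_distrib matrix_vector_mul_assoc)
qed

text \<open>Multiplying by \<open>R\<^sup>T\<close> turns the jump of \<open>V\<close> into that of the scaled variables \<open>W\<close> and the reconstructed jump into that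
  of the reconstruction; componentwise these have equal signs.\<close>
lemma diffusion_dissipative:
  assumes ev: "entropy_scaled_eigenvectors d (avg (a i) (a (i + 1))) (R d (avg (a i) (a (i + 1))))"
    and sp: "sign_preserving rec"
  shows "0 \<le> (entropy_var (a (i + 1)) - entropy_var (a i)) \<bullet> (diff_mat avg R d a i *v V_jump avg R rec d a i)"
proof -
  define Rs where "Rs = iface_mats avg R d a"
  define v where "v = (\<lambda>m. entropy_var (a m))"
  define lam where "lam = max_abs_eigenvalue (Amat d (avg (a i) (a (i + 1))))"
  have inv: "invertible (R d (avg (a i) (a (i + 1))))" using ev by (simp add: entropy_scaled_eigenvectors_def)
  have lam0: "0 \<le> lam"
    unfolding lam_def by (rule rayleigh_quotient(1)[OF inv]) (use ev in \<open>simp add: entropy_scaled_eigenvectors_def\<close>)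
  have D: "diff_mat avg R d a i = lam *\<^sub>R (Rs i ** transpose (Rs i))"
    using diffusion_matrix_eq[OF ev] ev
    by (simp add: diff_mat_def Let_def Rs_def iface_mats_def lam_def entropy_scaled_eigenvectors_def)
  have "(v (i + 1) - v i) \<bullet> (diff_mat avg R d a i *v V_jump avg R rec d a i)
      = lam * ((transpose (Rs i) *v (v (i + 1) - v i)) \<bullet> (transpose (Rs i) *v V_jump avg R rec d a i))"
    by (simp add: D scaleR_matrix_vector_assoc[symmetric] matrix_vector_mul_assoc[symmetric] inner_mult_transpose)
  also have "transpose (Rs i) *v (v (i + 1) - v i) = scaled_var Minus Rs v (i + 1) - scaled_var Plus Rs v i"
    by (simp add: scaled_var_def matrix_vector_mult_diff_distrib)
  also have "transpose (Rs i) *v V_jump avg R rec d a i = rec Minus Rs v (i + 1) - rec Plus Rs v i"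
    unfolding Rs_def v_def by (rule transpose_mult_V_jump[of R d avg a i rec, OF inv])
  also have "lam * ((scaled_var Minus Rs v (i + 1) - scaled_var Plus Rs v i) \<bullet> (rec Minus Rs v (i + 1) - rec Plus Rs v i)) \<ge> 0"
  proof (intro mult_nonneg_nonneg lam0)
    have "0 \<le> x * y" if "sgn y = sgn x" for x y :: real
      using that by (auto simp: sgn_real_def zero_le_mult_iff split: if_splits)
    then show "0 \<le> (scaled_var Minus Rs v (i + 1) - scaled_var Plus Rs v i) \<bullet> (rec Minus Rs v (i + 1) - rec Plus Rs v i)"
      unfolding inner_vec_def inner_real_def
      by (intro sum_nonneg) (use sp in \<open>simp add: sign_preserving_def\<close>)
  qed
  finally show ?thesis by (simp add: v_def)
qed

section \<open>Entropy stability\<close>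

text \<open>For a symmetric two-point function the terms pairing the neighbours \<open>i - 1\<close> and \<open>i + 1\<close> cancel, so only pairs
  containing the node \<open>i\<close> remain.\<close>
lemma high_order_difference:
  assumes "\<And>Ul Ur. g Ul Ur = g Ur Ul"
  shows "high_order p g a i - high_order p g a (i - 1)
   = (if p = 1 then g (a i) (a (i + 1)) - g (a i) (a (i - 1))
      else (4 / 3) *\<^sub>R (g (a i) (a (i + 1)) - g (a i) (a (i - 1)))
        - (1 / 6) *\<^sub>R (g (a i) (a (i + 2)) - g (a i) (a (i - 2))))"
  by (simp add: high_order_def assms[of "a (i - 1)" "a i"] assms[of "a (i - 2)" "a i"]
      scaleR_diff_right scaleR_add_right algebra_simps)

lemma conservative_entropy_balance:
  assumes a: "\<And>m. a m \<in> pos_states" and h: "0 < h"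
  shows "entropy_var (a i) \<bullet> ((high_order p (ec_flux d) a i - high_order p (ec_flux d) a (i - 1)) /\<^sub>R h)
      + central_diff p h (\<lambda>m. mag (a m) $ dir_idx d) i * phi (a i)
    = (high_order p (ec_entropy_flux d) a i - high_order p (ec_entropy_flux d) a (i - 1)) / h"
proof -
  define V where "V = entropy_var (a i)"
  define B where "B m = mag (a m) $ dir_idx d" for m
  define F where "F m = V \<bullet> ec_flux d (a i) (a m)" for m
  define Q where "Q m = ec_entropy_flux d (a i) (a m)" for m
  have bal: "F m = Q m + calF d (a i) - phi (a i) * ((B i + B m) / 2)" for m
    using ec_entropy_balance[OF a[of i] a[of m], of d] by (simp add: F_def Q_def V_def B_def mean_real)
  show ?thesis
    unfolding high_order_difference[of "ec_flux d", OF ec_flux_commute]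
      high_order_difference[of "ec_entropy_flux d", OF ec_entropy_flux_commute]
      V_def[symmetric] B_def[symmetric] central_diff_def
    using h by (simp add: inner_diff_right F_def[symmetric] Q_def[symmetric] bal)
      (simp add: field_simps)
qed

text \<open>The flux at each of the two interfaces is tested with \<open>V\<close> at the node, while the numerical entropy flux uses the
  mean of \<open>V\<close>. The discrepancy is half of the jump, with opposite signs on the two sides, so both dissipation terms
  enter with the same sign.\<close>
lemma directional_entropy_inequality:
  assumes a: "\<And>m. a m \<in> Omega" and h: "0 < h"
    and R: "\<And>d Ul Ur. Ul \<in> Omega \<Longrightarrow> Ur \<in> Omega \<Longrightarrow>
           entropy_scaled_eigenvectors d (avg Ul Ur) (R d (avg Ul Ur))"
    and sp: "sign_preserving rec"
  shows "(num_entropy_flux p avg R rec d a i - num_entropy_flux p avg R rec d a (i - 1)) / h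
    \<le> entropy_var (a i) \<bullet> ((num_flux p avg R rec d a i - num_flux p avg R rec d a (i - 1)) /\<^sub>R h
        + central_diff p h (\<lambda>m. mag (a m) $ dir_idx d) i *\<^sub>R phi_grad (a i)
        + Cmat d (a i) *v central_diff p h a i)"
proof -
  define V where "V m = entropy_var (a m)" for m
  define DJ where "DJ m = diff_mat avg R d a m *v V_jump avg R rec d a m" for m
  have mag: "a m \<in> magnetized" and pos: "a m \<in> pos_states" for m
    using a[of m] magnetized_subset by auto
  have diss: "0 \<le> (V (m + 1) - V m) \<bullet> DJ m" for m
    unfolding V_def DJ_def by (rule diffusion_dissipative[where avg = avg and R = R and a = a and i = m and d = d and rec = rec,
          OF R[OF a a] sp])
  have ent: "mean entropy_var (a m) (a (m + 1)) \<bullet> DJ m = V m \<bullet> DJ m + (V (m + 1) - V m) \<bullet> DJ m / 2"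
    "mean entropy_var (a m) (a (m + 1)) \<bullet> DJ m = V (m + 1) \<bullet> DJ m - (V (m + 1) - V m) \<bullet> DJ m / 2" for m
    by (simp_all add: mean_def V_def inner_diff_left inner_add_left field_simps)
  have "num_entropy_flux p avg R rec d a i - num_entropy_flux p avg R rec d a (i - 1)
      = (high_order p (ec_entropy_flux d) a i - high_order p (ec_entropy_flux d) a (i - 1))
        - (1 / 2) * (V i \<bullet> (DJ i - DJ (i - 1)))
        - ((V (i + 1) - V i) \<bullet> DJ i + (V i - V (i - 1)) \<bullet> DJ (i - 1)) / 4"
    using ent(1)[of i] ent(2)[of "i - 1"]
    unfolding num_entropy_flux_def DJ_def[symmetric]
    by (simp add: inner_diff_right) (simp add: field_simps)
  also have "\<dots> \<le> (high_order p (ec_entropy_flux d) a i - high_order p (ec_entropy_flux d) a (i - 1))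
        - (1 / 2) * (V i \<bullet> (DJ i - DJ (i - 1)))"
    using diss[of i] diss[of "i - 1"] by simp
  finally have "(num_entropy_flux p avg R rec d a i - num_entropy_flux p avg R rec d a (i - 1)) / h
      \<le> ((high_order p (ec_entropy_flux d) a i - high_order p (ec_entropy_flux d) a (i - 1))
        - (1 / 2) * (V i \<bullet> (DJ i - DJ (i - 1)))) / h"
    by (rule divide_right_mono) (use h in simp)
  also have "\<dots> = (high_order p (ec_entropy_flux d) a i - high_order p (ec_entropy_flux d) a (i - 1)) / h
        - (1 / 2) * (V i \<bullet> (DJ i - DJ (i - 1))) / h"
    by (rule diff_divide_distrib)
  also have "\<dots> = V i \<bullet> ((high_order p (ec_flux d) a i - high_order p (ec_flux d) a (i - 1)) /\<^sub>R h)
      + central_diff p h (\<lambda>m. mag (a m) $ dir_idx d) i * phi (a i)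
      - (1 / 2) * (V i \<bullet> (DJ i - DJ (i - 1))) / h"
    using conservative_entropy_balance[where a = a, OF pos h] by (simp add: V_def)
  also have "\<dots> = V i \<bullet> ((num_flux p avg R rec d a i - num_flux p avg R rec d a (i - 1)) /\<^sub>R h
        + central_diff p h (\<lambda>m. mag (a m) $ dir_idx d) i *\<^sub>R phi_grad (a i)
        + Cmat d (a i) *v central_diff p h a i)"
  proof -
    have "num_flux p avg R rec d a i - num_flux p avg R rec d a (i - 1)
        = (high_order p (ec_flux d) a i - high_order p (ec_flux d) a (i - 1)) - (1 / 2) *\<^sub>R (DJ i - DJ (i - 1))"
      by (simp add: num_flux_def DJ_def scaleR_diff_right)
    moreover have "V i \<bullet> (Cmat d (a i) *v central_diff p h a i) = 0" "V i \<bullet> phi_grad (a i) = phi (a i)"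
      unfolding V_def by (rule entropy_var_Cmat[OF mag] entropy_var_phi_grad[OF pos])+
    moreover have "v \<bullet> ((P - (1 / 2) *\<^sub>R D) /\<^sub>R h + c *\<^sub>R g + X) = v \<bullet> (P /\<^sub>R h) + c * (v \<bullet> g) - (1 / 2) * (v \<bullet> D) / h + v \<bullet> X"
      for v P D g X :: "real^9" and c
      by (simp add: inner_add_right inner_diff_right inverse_eq_divide diff_divide_distrib)
    ultimately show ?thesis by (simp only: add_0_right)
  qed
  finally show ?thesis by (simp only: V_def)
qed

lemma entropy_along_curve:
  assumes "U t \<in> pos_states" "(U has_vector_derivative D) (at t within T)"
  shows "((\<lambda>s. entropy (U s)) has_real_derivative entropy_var (U t) \<bullet> D) (at t within T)"
proof -
  have "(entropy has_derivative (\<lambda>h. h \<bullet> entropy_var (U t))) (at (U t))"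
    using entropy_var_gradient[OF assms(1)] by (simp add: gderiv_def)
  from has_derivative_compose[OF assms(2)[unfolded has_vector_derivative_def] this]
  show ?thesis
    by (simp add: has_field_derivative_def inner_commute mult_commute_abs)
qed

lemma scheme_entropy_stable:
  assumes "0 < dx" "0 < dy"
    and U: "\<And>i j. U t i j \<in> Omega"
    and D: "((\<lambda>s. U s i j) has_vector_derivative - spatial_terms p avg R rec dx dy (U t) i j) (at t within T)"
    and R: "\<And>d Ul Ur. Ul \<in> Omega \<Longrightarrow> Ur \<in> Omega \<Longrightarrow>
           entropy_scaled_eigenvectors d (avg Ul Ur) (R d (avg Ul Ur))"
    and sp: "sign_preserving rec"
  shows "\<exists>E'. ((\<lambda>s. entropy (U s i j)) has_real_derivative E') (at t within T) \<and>
           E'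
           + 1 / dx * (num_entropy_flux p avg R rec Xdir (\<lambda>m. U t m j) i
                       - num_entropy_flux p avg R rec Xdir (\<lambda>m. U t m j) (i - 1))
           + 1 / dy * (num_entropy_flux p avg R rec Ydir (U t i) j
                       - num_entropy_flux p avg R rec Ydir (U t i) (j - 1)) \<le> 0"
proof (intro exI conjI)
  have "U t i j \<in> pos_states" using U magnetized_subset by blast
  then show "((\<lambda>s. entropy (U s i j)) has_real_derivative
      entropy_var (U t i j) \<bullet> - spatial_terms p avg R rec dx dy (U t) i j) (at t within T)"
    by (rule entropy_along_curve[where U = "\<lambda>s. U s i j"]) (rule D)
  note x = directional_entropy_inequality[where a = "\<lambda>m. U t m j" and h = dx and avg = avg and R = R
      and rec = rec and p = p and d = Xdir and i = i, OF U assms(1) R sp]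
  note y = directional_entropy_inequality[where a = "U t i" and h = dy and avg = avg and R = R
      and rec = rec and p = p and d = Ydir and i = j, OF U assms(2) R sp]
  show "entropy_var (U t i j) \<bullet> - spatial_terms p avg R rec dx dy (U t) i j
      + 1 / dx * (num_entropy_flux p avg R rec Xdir (\<lambda>m. U t m j) i
                  - num_entropy_flux p avg R rec Xdir (\<lambda>m. U t m j) (i - 1))
      + 1 / dy * (num_entropy_flux p avg R rec Ydir (U t i) j
                  - num_entropy_flux p avg R rec Ydir (U t i) (j - 1)) \<le> 0"
    using x y unfolding spatial_terms_def
    by (simp add: inner_add_right diff_divide_distrib algebra_simps)
qed

section \<open>Consistency of the two-point flux\<close>

definition uniform_O :: "'z set \<Rightarrow> nat \<Rightarrow> ('z \<Rightarrow> real \<Rightarrow> 'b::real_normed_vector) \<Rightarrow> bool" where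
  "uniform_O Z q E \<longleftrightarrow> (\<exists>M. \<exists>\<delta>>0. \<forall>z\<in>Z. \<forall>h. 0 < h \<and> h < \<delta> \<longrightarrow> norm (E z h) \<le> M * h ^ q)"

lemma uniform_OI:
  "0 < \<delta> \<Longrightarrow> (\<And>z h. z \<in> Z \<Longrightarrow> 0 < h \<Longrightarrow> h < \<delta> \<Longrightarrow> norm (E z h) \<le> M * h ^ q) \<Longrightarrow> uniform_O Z q E"
  unfolding uniform_O_def by blast

lemma uniform_OE:
  assumes "uniform_O Z q E"
  obtains M \<delta> where "0 \<le> M" "0 < \<delta>" "\<delta> \<le> 1" "\<And>z h. z \<in> Z \<Longrightarrow> 0 < h \<Longrightarrow> h < \<delta> \<Longrightarrow> norm (E z h) \<le> M * h ^ q"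
proof -
  obtain M \<delta> where *: "0 < \<delta>" "\<And>z h. z \<in> Z \<Longrightarrow> 0 < h \<Longrightarrow> h < \<delta> \<Longrightarrow> norm (E z h) \<le> M * h ^ q"
    using assms unfolding uniform_O_def by blast
  show thesis
  proof (rule that[of "\<bar>M\<bar>" "min \<delta> 1"])
    fix z h assume "z \<in> Z" "0 < h" "h < min \<delta> (1::real)"
    then have "norm (E z h) \<le> M * h ^ q" using *(2) by simp
    also have "\<dots> \<le> \<bar>M\<bar> * h ^ q" using \<open>0 < h\<close> by (intro mult_right_mono) auto
    finally show "norm (E z h) \<le> \<bar>M\<bar> * h ^ q" .
  qed (use *(1) in auto)
qed

lemma uniform_O_cong:
  assumes "uniform_O Z q E" "\<And>z h. z \<in> Z \<Longrightarrow> 0 < h \<Longrightarrow> E' z h = E z h"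
  shows "uniform_O Z q E'"
proof -
  obtain M d where 1: "0 \<le> M" "0 < d" "d \<le> 1" "\<And>z h. z \<in> Z \<Longrightarrow> 0 < h \<Longrightarrow> h < d \<Longrightarrow> norm (E z h) \<le> M * h ^ q"
    using assms(1) by (rule uniform_OE) (rule that)
  show ?thesis by (rule uniform_OI[OF 1(2), of _ _ M]) (use 1(4) assms(2) in simp)
qed

lemma uniform_O_add:
  assumes "uniform_O Z q E" "uniform_O Z q F"
  shows "uniform_O Z q (\<lambda>z h. E z h + F z h)"
proof -
  obtain M d where 1: "0 \<le> M" "0 < d" "d \<le> 1" "\<And>z h. z \<in> Z \<Longrightarrow> 0 < h \<Longrightarrow> h < d \<Longrightarrow> norm (E z h) \<le> M * h ^ q"
    using assms(1) by (rule uniform_OE) (rule that)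
  obtain N e where 2: "0 \<le> N" "0 < e" "e \<le> 1" "\<And>z h. z \<in> Z \<Longrightarrow> 0 < h \<Longrightarrow> h < e \<Longrightarrow> norm (F z h) \<le> N * h ^ q"
    using assms(2) by (rule uniform_OE) (rule that)
  show ?thesis
  proof (rule uniform_OI[of "min d e" _ _ "M + N"])
    fix z h assume "z \<in> Z" "0 < h" "h < min d e"
    then have "norm (E z h) \<le> M * h ^ q" "norm (F z h) \<le> N * h ^ q" by (simp_all add: 1(4) 2(4))
    then show "norm (E z h + F z h) \<le> (M + N) * h ^ q"
      unfolding distrib_right by (intro order_trans[OF norm_triangle_ineq] add_mono)
  qed (use 1(2) 2(2) in simp)
qed

lemma uniform_O_bounded_linear:
  assumes "uniform_O Z q E" "\<And>z h. z \<in> Z \<Longrightarrow> norm (F z h) \<le> K * norm (E z h)"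
  shows "uniform_O Z q F"
proof -
  obtain M d where 1: "0 \<le> M" "0 < d" "d \<le> 1" "\<And>z h. z \<in> Z \<Longrightarrow> 0 < h \<Longrightarrow> h < d \<Longrightarrow> norm (E z h) \<le> M * h ^ q"
    using assms(1) by (rule uniform_OE) (rule that)
  show ?thesis
  proof (rule uniform_OI[OF 1(2), of _ _ "\<bar>K\<bar> * M"])
    fix z h assume z: "z \<in> Z" "0 < h" "h < d"
    have "norm (F z h) \<le> K * norm (E z h)" by (rule assms(2)[OF z(1)])
    also have "\<dots> \<le> \<bar>K\<bar> * norm (E z h)" by (simp add: mult_right_mono)
    also have "\<dots> \<le> \<bar>K\<bar> * (M * h ^ q)" by (intro mult_left_mono 1(4) z) simp
    finally show "norm (F z h) \<le> \<bar>K\<bar> * M * h ^ q" by (simp add: mult.assoc)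
  qed
qed

lemma uniform_O_mono:
  assumes "uniform_O Z q E" "r \<le> q"
  shows "uniform_O Z r E"
proof -
  obtain M d where 1: "0 \<le> M" "0 < d" "d \<le> 1" "\<And>z h. z \<in> Z \<Longrightarrow> 0 < h \<Longrightarrow> h < d \<Longrightarrow> norm (E z h) \<le> M * h ^ q"
    using assms(1) by (rule uniform_OE) (rule that)
  show ?thesis
  proof (rule uniform_OI[OF 1(2)])
    fix z h assume z: "z \<in> Z" "0 < h" "h < d"
    have "norm (E z h) \<le> M * h ^ q" by (rule 1(4)[OF z])
    also have "\<dots> \<le> M * h ^ r" using z 1(1,3) assms(2) by (intro mult_left_mono power_decreasing) auto
    finally show "norm (E z h) \<le> M * h ^ r" .
  qed
qed

lemma uniform_O_sum:
  assumes "finite I" "\<And>i. i \<in> I \<Longrightarrow> uniform_O Z q (E i)"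
  shows "uniform_O Z q (\<lambda>z h. \<Sum>i\<in>I. E i z h)"
  using assms
proof (induction I rule: finite_induct)
  case empty
  show ?case by (rule uniform_OI[of 1 _ _ 0]) auto
next
  case (insert i I)
  then show ?case by (simp add: uniform_O_add)
qed

lemma uniform_O_components:
  fixes E :: "'z \<Rightarrow> real \<Rightarrow> real^'n"
  assumes "\<And>i. uniform_O Z q (\<lambda>z h. E z h $ i)"
  shows "uniform_O Z q E"
proof -
  have "uniform_O Z q (\<lambda>z h. \<bar>E z h $ i\<bar>)" for i
    by (rule uniform_O_bounded_linear[OF assms[of i], where K = 1]) simp
  then have "uniform_O Z q (\<lambda>z h. \<Sum>i\<in>UNIV. \<bar>E z h $ i\<bar>)" by (intro uniform_O_sum) auto
  then show ?thesis
    by (rule uniform_O_bounded_linear[where K = 1])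
       (simp add: norm_le_l1_cart sum_nonneg)
qed

lemma uniform_O_central_slope:
  assumes "expandable Z G" "p \<in> {1, 2}" "\<And>z. z \<in> Z \<Longrightarrow> (G z has_real_derivative D z) (at 0)"
  shows "uniform_O Z (2 * p) (\<lambda>z h. central_slope p h (G z) - D z)"
  using central_slope_error[OF assms] unfolding uniform_O_def by simp

text \<open>First differences serve for the Lipschitz bounds, second differences for the jumps of the trivial reconstruction.\<close>
lemma expandable_increments:
  assumes "expandable Z g"
  shows "uniform_O Z 1 (\<lambda>z h. g z h - g z 0)" "uniform_O Z 1 (\<lambda>z h. g z (- h) - g z 0)"
    "uniform_O Z 2 (\<lambda>z h. g z h - 2 * g z 0 + g z (- h))"
proof -
  obtain k where k: "expandable Z k" "near Z (\<lambda>z s. g z s = g z 0 + s * k z s)"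
    using expandable_factor[OF assms] by blast
  obtain l where l: "expandable Z l" "near Z (\<lambda>z s. k z s = k z 0 + s * l z s)"
    using expandable_factor[OF k(1)] by blast
  have "expands 0 Z k" "expands 0 Z l" using k(1) l(1) by (simp_all add: expandable_def del: expands.simps)
  then obtain M N where MN: "near Z (\<lambda>z s. \<bar>k z s\<bar> \<le> M)" "near Z (\<lambda>z s. \<bar>l z s\<bar> \<le> N)" by auto
  have "near Z (\<lambda>z s. g z s = g z 0 + s * k z s \<and> k z s = k z 0 + s * l z s \<and> \<bar>k z s\<bar> \<le> M \<and> \<bar>l z s\<bar> \<le> N)"
    by (rule near_conj[OF k(2) near_conj[OF l(2) near_conj[OF MN]]])
  then obtain d where d: "d > 0" "\<And>z s. z \<in> Z \<Longrightarrow> \<bar>s\<bar> < d \<Longrightarrow>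
      g z s = g z 0 + s * k z s \<and> k z s = k z 0 + s * l z s \<and> \<bar>k z s\<bar> \<le> M \<and> \<bar>l z s\<bar> \<le> N"
    unfolding near_def by (elim exE conjE) (rule that, assumption, blast)
  show "uniform_O Z 1 (\<lambda>z h. g z h - g z 0)"
  proof (rule uniform_OI[OF d(1), of _ _ M])
    fix z h assume z: "z \<in> Z" "0 < h" "h < d"
    have "g z h - g z 0 = h * k z h" "\<bar>k z h\<bar> \<le> M" using d(2)[of z h] z by auto
    then show "norm (g z h - g z 0) \<le> M * h ^ 1" using z by (simp add: abs_mult)
  qed
  show "uniform_O Z 1 (\<lambda>z h. g z (- h) - g z 0)"
  proof (rule uniform_OI[OF d(1), of _ _ M])
    fix z h assume z: "z \<in> Z" "0 < h" "h < d"
    have "g z (- h) - g z 0 = - (h * k z (- h))" "\<bar>k z (- h)\<bar> \<le> M" using d(2)[of z "- h"] z by auto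
    then show "norm (g z (- h) - g z 0) \<le> M * h ^ 1" using z by (simp add: abs_mult)
  qed
  show "uniform_O Z 2 (\<lambda>z h. g z h - 2 * g z 0 + g z (- h))"
  proof (rule uniform_OI[OF d(1), of _ _ "2 * N"])
    fix z h assume z: "z \<in> Z" "0 < h" "h < d"
    have 1: "g z h = g z 0 + h * (k z 0 + h * l z h)" "\<bar>l z h\<bar> \<le> N" using d(2)[of z h] z by auto
    have 2: "g z (- h) = g z 0 + (- h) * (k z 0 + (- h) * l z (- h))" "\<bar>l z (- h)\<bar> \<le> N"
      using d(2)[of z "- h"] z by auto
    have "g z h - 2 * g z 0 + g z (- h) = (l z h + l z (- h)) * h ^ 2"
      unfolding 1(1) 2(1) by (simp add: power2_eq_square algebra_simps)
    then show "norm (g z h - 2 * g z 0 + g z (- h)) \<le> 2 * N * h ^ 2"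
      unfolding real_norm_def by (rule abs_mult_power_le) (use 1 2 z in auto)
  qed
qed

text \<open>For a symmetric numerical flux: \<open>G\<close> is the flux between the fixed and the moving state, \<open>f\<close> the physical flux at the
  moving state.\<close>
definition consistent_pair :: "'z set \<Rightarrow> ('z \<Rightarrow> real \<Rightarrow> real) \<Rightarrow> ('z \<Rightarrow> real \<Rightarrow> real) \<Rightarrow> bool" where
  "consistent_pair Z G f \<longleftrightarrow> expandable Z G \<and> (\<forall>z\<in>Z. half_slope (G z) (f z))"

lemma consistent_const: "consistent_pair Z (\<lambda>z s. c) (\<lambda>z s. c)"
  by (simp add: consistent_pair_def expandable_const half_slope_const)

lemma consistent_add:
  "consistent_pair Z G f \<Longrightarrow> consistent_pair Z H g \<Longrightarrow>
     consistent_pair Z (\<lambda>z s. G z s + H z s) (\<lambda>z s. f z s + g z s)"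
  by (simp add: consistent_pair_def expandable_add half_slope_add)

lemma consistent_mult:
  "consistent_pair Z G f \<Longrightarrow> consistent_pair Z H g \<Longrightarrow>
     consistent_pair Z (\<lambda>z s. G z s * H z s) (\<lambda>z s. f z s * g z s)"
  by (simp add: consistent_pair_def expandable_mult half_slope_mult)

lemma consistent_diff:
  "consistent_pair Z G f \<Longrightarrow> consistent_pair Z H g \<Longrightarrow>
     consistent_pair Z (\<lambda>z s. G z s - H z s) (\<lambda>z s. f z s - g z s)"
  using consistent_add[OF _ consistent_mult[OF consistent_const[of Z "-1"]], of G f H g] by simp

lemma consistent_divide:
  assumes G: "consistent_pair Z G f" and H: "consistent_pair Z H g" and b: "bounded_below Z g"
  shows "consistent_pair Z (\<lambda>z s. G z s / H z s) (\<lambda>z s. f z s / g z s)"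
proof -
  have "bounded_below Z H" using b H by (simp add: bounded_below_def consistent_pair_def half_slope_def)
  moreover have "g z 0 \<noteq> 0" if "z \<in> Z" for z using b that by (force simp: bounded_below_def)
  ultimately show ?thesis using G H
    by (auto simp: consistent_pair_def expandable_divide divide_inverse[of "_ :: real", symmetric]
        intro: half_slope_mult[OF _ half_slope_inverse, folded divide_inverse])
qed

lemma expandable_has_derivative:
  assumes "expandable Z g" "z \<in> Z"
  shows "\<exists>D. (g z has_real_derivative D) (at 0)"
proof -
  obtain k where k: "expandable Z k" "near Z (\<lambda>z s. g z s = g z 0 + s * k z s)"
    using expandable_factor[OF assms(1)] by blast
  have "expands (Suc 0) Z k" using k(1) by (simp add: expandable_def del: expands.simps)
  from expands_has_derivative[OF k(2) this assms(2)] show ?thesis by blast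
qed

lemma consistent_arithmetic_mean:
  assumes "expandable Z f"
  shows "consistent_pair Z (\<lambda>z s. (f z 0 + f z s) / 2) f"
  unfolding consistent_pair_def
proof (intro conjI ballI)
  show "expandable Z (\<lambda>z s. (f z 0 + f z s) / 2)"
    using expandable_mult[OF expandable_const[of Z "1/2"] expandable_add[OF expandable_freeze[OF assms] assms]] by simp
  show "half_slope (\<lambda>s. (f z 0 + f z s) / 2) (f z)" if "z \<in> Z" for z
    using expandable_has_derivative[OF assms that] half_slope_mean by blast
qed

lemma consistent_log_mean:
  assumes "expandable Z f" "bounded_below Z f"
  shows "consistent_pair Z (\<lambda>z s. log_mean (f z 0) (f z s)) f"
  unfolding consistent_pair_def
proof (intro conjI ballI expandable_log_mean assms)
  fix z assume z: "z \<in> Z"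
  have "f z 0 > 0" using assms(2) z by (force simp: bounded_below_def)
  then show "half_slope (\<lambda>s. log_mean (f z 0) (f z s)) (f z)"
    using expandable_has_derivative[OF assms(1) z] half_slope_log_mean by blast
qed

lemma consistent_cong:
  assumes "consistent_pair Z G f" "\<And>z s. z \<in> Z \<Longrightarrow> G' z s = G z s" "\<And>z s. z \<in> Z \<Longrightarrow> f' z s = f z s"
  shows "consistent_pair Z G' f'"
  unfolding consistent_pair_def
proof (intro conjI ballI)
  show "expandable Z G'"
  proof (rule expandable_cong)
    show "expandable Z G" using assms(1) by (simp add: consistent_pair_def)
    show "near Z (\<lambda>z s. G' z s = G z s)" by (rule near_always) (rule assms(2))
  qed
  fix z assume z: "z \<in> Z"
  have "G' z = G z" "f' z = f z" using assms(2,3)[OF z] by (simp_all add: fun_eq_iff)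
  then show "half_slope (G' z) (f' z)" using assms(1) z by (simp add: consistent_pair_def)
qed

text \<open>Curves \<open>s \<mapsto> w z s\<close> of states through the points of a compact set, with uniform expansions. The compact set gives
  the lower bounds that are needed for divisions.\<close>
definition state_curves :: "'z set \<Rightarrow> ('z \<Rightarrow> real \<Rightarrow> state) \<Rightarrow> bool" where
  "state_curves Z w \<longleftrightarrow> (\<forall>i. expandable Z (\<lambda>z s. w z s $ i)) \<and> (\<forall>z\<in>Z. \<forall>s. w z s \<in> pos_states) \<and>
     (\<exists>C. compact C \<and> C \<subseteq> pos_states \<and> (\<forall>z\<in>Z. w z 0 \<in> C))"

lemma state_curvesE:
  assumes "state_curves Z w"
  obtains C where "compact C" "C \<subseteq> pos_states" "\<And>z. z \<in> Z \<Longrightarrow> w z 0 \<in> C"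
  using assms unfolding state_curves_def by (elim conjE exE) (rule that, auto)

lemma state_curves_expandable:
  assumes "state_curves Z w" "rational_on pos_states g"
  shows "expandable Z (\<lambda>z s. g (w z s))"
  using assms(1)
proof (rule state_curvesE)
  fix C assume C: "compact C" "C \<subseteq> pos_states" "\<And>z. z \<in> Z \<Longrightarrow> w z 0 \<in> C"
  show ?thesis
    by (rule rational_on_expandable[where w = w and Z = Z and C = C, OF assms(2) _ C])
       (use assms(1) in \<open>auto simp: state_curves_def intro: near_always\<close>)
qed

lemma state_curves_bounded_below:
  assumes "state_curves Z w" "rational_on pos_states g" "\<And>U. U \<in> pos_states \<Longrightarrow> g U > 0"
  shows "bounded_below Z (\<lambda>z s. g (w z s))"
  using assms(1)
proof (rule state_curvesE)
  fix C assume C: "compact C" "C \<subseteq> pos_states" "\<And>z. z \<in> Z \<Longrightarrow> w z 0 \<in> C"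
  show ?thesis by (rule rational_on_bounded_below[where w = w and Z = Z and C = C, OF assms(2,3) C])
qed

text \<open>Every component is built from arithmetic and logarithmic means by operations that preserve \<open>consistent_pair\<close>.
  Replacing each mean by its argument yields the physical flux, for the energy component after inserting
  \<open>e = p_perp + \<rho> |u|\<^sup>2 / 2 + |B|\<^sup>2 / 2 + p_par / 2\<close>.\<close>
lemma ec_flux_x_consistent:
  assumes w: "state_curves Z w"
  shows "consistent_pair Z (\<lambda>z s. ec_flux_x (w z 0) (w z s) $ i) (\<lambda>z s. flux Xdir (w z s) $ i)"
proof -
  have pos: "rho U > 0" "beta_perp U > 0" "beta_par U > 0" "p_perp U > 0" "p_par U > 0" if "U \<in> pos_states" for U
    using that by (auto simp: pos_states_def beta_perp_def beta_par_def)
  have m: "consistent_pair Z (\<lambda>z s. mean g (w z 0) (w z s)) (\<lambda>z s. g (w z s))" if "rational_on pos_states g" for g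
    unfolding mean_real by (rule consistent_arithmetic_mean[OF state_curves_expandable[OF w that]])
  have lm: "consistent_pair Z (\<lambda>z s. ln_mean g (w z 0) (w z s)) (\<lambda>z s. g (w z s))"
    if "rational_on pos_states g" "\<And>U. U \<in> pos_states \<Longrightarrow> g U > 0" for g
    unfolding ln_mean_log_mean
    by (rule consistent_log_mean[OF state_curves_expandable[OF w that(1)] state_curves_bounded_below[OF w that]])
  note ux = m[OF rational_vel[of 1]] and uy = m[OF rational_vel[of 2]] and uz = m[OF rational_vel[of 3]]
    and Bx = m[OF rational_mag[of _ 1]] and By = m[OF rational_mag[of _ 2]] and Bz = m[OF rational_mag[of _ 3]]
    and B2 = m[OF rational_norms(2)] and u2 = m[OF rational_norms(1)] and bt = m[OF rational_state_functions(5)]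
    and r = m[OF rational_state_functions(1)]
    and bux = m[OF rational_on.mult[OF rational_state_functions(5) rational_vel[of 1]]]
    and buy = m[OF rational_on.mult[OF rational_state_functions(5) rational_vel[of 2]]]
    and buz = m[OF rational_on.mult[OF rational_state_functions(5) rational_vel[of 3]]]
    and lr = lm[OF rational_state_functions(1) pos(1)]
    and lbt = lm[OF rational_state_functions(5) pos(2)] and lbp = lm[OF rational_state_functions(6) pos(3)]
    and bb = state_curves_bounded_below[OF w rational_state_functions(5) pos(2)]
      state_curves_bounded_below[OF w rational_state_functions(6) pos(3)]
  have two: "bounded_below Z (\<lambda>z s. 2)" by (auto simp: bounded_below_def intro: exI[of _ 2])
  note c = consistent_const
  note half = consistent_divide[OF _ c two]
  note c1 = consistent_mult[OF lr ux]
  note c2 = consistent_diff[OF consistent_add[OF consistent_add[OF consistent_divide[OF r bt bb(1)]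
      consistent_mult[OF ux c1]] half[OF B2]] consistent_mult[OF Bx Bx]]
  note c3 = consistent_diff[OF consistent_mult[OF uy c1] consistent_mult[OF Bx By]]
  note c4 = consistent_diff[OF consistent_mult[OF uz c1] consistent_mult[OF Bx Bz]]
  note c5 = consistent_divide[OF c1 lbp bb(2)]
  note c7 = c[of Z 0]
  note c8 = consistent_divide[OF consistent_diff[OF consistent_mult[OF bux By] consistent_mult[OF buy Bx]] bt bb(1)]
  note c9 = consistent_divide[OF consistent_diff[OF consistent_mult[OF bux Bz] consistent_mult[OF buz Bx]] bt bb(1)]
  note c6 = consistent_add[OF consistent_diff[OF consistent_add[OF consistent_add[OF consistent_add[OF
      consistent_add[OF consistent_add[OF consistent_add[OF consistent_add[OF
        half[OF consistent_mult[OF consistent_diff[OF consistent_divide[OF c[of Z 2] lbt bb(1)] u2] c1]]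
        consistent_mult[OF ux c2]] consistent_mult[OF uy c3]] consistent_mult[OF uz c4]] half[OF c5]]
        consistent_mult[OF Bx c7]] consistent_mult[OF By c8]] consistent_mult[OF Bz c9]]
      half[OF consistent_mult[OF ux B2]]]
      consistent_mult[OF consistent_add[OF consistent_add[OF consistent_mult[OF ux Bx] consistent_mult[OF uy By]]
        consistent_mult[OF uz Bz]] Bx]]
  have W: "w z s \<in> pos_states" if "z \<in> Z" for z s using w that by (simp add: state_curves_def)
  have e: "energy U = p_perp U + rho U * (norm (vel U))\<^sup>2 / 2 + (norm (mag U))\<^sup>2 / 2 + p_par U / 2" for U
    by (simp add: p_perp_def)
  have b: "rho U / beta_perp U = p_perp U" "rho U / beta_par U = p_par U"
    "(beta_perp U * x * y - beta_perp U * x' * y') / beta_perp U = x * y - x' * y'" if "U \<in> pos_states" for U x y x' y'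
    using pos[OF that] by (simp_all add: beta_perp_def beta_par_def field_simps)
  have fx: "flux Xdir U $ 1 = rho U * vel U $ 1"
    "flux Xdir U $ 2 = rho U / beta_perp U + vel U $ 1 * (rho U * vel U $ 1) + (norm (mag U))\<^sup>2 / 2 - mag U $ 1 * mag U $ 1"
    "flux Xdir U $ 3 = vel U $ 2 * (rho U * vel U $ 1) - mag U $ 1 * mag U $ 2"
    "flux Xdir U $ 4 = vel U $ 3 * (rho U * vel U $ 1) - mag U $ 1 * mag U $ 3"
    "flux Xdir U $ 5 = rho U * vel U $ 1 / beta_par U"
    "flux Xdir U $ 7 = 0"
    "flux Xdir U $ 8 = (beta_perp U * vel U $ 1 * mag U $ 2 - beta_perp U * vel U $ 2 * mag U $ 1) / beta_perp U"
    "flux Xdir U $ 9 = (beta_perp U * vel U $ 1 * mag U $ 3 - beta_perp U * vel U $ 3 * mag U $ 1) / beta_perp U"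
    if "U \<in> pos_states" for U
    unfolding b(3)[OF that] using b(1,2)[OF that]
    by (simp_all add: flux_def Let_def vector_9 axis_def algebra_simps flip: times_divide_eq_left times_divide_eq_right)
  have fx6: "flux Xdir U $ 6 = (2 / beta_perp U - (norm (vel U))\<^sup>2) * (rho U * vel U $ 1) / 2
      + vel U $ 1 * (rho U / beta_perp U + vel U $ 1 * (rho U * vel U $ 1) + (norm (mag U))\<^sup>2 / 2 - mag U $ 1 * mag U $ 1)
      + vel U $ 2 * (vel U $ 2 * (rho U * vel U $ 1) - mag U $ 1 * mag U $ 2)
      + vel U $ 3 * (vel U $ 3 * (rho U * vel U $ 1) - mag U $ 1 * mag U $ 3)
      + rho U * vel U $ 1 / beta_par U / 2 + mag U $ 1 * 0
      + mag U $ 2 * ((beta_perp U * vel U $ 1 * mag U $ 2 - beta_perp U * vel U $ 2 * mag U $ 1) / beta_perp U)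
      + mag U $ 3 * ((beta_perp U * vel U $ 1 * mag U $ 3 - beta_perp U * vel U $ 3 * mag U $ 1) / beta_perp U)
      - vel U $ 1 * (norm (mag U))\<^sup>2 / 2
      + (vel U $ 1 * mag U $ 1 + vel U $ 2 * mag U $ 2 + vel U $ 3 * mag U $ 3) * mag U $ 1"
    if "U \<in> pos_states" for U
  proof -
    have 1: "rho U * vel U $ 1 / beta_par U = p_par U * vel U $ 1" using b(2)[OF that, symmetric] by simp
    have 2: "(2 / beta_perp U - (norm (vel U))\<^sup>2) * (rho U * vel U $ 1) / 2
        = p_perp U * vel U $ 1 - (norm (vel U))\<^sup>2 * (rho U * vel U $ 1) / 2"
      using b(1)[OF that, symmetric] by (simp add: algebra_simps diff_divide_distrib)
    show ?thesis unfolding 1 2 b(1,3)[OF that]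
      by (simp add: flux_def Let_def vector_9 e inner_vec_def sum_3 norm_sq_3)
         (simp add: algebra_simps add_divide_distrib diff_divide_distrib power2_eq_square)
  qed
  note fd = ec_flux_x_def Let_def vector_9
  show ?thesis
    using exhaust_9[of i]
  proof (elim disjE)
    assume "i = 1" then show ?thesis by (simp only: fd) (rule consistent_cong[OF c1 refl], (assumption | rule fx(1)[OF W])+)
  next
    assume "i = 2" then show ?thesis by (simp only: fd) (rule consistent_cong[OF c2 refl], (assumption | rule fx(2)[OF W])+)
  next
    assume "i = 3" then show ?thesis by (simp only: fd) (rule consistent_cong[OF c3 refl], (assumption | rule fx(3)[OF W])+)
  next
    assume "i = 4" then show ?thesis by (simp only: fd) (rule consistent_cong[OF c4 refl], (assumption | rule fx(4)[OF W])+)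
  next
    assume "i = 5" then show ?thesis by (simp only: fd) (rule consistent_cong[OF c5 refl], (assumption | rule fx(5)[OF W])+)
  next
    assume "i = 6" then show ?thesis by (simp only: fd) (rule consistent_cong[OF c6 refl], (assumption | rule fx6[OF W])+)
  next
    assume "i = 7" then show ?thesis by (simp only: fd) (rule consistent_cong[OF c7 refl], (assumption | rule fx(6)[OF W])+)
  next
    assume "i = 8" then show ?thesis by (simp only: fd) (rule consistent_cong[OF c8 refl], (assumption | rule fx(7)[OF W])+)
  next
    assume "i = 9" then show ?thesis by (simp only: fd) (rule consistent_cong[OF c9 refl], (assumption | rule fx(8)[OF W])+)
  qed
qed

lemma state_curves_swap:
  assumes "state_curves Z w"
  shows "state_curves Z (\<lambda>z s. swap_xy (w z s))"
proof -
  obtain C where C: "compact C" "C \<subseteq> pos_states" "\<And>z. z \<in> Z \<Longrightarrow> w z 0 \<in> C"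
    using assms by (rule state_curvesE) (rule that)
  have e: "expandable Z (\<lambda>z s. swap_xy (w z s) $ i)" for i
    using exhaust_9[of i] assms by (elim disjE) (simp_all add: swap_xy_nth state_curves_def)
  have "linear swap_xy" by (rule linearI) (simp_all add: vec_eq_9 swap_xy_nth)
  then have "continuous_on C swap_xy" by (rule linear_continuous_on[OF linear_conv_bounded_linear[THEN iffD1]])
  then have "compact (swap_xy ` C)" using C(1) by (rule compact_continuous_image)
  then have "\<exists>C. compact C \<and> C \<subseteq> pos_states \<and> (\<forall>z\<in>Z. swap_xy (w z 0) \<in> C)"
    using C by (intro exI[of _ "swap_xy ` C"]) (auto simp: swap_xy_functions)
  then show ?thesis using e assms by (simp add: state_curves_def swap_xy_functions)
qed

lemma ec_flux_consistent:
  assumes "state_curves Z w"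
  shows "consistent_pair Z (\<lambda>z s. ec_flux d (w z 0) (w z s) $ i) (\<lambda>z s. flux d (w z s) $ i)"
proof (cases d)
  case Xdir then show ?thesis using ec_flux_x_consistent[OF assms] by simp
next
  case Ydir
  note y = ec_flux_x_consistent[OF state_curves_swap[OF assms]]
  show ?thesis unfolding Ydir swap_xy_functions(5) ec_flux.simps
    using exhaust_9[of i] y by (elim disjE) (simp_all only: swap_xy_nth)
qed

section \<open>Truncation error along a grid line\<close>

fun grid_axis :: "dir \<Rightarrow> real \<times> real \<times> real" where
  "grid_axis Xdir = (0, 1, 0)"
| "grid_axis Ydir = (0, 0, 1)"

text \<open>The grid function whose node \<open>i\<close> sits at parameter \<open>0\<close> of the curve \<open>w\<close>.\<close>
definition line_samples :: "(real \<Rightarrow> 'b) \<Rightarrow> real \<Rightarrow> int \<Rightarrow> int \<Rightarrow> 'b" where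
  "line_samples w h i m = w (of_int (m - i) * h)"

lemma line_samples_nth:
  "line_samples w h i i = w 0" "line_samples w h i (i + 1) = w h" "line_samples w h i (i - 1) = w (- h)"
  "line_samples w h i (i + 2) = w (2 * h)" "line_samples w h i (i - 2) = w (- (2 * h))"
  by (simp_all add: line_samples_def)

lemma central_diff_samples:
  fixes f :: "'b \<Rightarrow> real"
  shows "central_diff p h (\<lambda>m. f (line_samples w h i m)) i = central_slope p h (\<lambda>s. f (w s))"
  unfolding central_diff_def central_slope_def line_samples_nth by (simp add: field_simps)

lemma central_diff_nth:
  fixes a :: "int \<Rightarrow> real^'n"
  shows "central_diff p h a i $ k = central_diff p h (\<lambda>m. a m $ k) i"
  by (simp add: central_diff_def)

lemma central_diff_samples_nth:
  fixes w :: "real \<Rightarrow> real^'n"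
  shows "central_diff p h (line_samples w h i) i $ k = central_slope p h (\<lambda>s. w s $ k)"
  unfolding central_diff_nth by (rule central_diff_samples[of p h "\<lambda>v. v $ k"])

lemma flux_difference_samples_nth:
  assumes "0 < h"
  shows "((high_order p (ec_flux d) (line_samples w h i) i - high_order p (ec_flux d) (line_samples w h i) (i - 1)) /\<^sub>R h) $ k
    = 2 * central_slope p h (\<lambda>s. ec_flux d (w 0) (w s) $ k)"
  unfolding high_order_difference[of "ec_flux d", OF ec_flux_commute] line_samples_nth
  using assms by (simp add: central_slope_def field_simps)

lemma has_vector_derivative_components:
  fixes f :: "real \<Rightarrow> real^'n"
  assumes "\<And>k. ((\<lambda>s. f s $ k) has_real_derivative D k) (at x)"
  shows "(f has_vector_derivative (\<chi> k. D k)) (at x)"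
  unfolding has_vector_derivative_def has_derivative_componentwise_within[where f = f]
  using assms by (auto simp: Basis_vec_def inner_axis has_field_derivative_def mult_commute_abs)

lemma has_vector_derivative_shift_iff:
  "((\<lambda>s. f (x + s)) has_vector_derivative D) (at 0) \<longleftrightarrow> (f has_vector_derivative D) (at (x::real))"
proof
  assume "(f has_vector_derivative D) (at x)"
  moreover have "((\<lambda>s. x + s) has_vector_derivative 1) (at 0)"
    by (auto intro!: derivative_eq_intros simp: has_vector_derivative_def)
  ultimately show "((\<lambda>s. f (x + s)) has_vector_derivative D) (at 0)"
    using vector_diff_chain_at[of "\<lambda>s. x + s" 1 0 f D] by (simp add: o_def)
next
  assume "((\<lambda>s. f (x + s)) has_vector_derivative D) (at 0)"
  moreover have "((\<lambda>s. s - x) has_vector_derivative 1) (at x)"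
    by (auto intro!: derivative_eq_intros simp: has_vector_derivative_def)
  ultimately show "(f has_vector_derivative D) (at x)"
    using vector_diff_chain_at[of "\<lambda>s. s - x" 1 x "\<lambda>s. f (x + s)" D] by (simp add: o_def)
qed

lemma vector_derivative_shift: "vector_derivative f (at (x::real)) = vector_derivative (\<lambda>s. f (x + s)) (at 0)"
  by (simp add: vector_derivative_def has_vector_derivative_shift_iff)

lemma deriv_shift: "deriv f (x::real) = deriv (\<lambda>s. f (x + s)) 0"
  using DERIV_shift[of f _ 0 x] by (simp add: deriv_def add.commute)

definition directional_terms ::
  "nat \<Rightarrow> (state \<Rightarrow> state \<Rightarrow> state) \<Rightarrow> (dir \<Rightarrow> state \<Rightarrow> real^9^9) \<Rightarrow> reconstruction \<Rightarrow>
   dir \<Rightarrow> real \<Rightarrow> (int \<Rightarrow> state) \<Rightarrow> int \<Rightarrow> real^9" where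
  "directional_terms p avg R rec d h a i =
     (num_flux p avg R rec d a i - num_flux p avg R rec d a (i - 1)) /\<^sub>R h
     + central_diff p h (\<lambda>m. mag (a m) $ dir_idx d) i *\<^sub>R phi_grad (a i)
     + Cmat d (a i) *v central_diff p h a i"

text \<open>What the terms of the scheme in direction \<open>d\<close> should converge to.\<close>
definition directional_limit :: "dir \<Rightarrow> (real \<Rightarrow> state) \<Rightarrow> real^9" where
  "directional_limit d w = vector_derivative (\<lambda>s. flux d (w s)) (at 0)
     + deriv (\<lambda>s. mag (w s) $ dir_idx d) 0 *\<^sub>R phi_grad (w 0)
     + Cmat d (w 0) *v vector_derivative w (at 0)"

lemma spatial_terms_directional:
  "spatial_terms p avg R rec dx dy U i j
   = directional_terms p avg R rec Xdir dx (\<lambda>m. U m j) i + directional_terms p avg R rec Ydir dy (U i) j"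
  by (simp add: spatial_terms_def directional_terms_def scaleR_add_left)

lemma phi_grad_bounded:
  assumes "compact C" "C \<subseteq> pos_states"
  shows "\<exists>M. \<forall>U\<in>C. norm (phi_grad U) \<le> M"
proof -
  have "\<forall>i. \<exists>m. \<forall>U\<in>C. \<bar>phi_grad U $ i\<bar> \<le> m"
    using rational_on_bounded[OF rational_phi_grad assms] by metis
  then obtain m where m: "\<And>i U. U \<in> C \<Longrightarrow> \<bar>phi_grad U $ i\<bar> \<le> m i" by metis
  have "norm (phi_grad U) \<le> (\<Sum>i\<in>UNIV. m i)" if "U \<in> C" for U
    by (rule order_trans[OF norm_le_l1_cart sum_mono]) (rule m[OF that])
  then show ?thesis by blast
qed

text \<open>All three terms are central differences: of \<open>ec_flux d (w z 0) (w z s)\<close>, with factor two, of \<open>B\<^sub>d\<close> and of the state.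
  The last two are multiplied by coefficients that are bounded on the compact set of states.\<close>
lemma smooth_part_consistent:
  assumes w: "state_curves K w" and C: "compact C" "C \<subseteq> magnetized" "\<And>z. z \<in> K \<Longrightarrow> w z 0 \<in> C"
    and p: "p \<in> {1, 2}"
  obtains E where "uniform_O K (2 * p) E"
    "\<And>z h i. z \<in> K \<Longrightarrow> 0 < h \<Longrightarrow>
      (high_order p (ec_flux d) (line_samples (w z) h i) i - high_order p (ec_flux d) (line_samples (w z) h i) (i - 1)) /\<^sub>R h
      + central_diff p h (\<lambda>m. mag (line_samples (w z) h i m) $ dir_idx d) i *\<^sub>R phi_grad (w z 0)
      + Cmat d (w z 0) *v central_diff p h (line_samples (w z) h i) i
      - directional_limit d (w z) = E z h"
proof -
  define S1 where "S1 z h = ((\<chi> k. 2 * central_slope p h (\<lambda>s. ec_flux d (w z 0) (w z s) $ k)) :: real^9)" for z h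
  define S2 where "S2 z h = central_slope p h (\<lambda>s. mag (w z s) $ dir_idx d)" for z h
  define S3 where "S3 z h = ((\<chi> k. central_slope p h (\<lambda>s. w z s $ k)) :: real^9)" for z h
  define D1 where "D1 z = vector_derivative (\<lambda>s. flux d (w z s)) (at 0)" for z
  define D2 where "D2 z = deriv (\<lambda>s. mag (w z s) $ dir_idx d) 0" for z
  define D3 where "D3 z = vector_derivative (w z) (at 0)" for z
  have e1: "uniform_O K (2 * p) (\<lambda>z h. S1 z h - D1 z)"
  proof (rule uniform_O_components)
    fix k
    note c = ec_flux_consistent[OF w, of d]
    have "\<forall>z\<in>K. \<forall>k. \<exists>D. ((\<lambda>s. ec_flux d (w z 0) (w z s) $ k) has_real_derivative D) (at 0)
        \<and> ((\<lambda>s. flux d (w z s) $ k) has_real_derivative 2 * D) (at 0)"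
      using c by (auto simp: consistent_pair_def half_slope_def)
    then obtain D where D: "\<And>z k. z \<in> K \<Longrightarrow> ((\<lambda>s. ec_flux d (w z 0) (w z s) $ k) has_real_derivative D z k) (at 0)"
        "\<And>z k. z \<in> K \<Longrightarrow> ((\<lambda>s. flux d (w z s) $ k) has_real_derivative 2 * D z k) (at 0)" by metis
    have D1: "D1 z $ k = 2 * D z k" if "z \<in> K" for z
      unfolding D1_def vector_derivative_at[OF has_vector_derivative_components[OF D(2)[OF that]]] by simp
    have "uniform_O K (2 * p) (\<lambda>z h. central_slope p h (\<lambda>s. ec_flux d (w z 0) (w z s) $ k) - D z k)"
      by (rule uniform_O_central_slope[OF _ p D(1)]) (use c in \<open>simp_all add: consistent_pair_def\<close>)
    then show "uniform_O K (2 * p) (\<lambda>z h. (S1 z h - D1 z) $ k)"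
    proof (rule uniform_O_bounded_linear[where K = 2])
      fix z h assume "z \<in> K"
      then have "(S1 z h - D1 z) $ k = 2 * (central_slope p h (\<lambda>s. ec_flux d (w z 0) (w z s) $ k) - D z k)"
        by (simp add: S1_def D1)
      then show "norm ((S1 z h - D1 z) $ k) \<le> 2 * norm (central_slope p h (\<lambda>s. ec_flux d (w z 0) (w z s) $ k) - D z k)"
        by (simp only: norm_mult) simp
    qed
  qed
  have e2: "uniform_O K (2 * p) (\<lambda>z h. S2 z h - D2 z)"
  proof -
    have ex: "expandable K (\<lambda>z s. mag (w z s) $ dir_idx d)" by (rule state_curves_expandable[OF w rational_mag])
    show ?thesis unfolding S2_def
    proof (rule uniform_O_central_slope[OF ex p])
      fix z assume "z \<in> K"
      with expandable_has_derivative[OF ex this]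
      show "((\<lambda>s. mag (w z s) $ dir_idx d) has_real_derivative D2 z) (at 0)"
        unfolding D2_def by (metis DERIV_imp_deriv)
    qed
  qed
  have e3: "uniform_O K (2 * p) (\<lambda>z h. S3 z h - D3 z)"
  proof (rule uniform_O_components)
    fix k
    have ex: "expandable K (\<lambda>z s. w z s $ k)" for k using w by (simp add: state_curves_def)
    have "\<forall>z\<in>K. \<forall>k. \<exists>D. ((\<lambda>s. w z s $ k) has_real_derivative D) (at 0)"
      using expandable_has_derivative[OF ex] by blast
    then obtain D where D: "\<And>z k. z \<in> K \<Longrightarrow> ((\<lambda>s. w z s $ k) has_real_derivative D z k) (at 0)" by metis
    have "D3 z $ k = D z k" if "z \<in> K" for z
      unfolding D3_def vector_derivative_at[OF has_vector_derivative_components[OF D[OF that]]] by simp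
    then show "uniform_O K (2 * p) (\<lambda>z h. (S3 z h - D3 z) $ k)"
      by (intro uniform_O_cong[OF uniform_O_central_slope[OF ex p D]]) (simp_all add: S3_def)
  qed
  have Cpos: "C \<subseteq> pos_states" using C(2) magnetized_subset by blast
  obtain P where P: "\<And>U. U \<in> C \<Longrightarrow> norm (phi_grad U) \<le> P" using phi_grad_bounded[OF C(1) Cpos] by metis
  obtain Q where Q: "\<And>U. U \<in> C \<Longrightarrow> entry_norm (Cmat d U) \<le> Q"
    using rational_matrix_lipschitz[OF rational_Cmat C(1,2)] by metis
  have f2: "uniform_O K (2 * p) (\<lambda>z h. (S2 z h - D2 z) *\<^sub>R phi_grad (w z 0))"
    by (rule uniform_O_bounded_linear[OF e2, where K = P])
       (use P C(3) in \<open>simp add: mult.commute mult_right_mono\<close>)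
  have f3: "uniform_O K (2 * p) (\<lambda>z h. Cmat d (w z 0) *v (S3 z h - D3 z))"
    by (rule uniform_O_bounded_linear[OF e3, where K = Q])
       (use Q C(3) in \<open>auto intro!: order_trans[OF norm_mult_le_entry_norm] mult_right_mono\<close>)
  show thesis
  proof (rule that[OF uniform_O_add[OF uniform_O_add[OF e1 f2] f3]])
    fix z h i assume h: "0 < (h::real)"
    let ?a = "line_samples (w z) h i"
    have "(high_order p (ec_flux d) ?a i - high_order p (ec_flux d) ?a (i - 1)) /\<^sub>R h = S1 z h"
      unfolding S1_def vec_eq_iff flux_difference_samples_nth[OF h] by simp
    moreover have "central_diff p h (\<lambda>m. mag (?a m) $ dir_idx d) i = S2 z h"
      unfolding S2_def by (rule central_diff_samples)
    moreover have "central_diff p h ?a i = S3 z h"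
      unfolding S3_def vec_eq_iff central_diff_samples_nth by simp
    ultimately show "(high_order p (ec_flux d) ?a i - high_order p (ec_flux d) ?a (i - 1)) /\<^sub>R h
      + central_diff p h (\<lambda>m. mag (?a m) $ dir_idx d) i *\<^sub>R phi_grad (w z 0)
      + Cmat d (w z 0) *v central_diff p h ?a i - directional_limit d (w z)
      = S1 z h - D1 z + (S2 z h - D2 z) *\<^sub>R phi_grad (w z 0) + Cmat d (w z 0) *v (S3 z h - D3 z)"
      unfolding directional_limit_def D1_def[symmetric] D2_def[symmetric] D3_def[symmetric]
      by (simp add: scaleR_diff_left matrix_vector_mult_diff_distrib)
  qed
qed

lemma norm_scaleR_inverse_le_iff:
  fixes x :: "'a::real_normed_vector"
  assumes "0 < h"
  shows "norm (x /\<^sub>R h) \<le> c \<longleftrightarrow> norm x \<le> c * h"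
  using pos_divide_le_eq[OF assms, of "norm x" c] assms by (simp add: divide_inverse mult.commute)

text \<open>Uses \<open>D J - D' J' = D (J - J') + (D - D') J'\<close>, where \<open>J\<close> and \<open>J'\<close> are the jumps at the two interfaces of a cell. The
  second term gains a factor \<open>h\<close> since \<open>D\<close> is Lipschitz and the averaged states at the two interfaces are \<open>O(h)\<close> apart.\<close>
lemma diffusive_part_bounded:
  assumes w: "state_curves K w"
    and C: "compact C" "C \<subseteq> Omega" "\<And>z s. z \<in> K \<Longrightarrow> \<bar>s\<bar> \<le> 1 \<Longrightarrow> w z s \<in> C"
    and avg: "averaged_state avg"
    and R: "\<And>d Ul Ur. Ul \<in> Omega \<Longrightarrow> Ur \<in> Omega \<Longrightarrow>
           entropy_scaled_eigenvectors d (avg Ul Ur) (R d (avg Ul Ur))"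
  obtains L \<delta> where "0 < \<delta>"
    "\<And>z h i J J' e. z \<in> K \<Longrightarrow> 0 < h \<Longrightarrow> h < \<delta> \<Longrightarrow> norm J' \<le> e \<Longrightarrow> norm (J - J') \<le> e * h \<Longrightarrow>
      norm ((diff_mat avg R d (line_samples (w z) h i) i *v J
        - diff_mat avg R d (line_samples (w z) h i) (i - 1) *v J') /\<^sub>R h) \<le> L * e"
proof -
  define M where "M = (\<lambda>(Ul, Ur). avg Ul Ur) ` (C \<times> C)"
  have CC: "compact (C \<times> C)" "C \<times> C \<subseteq> Omega \<times> Omega" using C(1,2) by (auto intro: compact_Times)
  obtain La where La: "La-lipschitz_on (C \<times> C) (\<lambda>(Ul, Ur). avg Ul Ur)"
    using avg CC unfolding averaged_state_def by blast
  have cM: "compact M" unfolding M_def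
    by (rule compact_continuous_image[OF lipschitz_on_continuous_on[OF La] CC(1)])
  have M: "M \<subseteq> pos_states" using avg C(2) unfolding averaged_state_def M_def by fastforce
  have "\<exists>S :: real^9^9. invertible S \<and> (\<forall>m. \<exists>c. Amat d U *v column m S = c *s column m S) \<and> dU_dV U = S ** transpose S"
    if U: "U \<in> M" for U
  proof -
    obtain Ul Ur where "Ul \<in> C" "Ur \<in> C" "U = avg Ul Ur" using U by (auto simp: M_def)
    then have "entropy_scaled_eigenvectors d U (R d U)" using R C(2) by blast
    then show ?thesis unfolding entropy_scaled_eigenvectors_def by blast
  qed
  from scaled_diffusion_lipschitz[OF rational_Amat rational_dU_dV cM M this]
  obtain L where L: "0 \<le> L"
    "\<And>U x. U \<in> M \<Longrightarrow> norm ((max_abs_eigenvalue (Amat d U) *\<^sub>R dU_dV U) *v x) \<le> L * norm x"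
    "\<And>U W x. U \<in> M \<Longrightarrow> W \<in> M \<Longrightarrow> norm ((max_abs_eigenvalue (Amat d U) *\<^sub>R dU_dV U) *v x
        - (max_abs_eigenvalue (Amat d W) *\<^sub>R dU_dV W) *v x) \<le> L * dist U W * norm x" by metis
  have inc: "uniform_O K 1 (\<lambda>z h. w z h - w z 0)" "uniform_O K 1 (\<lambda>z h. w z (- h) - w z 0)"
  proof -
    have ex: "expandable K (\<lambda>z s. w z s $ k)" for k using w by (simp add: state_curves_def)
    show "uniform_O K 1 (\<lambda>z h. w z h - w z 0)" "uniform_O K 1 (\<lambda>z h. w z (- h) - w z 0)"
      by (rule uniform_O_components, simp only: vector_minus_component, rule expandable_increments(1,2)[OF ex])+
  qed
  obtain N1 d1 where 1: "0 \<le> N1" "0 < d1" "d1 \<le> 1" "\<And>z h. z \<in> K \<Longrightarrow> 0 < h \<Longrightarrow> h < d1 \<Longrightarrow> norm (w z h - w z 0) \<le> N1 * h ^ 1"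
    using inc(1) by (rule uniform_OE) (rule that)
  obtain N2 d2 where 2: "0 \<le> N2" "0 < d2" "d2 \<le> 1" "\<And>z h. z \<in> K \<Longrightarrow> 0 < h \<Longrightarrow> h < d2 \<Longrightarrow> norm (w z (- h) - w z 0) \<le> N2 * h ^ 1"
    using inc(2) by (rule uniform_OE) (rule that)
  have La0: "0 \<le> La" using La by (rule lipschitz_on_nonneg)
  define N where "N = La * (N1 + N2)"
  show thesis
  proof (rule that[of "min d1 d2" "L + L * N"])
    show "0 < min d1 d2" using 1 2 by simp
    fix z h i and J J' :: "real^9" and e :: real
    assume z: "z \<in> K" and h: "0 < h" "h < min d1 d2" and J: "norm J' \<le> e" "norm (J - J') \<le> e * h"
    have e: "0 \<le> e" using J(1) norm_ge_zero order_trans by blast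
    let ?a = "line_samples (w z) h i"
    have in_C: "w z 0 \<in> C" "w z h \<in> C" "w z (- h) \<in> C" using z h 1(3) by (auto intro!: C(3))
    define U where "U = avg (w z 0) (w z h)"
    define U' where "U' = avg (w z (- h)) (w z 0)"
    have UM: "U \<in> M" "U' \<in> M" unfolding U_def U'_def M_def using in_C by force+
    have D: "diff_mat avg R d ?a i = max_abs_eigenvalue (Amat d U) *\<^sub>R dU_dV U"
      "diff_mat avg R d ?a (i - 1) = max_abs_eigenvalue (Amat d U') *\<^sub>R dU_dV U'"
      unfolding diff_mat_def Let_def using in_C C(2)
      by (simp_all add: line_samples_nth U_def U'_def diffusion_matrix_eq R subset_iff)
    have "dist (w z 0, w z h) (w z (- h), w z 0) \<le> dist (w z 0) (w z (- h)) + dist (w z h) (w z 0)"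
      unfolding dist_Pair_Pair by (rule sqrt_sum_squares_le_sum) auto
    also have "\<dots> \<le> N2 * h + N1 * h"
      using 1(4)[OF z, of h] 2(4)[OF z, of h] h by (simp add: dist_norm norm_minus_commute)
    finally have "La * dist (w z 0, w z h) (w z (- h), w z 0) \<le> La * (N2 * h + N1 * h)"
      by (rule mult_left_mono[OF _ La0])
    moreover have "dist U U' \<le> La * dist (w z 0, w z h) (w z (- h), w z 0)"
      using lipschitz_onD[OF La, of "(w z 0, w z h)" "(w z (- h), w z 0)"] in_C by (simp add: U_def U'_def)
    ultimately have UU: "dist U U' \<le> N * h" by (simp add: N_def algebra_simps)
    have "diff_mat avg R d ?a i *v J - diff_mat avg R d ?a (i - 1) *v J'
        = diff_mat avg R d ?a i *v (J - J') + (diff_mat avg R d ?a i *v J' - diff_mat avg R d ?a (i - 1) *v J')"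
      by (simp add: matrix_vector_mult_diff_distrib)
    also have "norm \<dots> \<le> L * norm (J - J') + L * dist U U' * norm J'"
      unfolding D by (intro order_trans[OF norm_triangle_ineq] add_mono L UM)
    also have "\<dots> \<le> L * (e * h) + L * (N * h) * e"
      by (intro add_mono mult_mono mult_left_mono J UU) (use L(1) h in \<open>auto intro!: mult_nonneg_nonneg order_trans[OF zero_le_dist UU]\<close>)
    finally have "norm (diff_mat avg R d ?a i *v J - diff_mat avg R d ?a (i - 1) *v J') \<le> (L + L * N) * e * h"
      by (simp add: algebra_simps)
    then show "norm ((diff_mat avg R d ?a i *v J - diff_mat avg R d ?a (i - 1) *v J') /\<^sub>R h) \<le> (L + L * N) * e"
      unfolding norm_scaleR_inverse_le_iff[OF h(1)] .
  qed
qed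

lemma trivial_V_jump:
  assumes R: "\<And>d Ul Ur. Ul \<in> Omega \<Longrightarrow> Ur \<in> Omega \<Longrightarrow>
           entropy_scaled_eigenvectors d (avg Ul Ur) (R d (avg Ul Ur))"
    and a: "\<And>m. a m \<in> Omega" and triv: "trivial_reconstruction rec"
  shows "V_jump avg R rec d a i = entropy_var (a (i + 1)) - entropy_var (a i)"
proof -
  have "invertible (transpose (iface_mats avg R d a i))" for i
    using R[OF a a] unfolding iface_mats_def entropy_scaled_eigenvectors_def by (blast intro: invertible_transposeI)
  note inv = matrix_inv_inverse(2)[OF this]
  have "V_hat avg R rec d s a j = entropy_var (a j)" for s j
    unfolding V_hat_def triv[unfolded trivial_reconstruction_def, rule_format] scaled_var_def
      matrix_vector_mul_assoc inv by (rule matrix_vector_mul_lid)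
  then show ?thesis by (simp add: V_jump_def)
qed

lemma entropy_var_expandable:
  assumes w: "state_curves K w"
  shows "expandable K (\<lambda>z s. entropy_var (w z s) $ i)"
proof -
  have pos: "rho U > 0" "beta_perp U > 0" "beta_par U > 0" if "U \<in> pos_states" for U
    using that by (auto simp: pos_states_def beta_perp_def beta_par_def)
  have l: "expandable K (\<lambda>z s. ln (f (w z s)))"
    if "rational_on pos_states f" "\<And>U. U \<in> pos_states \<Longrightarrow> f U > 0" for f
    by (rule expandable_ln[OF state_curves_expandable[OF w that(1)] state_curves_bounded_below[OF w that]])
  have "expandable K (\<lambda>z s. 5 - (0 - ln (beta_par (w z s)) - 2 * ln (beta_perp (w z s)) - 2 * ln (rho (w z s)))
      - beta_perp (w z s) * (norm (vel (w z s)))\<^sup>2)"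
    by (intro expandable_diff expandable_mult expandable_const l
        state_curves_expandable[OF w rational_norms(1)] state_curves_expandable[OF w rational_state_functions(5)]
        rational_state_functions pos)
  then have "expandable K (\<lambda>z s. entropy_var (w z s) $ 1)"
    by (rule expandable_cong, intro near_always)
       (use w in \<open>simp add: state_curves_def entropy_var_def vector_9 spec_entropy_alt\<close>)
  moreover have "expandable K (\<lambda>z s. entropy_var (w z s) $ i)" if "i \<noteq> 1"
    using state_curves_expandable[OF w rational_drop_entropy_var[of i]] that by (simp add: drop_first_nth)
  ultimately show ?thesis by (cases "i = 1") auto
qed

text \<open>For \<open>k \<noteq> 1\<close> the bounds on the jumps are hypotheses, to be supplied by the accuracy of the reconstruction. For
  \<open>k = 1\<close> the jump is \<open>V(h) - V(0)\<close>, of size \<open>O(h)\<close>, and its increment is a second difference, of size \<open>O(h\<^sup>2)\<close>.\<close>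
lemma directional_error:
  assumes w: "state_curves K w"
    and C: "compact C" "C \<subseteq> Omega" "\<And>z s. z \<in> K \<Longrightarrow> \<bar>s\<bar> \<le> 1 \<Longrightarrow> w z s \<in> C"
    and Om: "\<And>z s. z \<in> K \<Longrightarrow> w z s \<in> Omega"
    and avg: "averaged_state avg"
    and R: "\<And>d Ul Ur. Ul \<in> Omega \<Longrightarrow> Ur \<in> Omega \<Longrightarrow>
           entropy_scaled_eigenvectors d (avg Ul Ur) (R d (avg Ul Ur))"
    and p: "p \<in> {1, 2}" "k \<le> 2 * p" and triv: "k = 1 \<Longrightarrow> trivial_reconstruction rec"
  shows "\<exists>M. \<exists>\<delta>>0. \<forall>z\<in>K. \<forall>h i. 0 < h \<and> h < \<delta> \<and>
      (k \<noteq> 1 \<longrightarrow> norm (V_jump avg R rec d (line_samples (w z) h i) (i - 1)) \<le> B * h ^ k \<and>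
        norm (V_jump avg R rec d (line_samples (w z) h i) i - V_jump avg R rec d (line_samples (w z) h i) (i - 1))
          \<le> B * h ^ k * h) \<longrightarrow>
      norm (directional_terms p avg R rec d h (line_samples (w z) h i) i - directional_limit d (w z)) \<le> M * h ^ k"
proof -
  have Cm: "C \<subseteq> magnetized" using C(2) magnetized_subset by blast
  have w0: "w z 0 \<in> C" if "z \<in> K" for z using C(3)[OF that, of 0] by simp
  obtain E where E: "uniform_O K (2 * p) E"
    "\<And>z h i. z \<in> K \<Longrightarrow> 0 < h \<Longrightarrow>
      (high_order p (ec_flux d) (line_samples (w z) h i) i - high_order p (ec_flux d) (line_samples (w z) h i) (i - 1)) /\<^sub>R h
      + central_diff p h (\<lambda>m. mag (line_samples (w z) h i m) $ dir_idx d) i *\<^sub>R phi_grad (w z 0)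
      + Cmat d (w z 0) *v central_diff p h (line_samples (w z) h i) i
      - directional_limit d (w z) = E z h"
    using smooth_part_consistent[where d = d, OF w C(1) Cm w0 p(1)] by metis
  obtain M1 d1 where M1: "0 \<le> M1" "0 < d1" "d1 \<le> 1" "\<And>z h. z \<in> K \<Longrightarrow> 0 < h \<Longrightarrow> h < d1 \<Longrightarrow> norm (E z h) \<le> M1 * h ^ k"
    using uniform_O_mono[OF E(1) p(2)] by (rule uniform_OE) (rule that)
  obtain L d2 where L: "0 < d2" "\<And>z h i J J' e. z \<in> K \<Longrightarrow> 0 < h \<Longrightarrow> h < d2 \<Longrightarrow> norm J' \<le> e \<Longrightarrow> norm (J - J') \<le> e * h \<Longrightarrow>
      norm ((diff_mat avg R d (line_samples (w z) h i) i *v J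
        - diff_mat avg R d (line_samples (w z) h i) (i - 1) *v J') /\<^sub>R h) \<le> L * e"
    using diffusive_part_bounded[where w = w and d = d and avg = avg and R = R, OF w C avg R] by metis
  let ?V = "\<lambda>z s. entropy_var (w z s)"
  have "uniform_O K 1 (\<lambda>z h. ?V z (- h) - ?V z 0)" "uniform_O K 2 (\<lambda>z h. ?V z h - 2 *\<^sub>R ?V z 0 + ?V z (- h))"
    by (rule uniform_O_components,
        simp only: vector_minus_component vector_add_component vector_scaleR_component real_scaleR_def,
        rule expandable_increments(2,3)[OF entropy_var_expandable[OF w]])+
  then obtain N1 N2 e1 e2 where
    N1: "0 \<le> N1" "0 < e1" "e1 \<le> 1" "\<And>z h. z \<in> K \<Longrightarrow> 0 < h \<Longrightarrow> h < e1 \<Longrightarrow> norm (?V z (- h) - ?V z 0) \<le> N1 * h ^ 1"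
    and N2: "0 \<le> N2" "0 < e2" "e2 \<le> 1"
      "\<And>z h. z \<in> K \<Longrightarrow> 0 < h \<Longrightarrow> h < e2 \<Longrightarrow> norm (?V z h - 2 *\<^sub>R ?V z 0 + ?V z (- h)) \<le> N2 * h ^ 2"
    by (elim uniform_OE) (rule that)
  \<comment> \<open>A single constant bounds the jumps in both cases.\<close>
  define B' where "B' = (if k = 1 then N1 + N2 else B)"
  show ?thesis
  proof (rule exI[of _ "M1 + \<bar>L * B'\<bar> / 2"], rule exI[of _ "min (min d1 d2) (min e1 e2)"], intro conjI ballI allI impI)
    show "0 < min (min d1 d2) (min e1 e2)" using M1 L(1) N1 N2 by simp
    fix z h i
    let ?a = "line_samples (w z) h i"
    let ?J = "\<lambda>m. V_jump avg R rec d ?a m"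
    assume z: "z \<in> K" and "0 < h \<and> h < min (min d1 d2) (min e1 e2) \<and>
      (k \<noteq> 1 \<longrightarrow> norm (?J (i - 1)) \<le> B * h ^ k \<and> norm (?J i - ?J (i - 1)) \<le> B * h ^ k * h)"
    then have h: "0 < h" "h < d1" "h < d2" "h < e1" "h < e2"
      and J: "k \<noteq> 1 \<Longrightarrow> norm (?J (i - 1)) \<le> B * h ^ k \<and> norm (?J i - ?J (i - 1)) \<le> B * h ^ k * h" by auto
    have jumps: "norm (?J (i - 1)) \<le> B' * h ^ k \<and> norm (?J i - ?J (i - 1)) \<le> B' * h ^ k * h"
    proof (cases "k = 1")
      case True
      have a: "?a m \<in> Omega" for m by (simp add: line_samples_def Om[OF z])
      have Jm: "?J m = entropy_var (?a (m + 1)) - entropy_var (?a m)" for m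
        by (rule trivial_V_jump[where a = ?a and avg = avg and R = R and rec = rec, OF R a triv[OF True]])
      have 1: "?J (i - 1) = - (?V z (- h) - ?V z 0)" using Jm[of "i - 1"] by (simp add: line_samples_nth)
      have 2: "?J i - ?J (i - 1) = ?V z h - 2 *\<^sub>R ?V z 0 + ?V z (- h)"
        using Jm[of i] 1 by (simp add: line_samples_nth scaleR_2)
      have "norm (?J (i - 1)) \<le> N1 * h" using N1(4)[OF z h(1,4)] unfolding 1 norm_minus_cancel by simp
      also have "\<dots> \<le> (N1 + N2) * h" using N2(1) h(1) by simp
      finally have 3: "norm (?J (i - 1)) \<le> (N1 + N2) * h" .
      have "norm (?J i - ?J (i - 1)) \<le> N2 * h ^ 2" using N2(4)[OF z h(1,5)] unfolding 2 .
      also have "\<dots> \<le> (N1 + N2) * h ^ 2" using N1(1) h(1) by (intro mult_right_mono) auto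
      finally show ?thesis using 3 True by (simp add: B'_def power2_eq_square mult.assoc)
    qed (use J in \<open>simp add: B'_def\<close>)
    define X where "X = (diff_mat avg R d ?a i *v ?J i - diff_mat avg R d ?a (i - 1) *v ?J (i - 1)) /\<^sub>R h"
    have "norm X \<le> L * (B' * h ^ k)"
      unfolding X_def by (rule L(2)[OF z h(1,3)]) (use jumps in auto)
    also have "\<dots> \<le> \<bar>L * B'\<bar> * h ^ k" using h(1) by (simp flip: mult.assoc add: mult_right_mono)
    finally have X: "norm X \<le> \<bar>L * B'\<bar> * h ^ k" .
    have "directional_terms p avg R rec d h ?a i - directional_limit d (w z) = E z h - (1 / 2) *\<^sub>R X"
      unfolding E(2)[OF z h(1), of i, symmetric] directional_terms_def num_flux_def X_def line_samples_nth(1)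
      by (simp add: scaleR_diff_right algebra_simps)
    then have "norm (directional_terms p avg R rec d h ?a i - directional_limit d (w z)) \<le> norm (E z h) + norm ((1 / 2) *\<^sub>R X)"
      by (simp only: norm_triangle_ineq4)
    also have "\<dots> \<le> M1 * h ^ k + \<bar>L * B'\<bar> * h ^ k / 2" using M1(4)[OF z h(1,2)] X by simp
    finally show "norm (directional_terms p avg R rec d h ?a i - directional_limit d (w z)) \<le> (M1 + \<bar>L * B'\<bar> / 2) * h ^ k"
      by (simp add: algebra_simps)
  qed
qed

text \<open>Both traces at an interface approximate the same value, and their differences across the cell the same
  difference; hence a factor two.\<close>
lemma accurate_traces_jumps:
  assumes "accurate_traces avg R rec C k d x0 h w i" "0 < h"
  defines "a \<equiv> \<lambda>m. w (node x0 h m)"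
  shows "norm (V_jump avg R rec d a (i - 1)) \<le> 2 * C * h ^ k"
    and "norm (V_jump avg R rec d a i - V_jump avg R rec d a (i - 1)) \<le> 2 * C * h ^ k * h"
proof -
  define tr where "tr s = V_trace avg R rec d s a" for s
  define vl vr where "vl = entropy_var (w (node x0 h i - h / 2))" and "vr = entropy_var (w (node x0 h i + h / 2))"
  have 1: "norm (tr s (i - 1) - vl) \<le> C * h ^ k" and 2: "norm ((tr s i - tr s (i - 1)) /\<^sub>R h - (vr - vl) /\<^sub>R h) \<le> C * h ^ k" for s
    using assms(1) unfolding accurate_traces_def Let_def tr_def vl_def vr_def a_def by auto
  have J: "V_jump avg R rec d a m = tr Minus m - tr Plus m" for m
    by (simp add: V_jump_def tr_def V_trace_def)
  have "V_jump avg R rec d a (i - 1) = (tr Minus (i - 1) - vl) - (tr Plus (i - 1) - vl)" by (simp add: J)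
  also have "norm \<dots> \<le> C * h ^ k + C * h ^ k" by (rule order_trans[OF norm_triangle_ineq4 add_mono[OF 1 1]])
  finally show "norm (V_jump avg R rec d a (i - 1)) \<le> 2 * C * h ^ k" by simp
  have "(V_jump avg R rec d a i - V_jump avg R rec d a (i - 1)) /\<^sub>R h
      = ((tr Minus i - tr Minus (i - 1)) /\<^sub>R h - (vr - vl) /\<^sub>R h) - ((tr Plus i - tr Plus (i - 1)) /\<^sub>R h - (vr - vl) /\<^sub>R h)"
    by (simp add: J scaleR_diff_right)
  also have "norm \<dots> \<le> C * h ^ k + C * h ^ k" by (rule order_trans[OF norm_triangle_ineq4 add_mono[OF 2 2]])
  finally have "norm ((V_jump avg R rec d a i - V_jump avg R rec d a (i - 1)) /\<^sub>R h) \<le> 2 * C * h ^ k" by simp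
  then show "norm (V_jump avg R rec d a i - V_jump avg R rec d a (i - 1)) \<le> 2 * C * h ^ k * h"
    unfolding norm_scaleR_inverse_le_iff[OF assms(2)] .
qed

definition solution_line :: "(real \<times> real \<times> real \<Rightarrow> state) \<Rightarrow> dir \<Rightarrow> real \<times> real \<times> real \<Rightarrow> real \<Rightarrow> state" where
  "solution_line U d z s = U (z + s *\<^sub>R grid_axis d)"

lemma solution_line_samples_X:
  "(\<lambda>m. U (t, node x0 h m, y)) = line_samples (solution_line U Xdir (t, node x0 h i, y)) h i"
  by (simp add: fun_eq_iff line_samples_def solution_line_def node_def algebra_simps)

lemma solution_line_samples_Y:
  "(\<lambda>m. U (t, x, node y0 h m)) = line_samples (solution_line U Ydir (t, x, node y0 h j)) h j"
  by (simp add: fun_eq_iff line_samples_def solution_line_def node_def algebra_simps)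

lemma solution_line_properties:
  assumes U: "smooth_solution U T" and K: "compact K" "K \<subseteq> T \<times> UNIV \<times> UNIV"
  shows "state_curves K (solution_line U d)"
    and "\<And>z s. z \<in> K \<Longrightarrow> solution_line U d z s \<in> Omega"
    and "\<exists>C. compact C \<and> C \<subseteq> Omega \<and> (\<forall>z\<in>K. \<forall>s. \<bar>s\<bar> \<le> 1 \<longrightarrow> solution_line U d z s \<in> C)"
proof -
  have sm: "smooth_on U (T \<times> UNIV \<times> UNIV)" using U by (simp add: smooth_solution_def)
  have dom: "z + s *\<^sub>R grid_axis d \<in> T \<times> UNIV \<times> UNIV" if "z \<in> K" for z s
    using that K(2) by (cases d) auto
  show Om: "solution_line U d z s \<in> Omega" if "z \<in> K" for z s
    using dom[OF that, of s] U unfolding solution_line_def smooth_solution_def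
    by (cases "z + s *\<^sub>R grid_axis d") auto
  have cont: "continuous_on (T \<times> UNIV \<times> UNIV) U"
    using sm unfolding smooth_on_def by (metis Ck_on.simps(1))
  define P where "P = (\<lambda>(z, s). z + s *\<^sub>R grid_axis d) ` (K \<times> {-1..1::real})"
  have "compact P" unfolding P_def
    by (rule compact_continuous_image) (auto intro!: continuous_intros compact_Times K(1) simp: case_prod_unfold)
  moreover have PT: "P \<subseteq> T \<times> UNIV \<times> UNIV"
    unfolding P_def by (rule image_subsetI) (use dom in \<open>simp only: case_prod_unfold mem_Times_iff\<close>)
  ultimately have "compact (U ` P)" using cont compact_continuous_image continuous_on_subset by metis
  moreover have "U ` P \<subseteq> Omega" using Om by (auto simp: P_def solution_line_def)
  moreover have "\<forall>z\<in>K. \<forall>s. \<bar>s\<bar> \<le> 1 \<longrightarrow> solution_line U d z s \<in> U ` P"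
    unfolding solution_line_def P_def by force
  ultimately show C: "\<exists>C. compact C \<and> C \<subseteq> Omega \<and> (\<forall>z\<in>K. \<forall>s. \<bar>s\<bar> \<le> 1 \<longrightarrow> solution_line U d z s \<in> C)" by blast
  then obtain C where "compact C" "C \<subseteq> Omega" "\<forall>z\<in>K. solution_line U d z 0 \<in> C" by force
  moreover have "Omega \<subseteq> pos_states" using magnetized_subset by blast
  moreover have "grid_axis d \<in> Basis" by (cases d) (auto simp: Basis_prod_def zero_prod_def)
  ultimately show "state_curves K (solution_line U d)"
    using smooth_line_expandable[OF sm K(1) _ dom] Om unfolding state_curves_def solution_line_def by blast
qed

lemma solves_pde_directional:
  assumes "solves_pde_at U t x y"
  shows "vector_derivative (\<lambda>s. U (s, x, y)) (at t)
    = - (directional_limit Xdir (solution_line U Xdir (t, x, y)) + directional_limit Ydir (solution_line U Ydir (t, x, y)))"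
  using assms unfolding solves_pde_at_def directional_limit_def solution_line_def
    vector_derivative_shift[of _ x] vector_derivative_shift[of _ y] deriv_shift[of _ x] deriv_shift[of _ y]
  by (simp add: scaleR_add_left algebra_simps eq_neg_iff_add_eq_0)

lemma scheme_accurate:
  assumes k: "k \<in> {1, 2, 3, 4}" and p: "p = (if k \<in> {1, 2} then 1 else 2)"
    and avg: "averaged_state avg"
    and R: "\<And>d Ul Ur. Ul \<in> Omega \<Longrightarrow> Ur \<in> Omega \<Longrightarrow>
           entropy_scaled_eigenvectors d (avg Ul Ur) (R d (avg Ul Ur))"
    and triv: "k = 1 \<Longrightarrow> trivial_reconstruction rec"
    and U: "smooth_solution U T" and K: "compact K" "K \<subseteq> T \<times> UNIV \<times> UNIV"
    and rec: "k \<noteq> 1 \<Longrightarrow> accurate_reconstruction avg R rec k x0 y0 U K"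
  shows "\<exists>C. \<exists>\<delta>>0. \<forall>dx dy t i j.
           0 < dx \<and> dx < \<delta> \<and> 0 < dy \<and> dy < \<delta> \<and> (t, node x0 dx i, node y0 dy j) \<in> K \<longrightarrow>
           norm (truncation_error p avg R rec x0 y0 dx dy U t i j) \<le> C * (dx ^ k + dy ^ k)"
proof -
  have p12: "p \<in> {1, 2}" "k \<le> 2 * p" using k p by auto
  let ?acc = "\<lambda>B dx dy t i j. accurate_traces avg R rec B k Xdir x0 dx (\<lambda>\<xi>. U (t, \<xi>, node y0 dy j)) i \<and>
        accurate_traces avg R rec B k Ydir y0 dy (\<lambda>\<eta>. U (t, node x0 dx i, \<eta>)) j"
  have "\<exists>B. \<exists>\<delta>>0. k \<noteq> 1 \<longrightarrow> (\<forall>dx dy t i j.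
        0 < dx \<and> dx < \<delta> \<and> 0 < dy \<and> dy < \<delta> \<and> (t, node x0 dx i, node y0 dy j) \<in> K \<longrightarrow> ?acc B dx dy t i j)"
  proof (cases "k = 1")
    case False
    then show ?thesis using rec[OF False] unfolding accurate_reconstruction_def by simp
  next
    case True
    then show ?thesis by (intro exI[of _ 0] exI[of _ 1]) simp
  qed
  then obtain B \<delta> where B: "\<delta> > 0" "k \<noteq> 1 \<longrightarrow> (\<forall>dx dy t i j.
        0 < dx \<and> dx < \<delta> \<and> 0 < dy \<and> dy < \<delta> \<and> (t, node x0 dx i, node y0 dy j) \<in> K \<longrightarrow> ?acc B dx dy t i j)"
    by (elim exE conjE) (rule that)
  let ?J = "\<lambda>d z h i. V_jump avg R rec d (line_samples (solution_line U d z) h i)"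
  let ?accurate = "\<lambda>d M \<delta>. \<forall>z\<in>K. \<forall>h i. 0 < h \<and> h < \<delta> \<and>
      (k \<noteq> 1 \<longrightarrow> norm (?J d z h i (i - 1)) \<le> 2 * B * h ^ k \<and>
        norm (?J d z h i i - ?J d z h i (i - 1)) \<le> 2 * B * h ^ k * h) \<longrightarrow>
      norm (directional_terms p avg R rec d h (line_samples (solution_line U d z) h i) i
        - directional_limit d (solution_line U d z)) \<le> M * h ^ k"
  have dir: "\<exists>M. \<exists>\<delta>>0. ?accurate d M \<delta>" for d
  proof -
    obtain C where C: "compact C" "C \<subseteq> Omega" "\<And>z s. z \<in> K \<Longrightarrow> \<bar>s\<bar> \<le> 1 \<Longrightarrow> solution_line U d z s \<in> C"
      using solution_line_properties(3)[OF U K, of d] by (elim exE conjE) (rule that, auto)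
    show ?thesis
      by (rule directional_error[where w = "solution_line U d", OF solution_line_properties(1)[OF U K] C
            solution_line_properties(2)[OF U K] avg R p12 triv])
  qed
  obtain M1 d1 where X: "d1 > 0" "?accurate Xdir M1 d1" using dir[of Xdir] by (elim exE conjE) (rule that)
  obtain M2 d2 where Y: "d2 > 0" "?accurate Ydir M2 d2" using dir[of Ydir] by (elim exE conjE) (rule that)
  show ?thesis
  proof (rule exI[of _ "\<bar>M1\<bar> + \<bar>M2\<bar>"], rule exI[of _ "min \<delta> (min d1 d2)"], intro conjI allI impI)
    show "0 < min \<delta> (min d1 d2)" using B(1) X(1) Y(1) by simp
    fix dx dy t i j
    assume *: "0 < dx \<and> dx < min \<delta> (min d1 d2) \<and> 0 < dy \<and> dy < min \<delta> (min d1 d2) \<and> (t, node x0 dx i, node y0 dy j) \<in> K"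
    let ?z = "(t, node x0 dx i, node y0 dy j)"
    let ?ax = "line_samples (solution_line U Xdir ?z) dx i" and ?ay = "line_samples (solution_line U Ydir ?z) dy j"
    have dx: "0 < dx" "dx < \<delta>" "dx < d1" and dy: "0 < dy" "dy < \<delta>" "dy < d2" and z: "?z \<in> K" using * by auto
    have sx: "(\<lambda>m. U (t, node x0 dx m, node y0 dy j)) = ?ax" by (rule solution_line_samples_X)
    have sy: "(\<lambda>n. U (t, node x0 dx i, node y0 dy n)) = ?ay" by (rule solution_line_samples_Y)
    have acc: "?acc B dx dy t i j" if "k \<noteq> 1"
      by (rule B(2)[rule_format, OF that]) (use dx dy z in simp)
    have jx: "norm (V_jump avg R rec Xdir ?ax (i - 1)) \<le> 2 * B * dx ^ k \<and>
        norm (V_jump avg R rec Xdir ?ax i - V_jump avg R rec Xdir ?ax (i - 1)) \<le> 2 * B * dx ^ k * dx" if "k \<noteq> 1"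
      using accurate_traces_jumps[OF conjunct1[OF acc[OF that]] dx(1)] unfolding sx by (rule conjI)
    have jy: "norm (V_jump avg R rec Ydir ?ay (j - 1)) \<le> 2 * B * dy ^ k \<and>
        norm (V_jump avg R rec Ydir ?ay j - V_jump avg R rec Ydir ?ay (j - 1)) \<le> 2 * B * dy ^ k * dy" if "k \<noteq> 1"
      using accurate_traces_jumps[OF conjunct2[OF acc[OF that]] dy(1)] unfolding sy by (rule conjI)
    define X' where "X' = directional_terms p avg R rec Xdir dx ?ax i - directional_limit Xdir (solution_line U Xdir ?z)"
    define Y' where "Y' = directional_terms p avg R rec Ydir dy ?ay j - directional_limit Ydir (solution_line U Ydir ?z)"
    have nx: "norm X' \<le> M1 * dx ^ k"
      unfolding X'_def by (rule X(2)[rule_format, OF z]) (intro conjI impI dx jx)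
    have ny: "norm Y' \<le> M2 * dy ^ k"
      unfolding Y'_def by (rule Y(2)[rule_format, OF z]) (intro conjI impI dy jy)
    have "solves_pde_at U t (node x0 dx i) (node y0 dy j)" using U K(2) z by (auto simp: smooth_solution_def)
    from solves_pde_directional[OF this]
    have "truncation_error p avg R rec x0 y0 dx dy U t i j = X' + Y'"
      unfolding truncation_error_def spatial_terms_directional sx sy X'_def Y'_def by simp
    then have "norm (truncation_error p avg R rec x0 y0 dx dy U t i j) \<le> M1 * dx ^ k + M2 * dy ^ k"
      using order_trans[OF norm_triangle_ineq add_mono[OF nx ny]] by simp
    also have "\<dots> \<le> (\<bar>M1\<bar> + \<bar>M2\<bar>) * dx ^ k + (\<bar>M1\<bar> + \<bar>M2\<bar>) * dy ^ k"
      using dx dy by (intro add_mono mult_right_mono) auto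
    finally show "norm (truncation_error p avg R rec x0 y0 dx dy U t i j) \<le> (\<bar>M1\<bar> + \<bar>M2\<bar>) * (dx ^ k + dy ^ k)"
      by (simp add: distrib_left)
  qed
qed

theorem theorem4p4:
  fixes k p :: nat
    and avg :: "state \<Rightarrow> state \<Rightarrow> state"
    and R :: "dir \<Rightarrow> state \<Rightarrow> real^9^9"
    and rec :: reconstruction
  assumes "k \<in> {1, 2, 3, 4}"
    and "p = (if k \<in> {1, 2} then 1 else 2)"
    and "averaged_state avg"
    and "\<And>d Ul Ur. Ul \<in> Omega \<Longrightarrow> Ur \<in> Omega \<Longrightarrow>
           entropy_scaled_eigenvectors d (avg Ul Ur) (R d (avg Ul Ur))"
    and "sign_preserving rec"
    and "k = 1 \<Longrightarrow> trivial_reconstruction rec"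
  shows
    "(\<forall>(U :: real \<times> real \<times> real \<Rightarrow> state) T x0 y0 K.
        smooth_solution U T \<and> compact K \<and> K \<subseteq> T \<times> UNIV \<times> UNIV \<and>
        (k \<noteq> 1 \<longrightarrow> accurate_reconstruction avg R rec k x0 y0 U K) \<longrightarrow>
        (\<exists>C. \<exists>\<delta>>0. \<forall>dx dy t i j.
           0 < dx \<and> dx < \<delta> \<and> 0 < dy \<and> dy < \<delta> \<and> (t, node x0 dx i, node y0 dy j) \<in> K \<longrightarrow>
           norm (truncation_error p avg R rec x0 y0 dx dy U t i j) \<le> C * (dx ^ k + dy ^ k)))
     \<and>
     (\<forall>(U :: real \<Rightarrow> int \<Rightarrow> int \<Rightarrow> state) T dx dy.
        0 < dx \<and> 0 < dy \<and> is_interval T \<and>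
        (\<forall>t\<in>T. \<forall>i j. U t i j \<in> Omega \<and>
           ((\<lambda>s. U s i j) has_vector_derivative
              - spatial_terms p avg R rec dx dy (U t) i j) (at t within T)) \<longrightarrow>
        (\<forall>t\<in>T. \<forall>i j. \<exists>E'.
           ((\<lambda>s. entropy (U s i j)) has_real_derivative E') (at t within T) \<and>
           E'
           + 1 / dx * (num_entropy_flux p avg R rec Xdir (\<lambda>m. U t m j) i
                       - num_entropy_flux p avg R rec Xdir (\<lambda>m. U t m j) (i - 1))
           + 1 / dy * (num_entropy_flux p avg R rec Ydir (U t i) j
                       - num_entropy_flux p avg R rec Ydir (U t i) (j - 1)) \<le> 0))"
proof (rule conjI, goal_cases)
  case 1
  show ?case
  proof (intro allI impI, elim conjE)
    fix U T x0 y0 K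
    assume "smooth_solution U T" "compact K" "K \<subseteq> T \<times> UNIV \<times> UNIV"
      and "k \<noteq> 1 \<longrightarrow> accurate_reconstruction avg R rec k x0 y0 U K"
    then show "\<exists>C. \<exists>\<delta>>0. \<forall>dx dy t i j.
           0 < dx \<and> dx < \<delta> \<and> 0 < dy \<and> dy < \<delta> \<and> (t, node x0 dx i, node y0 dy j) \<in> K \<longrightarrow>
           norm (truncation_error p avg R rec x0 y0 dx dy U t i j) \<le> C * (dx ^ k + dy ^ k)"
      by (intro scheme_accurate[OF assms(1-4,6)]) simp_all
  qed
next
  case 2
  show ?case
  proof (intro allI impI ballI, elim conjE)
    fix U :: "real \<Rightarrow> int \<Rightarrow> int \<Rightarrow> state" and T dx dy t i j
    assume "0 < dx" "0 < dy" "t \<in> T"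
      and sol: "\<forall>t\<in>T. \<forall>i j. U t i j \<in> Omega \<and>
           ((\<lambda>s. U s i j) has_vector_derivative
              - spatial_terms p avg R rec dx dy (U t) i j) (at t within T)"
    show "\<exists>E'. ((\<lambda>s. entropy (U s i j)) has_real_derivative E') (at t within T) \<and>
           E'
           + 1 / dx * (num_entropy_flux p avg R rec Xdir (\<lambda>m. U t m j) i
                       - num_entropy_flux p avg R rec Xdir (\<lambda>m. U t m j) (i - 1))
           + 1 / dy * (num_entropy_flux p avg R rec Ydir (U t i) j
                       - num_entropy_flux p avg R rec Ydir (U t i) (j - 1)) \<le> 0"
      by (rule scheme_entropy_stable[where U = U and t = t and T = T and i = i and j = j and p = p
            and avg = avg and R = R and rec = rec, OF \<open>0 < dx\<close> \<open>0 < dy\<close> _ _ assms(4,5)])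
         (use sol \<open>t \<in> T\<close> in auto)
  qed
qed

end
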